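(* For each $p$ let $X\in\mathbb{R}^{n\times p}$ ($n=n(p)$) have columns in general position, and let $y\in\mathbb{R}^n$ be drawn from the model $y=X\beta^*+\varepsilon$, $\varepsilon\sim N(0,\sigma^2I)$, with $\sigma^2>0$ fixed. Assume that for a fixed integer $k_0\ge0$, a fixed subset $A_0\subseteq\{1,\ldots,p\}$ with $A_0\supseteq A^*=\operatorname{supp}(\beta^* )$, and a fixed sign vector $s_{A_0}\in\{-1,1\}^{|A_0|}$, the event $B$ (defined in the context in terms of $k_0,A_0,s_{A_0}$) satisfies $\mathbb{P}(B)\to1$ as $p\to\infty$. Assume that there exists a constant $0<\eta\le1$ such that $$\|(X_{A_0})^+X_j\|_1\le1-\eta\quad\text{for all }j\notin A_0.$$ Define the matrix $R$ by $R_{ij}=X_i^T(I-P_{A_0})X_j$ for $i,j\notin A_0$. Assume that the diagonal elements of $R$ are all of the same order, i.e. $R_{ii}/R_{jj}\le C$ for all $i,j$ and some constant $C>0$. Finally assume that for each fixed $j\notin A_0$ there is a set $S\subseteq\{1,\ldots,p\}\setminus(A_0\cup\{j\})$ such that for all $i\in S$, $$\big[R_{ii}-R_{i,S\setminus\{i\}}(R_{S\setminus\{i\},S\setminus\{i\}})^{-1}R_{S\setminus\{i\},i}\big]/R_{ii}\ \ge\ \delta^2,$$ $$|R_{ij}|/R_{jj}<\eta/(2-\eta),$$ $$\|(X_{A_0\cup\{j\}})^+X_i\|_1<1,$$ where $\delta>0$ is a constant (not depending on $j$), and the size of $S$ grows faster than $\log p$: $|S|\ge d_p$, where $d_p/\log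 p\to\infty$ as $p\to\infty$. (The constants $\eta,C,\delta$ do not depend on $p$.) Then at step $k=k_0+1$ the covariance test statistic satisfies $\limsup_{p\to\infty}\mathbb{P}(T_k>t)\le e^{-t}$ for all $t\ge0$. The same result holds for the tail of $T_k$ conditional on $B$: $\limsup_{p\to\infty}\mathbb{P}(T_k>t\mid B)\le e^{-t}$ for all $t\ge0$.
   Context: Notation: $X_j$ is the $j$th column of $X$, $X_A$ the submatrix of columns in $A$; $(\cdot)^+$ is the Moore–Penrose pseudoinverse, so for $X_A$ of full column rank $(X_A)^+=(X_A^TX_A)^{-1}X_A^T$ and $(X_A^T)^+=X_A(X_A^TX_A)^{-1}$; $P_A=X_A(X_A)^+$ is the projection onto the column space of $X_A$ (zero if $A=\emptyset$). $R_{S,S'}$ is the submatrix of $R$ with rows in $S$, columns in $S'$; inverses and denominators in the hypotheses presuppose invertibility/nonvanishing. General position: no $k$-dimensional affine subspace of $\mathbb{R}^n$, $k<\min\{n,p\}$, contains more than $k+1$ elements of $\{\pm X_1,\ldots,\pm X_p\}$, excluding antipodal pairs. Lasso path: for $\lambda>0$ let $\hat\beta(\lambda)=\operatorname{argmin}_{\beta\in\mathbb{R}^p}\frac12\|y-X\beta\|_2^2+\lambda\|\beta\|_1$ (unique under general position). The map $\lambda\mapsto\hat\beta(\lambda)$ is continuous and piecewise linear, zero for large $\lambda$; its knots $\lambda_1\ge\lambda_2\ge\cdots\ge0$ are the values at which, as $\lambda$ decreases from $\infty$, a variable joins or leaves the active set $\operatorname{supp}(\hat\beta(\lambda))$; put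 $\lambda_0=\infty$. The active set $A$ and the signs $s_A$ of the active coefficients are constant between consecutive knots; "the solution at step $k$ has active set $A$ and signs $s_A$" means that these are the active set and signs on the interval between $\lambda_{k+1}$ and $\lambda_k$ (so $A=\emptyset$ at step $0$). With such $A,s_A$ one has $\lambda_{k+1}=\max\{\lambda_{k+1}^{\mathrm{join}},\lambda_{k+1}^{\mathrm{leave}}\}$, where $$\lambda_{k+1}^{\mathrm{join}}=\max_{j\notin A,\,s\in\{-1,1\}}\frac{X_j^T(I-P_A)y}{s-X_j^T(X_A^T)^+s_A}\cdot 1\Big\{\frac{X_j^T(I-P_A)y}{s-X_j^T(X_A^T)^+s_A}<\lambda_k\Big\},$$ $$\lambda_{k+1}^{\mathrm{leave}}=\max_{j\in A}\frac{[(X_A)^+y]_j}{[(X_A^TX_A)^{-1}s_A]_j}\cdot1\Big\{\frac{[(X_A)^+y]_j}{[(X_A^TX_A)^{-1}s_A]_j}<\lambda_k\Big\}.$$ Event $B$: the event that the solution at step $k_0$ in the lasso path has active set $A=A_0$ and signs $s_A=\operatorname{sign}((X_{A_0})^+y)=s_{A_0}$, and the next two knots are given by $$\lambda_{k_0+1}=\max_{j\notin A\cup\{j_{k_0}\},\,s\in\{-1,1\}}\frac{X_j^T(I-P_A)y}{s-X_j^T(X_A^T)^+s_A},\qquad \lambda_{k_0+2}=\lambda_{k_0+2}^{\mathrm{join}},$$ where $j_{k_0}$ is the variable that joined or left the active set at $\lambda_{k_0}$ (nothing is excluded if $k_0=0$). Covariance test statistic at step $k$: let $A$ be the active set just before $\lambda_k$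 (i.e. on the interval between $\lambda_k$ and $\lambda_{k-1}$), and $\tilde\beta_A(\lambda_{k+1})=\operatorname{argmin}_{\beta_A\in\mathbb{R}^{|A|}}\frac12\|y-X_A\beta_A\|_2^2+\lambda_{k+1}\|\beta_A\|_1$. Then $$T_k=\big(\langle y,X\hat\beta(\lambda_{k+1})\rangle-\langle y,X_A\tilde\beta_A(\lambda_{k+1})\rangle\big)/\sigma^2.$$ *)

theory Defs
  imports
    "HOL-Probability.Probability"
    "Jordan_Normal_Form.Gauss_Jordan_Elimination"
    "Jordan_Normal_Form.DL_Submatrix"
    "Jordan_Normal_Form.VS_Connect"
begin

hide_const (open) Finite_Cartesian_Product.vec Finite_Cartesian_Product.mat
  Finite_Cartesian_Product.row
no_notation vec_nth (infixl "$" 90)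
no_notation inner (infix "\<bullet>" 70)

text \<open>The design matrix is a matrix of dimension \<open>n \<times> p\<close>; variables are numbered \<open>0, \<dots>, p - 1\<close>.
  Vectors indexed by a set \<open>A\<close> of variables are vectors of dimension \<open>card A\<close>, with the elements
  of \<open>A\<close> listed in increasing order.\<close>

definition sub_cols :: "real mat \<Rightarrow> nat set \<Rightarrow> real mat" where
  "sub_cols X A = submatrix X UNIV A"

definition sub_vec :: "real vec \<Rightarrow> nat set \<Rightarrow> real vec" where
  "sub_vec v A = vec (card A) (\<lambda>i. v $ pick A i)"

definition l1_norm :: "real vec \<Rightarrow> real" where
  "l1_norm v = (\<Sum>i<dim_vec v. \<bar>v $ i\<bar>)"

definition supp :: "real vec \<Rightarrow> nat set" where
  "supp v = {i. i < dim_vec v \<and> v $ i \<noteq> 0}"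

definition sign_vec :: "real vec \<Rightarrow> real vec" where
  "sign_vec v = map_vec sgn v"

text \<open>Moore--Penrose pseudoinverse: the unique matrix satisfying the four Penrose conditions.\<close>

definition pinv :: "real mat \<Rightarrow> real mat" where
  "pinv A = (THE G. G \<in> carrier_mat (dim_col A) (dim_row A) \<and>
      A * G * A = A \<and> G * A * G = G \<and>
      transpose_mat (A * G) = A * G \<and> transpose_mat (G * A) = G * A)"

definition proj :: "real mat \<Rightarrow> nat set \<Rightarrow> real mat" where
  "proj X A = sub_cols X A * pinv (sub_cols X A)"

definition resid_proj :: "real mat \<Rightarrow> nat set \<Rightarrow> real mat" where
  "resid_proj X A = 1\<^sub>m (dim_row X) - proj X A"

text \<open>The full \<open>p \<times> p\<close> matrix; only entries with both indices outside \<open>A\<close> are of interest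
  (the remaining ones vanish).\<close>

definition resid_gram :: "real mat \<Rightarrow> nat set \<Rightarrow> real mat" where
  "resid_gram X A = transpose_mat X * resid_proj X A * X"

text \<open>\<open>R\<^sub>i\<^sub>i - R\<^sub>i\<^sub>,\<^sub>T (R\<^sub>T\<^sub>,\<^sub>T)\<^sup>-\<^sup>1 R\<^sub>T\<^sub>,\<^sub>i\<close>, to be used only if the submatrix on \<open>T\<close> is invertible.\<close>

definition schur_compl :: "real mat \<Rightarrow> nat set \<Rightarrow> nat \<Rightarrow> real" where
  "schur_compl R T i = R $$ (i, i) -
     (submatrix R {i} T * the (mat_inverse (submatrix R T T)) * submatrix R T {i}) $$ (0, 0)"

subsection \<open>General position\<close>

definition affine_subspace :: "nat \<Rightarrow> nat \<Rightarrow> real vec set \<Rightarrow> bool" where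
  "affine_subspace n k L \<longleftrightarrow>
     (\<exists>a\<in>carrier_vec n. \<exists>W. VectorSpace.subspace class_ring W (module_vec TYPE(real) n) \<and>
        vectorspace.dim class_ring ((module_vec TYPE(real) n)\<lparr>carrier := W\<rparr>) = k \<and>
        L = (\<lambda>w. a + w) ` W)"

text \<open>The elements of \<open>{\<plusminus>X\<^sub>1, \<dots>, \<plusminus>X\<^sub>p}\<close> in \<open>L\<close> are counted by column index, so that equal columns
  count twice; choosing one sign per index excludes antipodal pairs.\<close>

definition general_position :: "real mat \<Rightarrow> bool" where
  "general_position X \<longleftrightarrow>
     (\<forall>k L J s. k < min (dim_row X) (dim_col X) \<and> affine_subspace (dim_row X) k L \<and>
        J \<subseteq> {..<dim_col X} \<and> (\<forall>j\<in>J. s j \<in> {-1, 1 :: real} \<and> s j \<cdot>\<^sub>v col X j \<in> L)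
        \<longrightarrow> card J \<le> k + 1)"

subsection \<open>The lasso and its path\<close>

definition lasso_obj :: "real mat \<Rightarrow> real vec \<Rightarrow> real \<Rightarrow> real vec \<Rightarrow> real" where
  "lasso_obj X y l b = 1 / 2 * ((y - X *\<^sub>v b) \<bullet> (y - X *\<^sub>v b)) + l * l1_norm b"

definition lasso :: "real mat \<Rightarrow> real vec \<Rightarrow> real \<Rightarrow> real vec" where
  "lasso X y l = arg_min_on (lasso_obj X y l) (carrier_vec (dim_col X))"

text \<open>A knot is a positive value at which the active set changes: the active set fails to be
  constant near it.\<close>

definition knots :: "real mat \<Rightarrow> real vec \<Rightarrow> real set" where
  "knots X y = {l. l > 0 \<and>
     \<not> (\<forall>\<^sub>F l' in at l. supp (lasso X y l') = supp (lasso X y l))}"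

text \<open>The knots in decreasing order, starting with \<open>\<infinity>\<close> and continued by \<open>0\<close> after the last positive
  one. As there are finitely many knots, the supremum is a maximum.\<close>

fun knot :: "real mat \<Rightarrow> real vec \<Rightarrow> nat \<Rightarrow> ereal" where
  "knot X y 0 = \<infinity>"
| "knot X y (Suc k) = Sup (insert 0 {ereal l | l. l \<in> knots X y \<and> ereal l < knot X y k})"

definition step_interval :: "real mat \<Rightarrow> real vec \<Rightarrow> nat \<Rightarrow> real set" where
  "step_interval X y k = {l. knot X y (k + 1) < ereal l \<and> ereal l < knot X y k}"

definition at_step :: "real mat \<Rightarrow> real vec \<Rightarrow> nat \<Rightarrow> nat set \<Rightarrow> real vec \<Rightarrow> bool" where
  "at_step X y k A s \<longleftrightarrow> step_interval X y k \<noteq> {} \<and>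
     (\<forall>l\<in>step_interval X y k. supp (lasso X y l) = A \<and> sign_vec (sub_vec (lasso X y l) A) = s)"

definition step_active :: "real mat \<Rightarrow> real vec \<Rightarrow> nat \<Rightarrow> nat set" where
  "step_active X y k = (THE A. \<exists>s. at_step X y k A s)"

text \<open>The variable that joins or leaves at the \<open>k\<close>-th knot, for \<open>k \<ge> 1\<close>.\<close>

definition knot_var :: "real mat \<Rightarrow> real vec \<Rightarrow> nat \<Rightarrow> nat" where
  "knot_var X y k =
     (THE j. j \<in> sym_diff (step_active X y (k - 1)) (step_active X y k))"

definition hit_value ::
  "real mat \<Rightarrow> real vec \<Rightarrow> nat set \<Rightarrow> real vec \<Rightarrow> nat \<Rightarrow> real \<Rightarrow> real" where
  "hit_value X y A sA j s =
     (col X j \<bullet> (resid_proj X A *\<^sub>v y)) /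
     (s - col X j \<bullet> (pinv (transpose_mat (sub_cols X A)) *\<^sub>v sA))"

text \<open>The joining value after a knot at \<open>l\<close>.\<close>

definition knot_join ::
  "real mat \<Rightarrow> real vec \<Rightarrow> nat set \<Rightarrow> real vec \<Rightarrow> ereal \<Rightarrow> real" where
  "knot_join X y A sA l =
     Max ((\<lambda>(j, s). hit_value X y A sA j s * of_bool (ereal (hit_value X y A sA j s) < l)) `
          (({..<dim_col X} - A) \<times> {-1, 1}))"

definition event_B ::
  "real mat \<Rightarrow> real vec \<Rightarrow> nat \<Rightarrow> nat set \<Rightarrow> real vec \<Rightarrow> bool" where
  "event_B X y k0 A0 s0 \<longleftrightarrow>
     at_step X y k0 A0 s0 \<and>
     sign_vec (pinv (sub_cols X A0) *\<^sub>v y) = s0 \<and>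
     knot X y (k0 + 1) =
       ereal (Max ((\<lambda>(j, s). hit_value X y A0 s0 j s) `
         (({..<dim_col X} - (A0 \<union> (if k0 = 0 then {} else {knot_var X y k0}))) \<times> {-1, 1}))) \<and>
     (\<exists>A s. at_step X y (k0 + 1) A s \<and>
        knot X y (k0 + 2) = ereal (knot_join X y A s (knot X y (k0 + 1))))"

text \<open>The covariance test statistic at step \<open>k \<ge> 1\<close>, with noise standard deviation \<open>\<sigma>\<close>. Where the
  regularization parameter is \<open>0\<close> the minimizer need not be unique, but its fit is.\<close>

definition cov_test :: "real mat \<Rightarrow> real vec \<Rightarrow> real \<Rightarrow> nat \<Rightarrow> real" where
  "cov_test X y \<sigma> k =
     (let l = real_of_ereal (knot X y (k + 1));
          XA = sub_cols X (step_active X y (k - 1))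
      in (y \<bullet> (X *\<^sub>v lasso X y l) - y \<bullet> (XA *\<^sub>v lasso XA y l)) / \<sigma>\<^sup>2)"

end

theory Submission
  imports Defs "HOL-Real_Asymp.Real_Asymp"
begin

text \<open>Let \<open>r\<^sub>i\<close> be the residual of column \<open>i\<close> after projection on the columns in \<open>A\<^sub>0\<close>. On the event \<open>B\<close>, the first
  knot after step \<open>k\<^sub>0\<close> is the maximum of the joining values \<open>g\<^sub>i\<^sub>s = r\<^sub>i\<cdot>\<epsilon> / c\<^sub>i\<^sub>s\<close>, attained almost surely by a
  unique \<open>(j, s)\<close>, and \<open>T = g (g - \<lambda>) / var g\<close> for \<open>g = g\<^sub>j\<^sub>s\<close> and the next knot \<open>\<lambda>\<close>. Conditionally on the component of
  the noise orthogonal to \<open>r\<^sub>j\<close>, the event that \<open>(j, s)\<close> is the maximizer says that the normal variable \<open>g\<close> lies in an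
  interval with some left endpoint \<open>m \<le> \<lambda>\<close>. By Mills' ratio, \<open>g (g - m) / var g > t\<close> has conditional probability at
  most about \<open>e\<^sup>-\<^sup>t\<close> given that event, once \<open>m\<close> is large compared with the standard deviation of \<open>g\<close>. The
  conditions on \<open>S\<close> make the probability that \<open>m\<close> is not large exponentially small in \<open>d\<^sub>p\<close>, which beats the
  \<open>2 p\<close> choices of \<open>(j, s)\<close>. Since the maximizer events are disjoint, summation over \<open>(j, s)\<close> gives the claim.\<close>

text \<open>Conditioning works because, in terms of the residuals at step k0, the joining values
  \<open>h q q'\<close> after \<open>q = (j, s)\<close> has entered depend on the noise only through
  its part orthogonal to r_j. The comparison of g at q' and q is then a linear inequality in one
  normal variable, and it reads g > \<open>h q q'\<close> as soon as the sign times denominator of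
  \<open>h\<close> is positive. So m is the largest of these h, and each of them is at most the next
  knot. The bound \<eta>/(2 - \<eta>) on |R_ij|/R_jj is what makes this denominator positive for i
  in S, because \<eta> \<le> s c \<le> 2 - \<eta> for every denominator c of g; hence each i in S
  pushes m up.

  The threshold K for m, in units of the standard deviation of g, is fixed while p grows, and only
  afterwards tends to infinity.

  Neither B nor the statistic is shown to be measurable. B yields a deterministic inequality, which
  places the outcome, up to ties, in a measurable set of noise vectors, and that set is bounded. On
  the lasso side no path algorithm is followed: the optimality conditions on the two intervals next
  to the knot, together with uniqueness of the solution, determine what happens there.\<close>

section \<open>Gaussian vectors\<close>

text \<open>As the dimension varies, vectors in \<open>\<real>\<^sup>n\<close> are functions on \<open>nat\<close> of which only the values below \<open>n\<close> count.\<close>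

definition dotf :: "nat \<Rightarrow> (nat \<Rightarrow> real) \<Rightarrow> (nat \<Rightarrow> real) \<Rightarrow> real" where
  "dotf n u v = (\<Sum>k<n. u k * v k)"

definition normal :: "real \<Rightarrow> real measure" where
  "normal \<sigma> = density lborel (\<lambda>x. ennreal (normal_density 0 \<sigma> x))"

definition gauss :: "nat \<Rightarrow> real \<Rightarrow> (nat \<Rightarrow> real) measure" where
  "gauss n \<sigma> = Pi\<^sub>M {..<n} (\<lambda>_. normal \<sigma>)"

section \<open>Densities and translations of product measures\<close>

lemma PiM_density:
  fixes f :: "'i \<Rightarrow> real \<Rightarrow> ennreal"
  assumes I: "finite I" and f: "\<And>i. f i \<in> borel_measurable borel"
    and sf: "\<And>i. sigma_finite_measure (density lborel (f i))"
  shows "Pi\<^sub>M I (\<lambda>i. density lborel (f i))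
    = density (Pi\<^sub>M I (\<lambda>_. lborel)) (\<lambda>x. \<Prod>i\<in>I. f i (x i))"
proof -
  interpret L: product_sigma_finite "\<lambda>_::'i. lborel :: real measure" by standard
  interpret D: product_sigma_finite "\<lambda>i. density lborel (f i)"
    using sf by (simp add: product_sigma_finite_def)
  have m: "(\<lambda>x. \<Prod>i\<in>I. f i (x i)) \<in> borel_measurable (Pi\<^sub>M I (\<lambda>_. lborel))"
    using f by measurable
  show ?thesis
  proof (rule D.PiM_eqI[symmetric])
    show "finite I" by fact
    show "sets (density (Pi\<^sub>M I (\<lambda>_. lborel)) (\<lambda>x. \<Prod>i\<in>I. f i (x i))) =
      sets (Pi\<^sub>M I (\<lambda>i. density lborel (f i)))"
      by (simp cong: sets_PiM_cong)
    fix A assume "\<And>i. i \<in> I \<Longrightarrow> A i \<in> sets (density lborel (f i))"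
    then have A: "\<And>i. i \<in> I \<Longrightarrow> A i \<in> sets borel" by simp
    have "emeasure (density (Pi\<^sub>M I (\<lambda>_. lborel)) (\<lambda>x. \<Prod>i\<in>I. f i (x i))) (Pi\<^sub>E I A)
      = (\<integral>\<^sup>+x. (\<Prod>i\<in>I. f i (x i)) * indicator (Pi\<^sub>E I A) x \<partial>Pi\<^sub>M I (\<lambda>_. lborel))"
      using A I by (intro emeasure_density m) (auto intro!: sets_PiM_I_finite)
    also have "\<dots> = (\<integral>\<^sup>+x. (\<Prod>i\<in>I. f i (x i) * indicator (A i) (x i)) \<partial>Pi\<^sub>M I (\<lambda>_. lborel))"
    proof (rule nn_integral_cong)
      fix x assume "x \<in> space (Pi\<^sub>M I (\<lambda>_. lborel :: real measure))"
      then have "indicator (Pi\<^sub>E I A) x = (\<Prod>i\<in>I. indicator (A i) (x i) :: ennreal)"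
        using I by (auto simp: indicator_def space_PiM PiE_def Pi_def intro!: prod.neutral[symmetric])
      then show "(\<Prod>i\<in>I. f i (x i)) * indicator (Pi\<^sub>E I A) x = (\<Prod>i\<in>I. f i (x i) * indicator (A i) (x i))"
        by (simp add: prod.distrib)
    qed
    also have "\<dots> = (\<Prod>i\<in>I. \<integral>\<^sup>+x. f i x * indicator (A i) x \<partial>lborel)"
      using A f by (intro L.product_nn_integral_prod I) simp
    also have "\<dots> = (\<Prod>i\<in>I. emeasure (density lborel (f i)) (A i))"
      using A f by (intro prod.cong refl) (simp add: emeasure_density)
    finally show "emeasure (density (Pi\<^sub>M I (\<lambda>_. lborel)) (\<lambda>x. \<Prod>i\<in>I. f i (x i))) (Pi\<^sub>E I A) =
         (\<Prod>i\<in>I. emeasure (density lborel (f i)) (A i))" .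
  qed
qed

text \<open>The only change of variables in several dimensions that the development uses: a shear is
  a translation in every fibre, so no determinant has to be computed.\<close>

lemma PiM_lborel_translation:
  assumes I: "finite I"
  shows "distr (Pi\<^sub>M I (\<lambda>_. lborel :: real measure)) (Pi\<^sub>M I (\<lambda>_. lborel)) (\<lambda>x. \<lambda>i\<in>I. c i + x i)
    = Pi\<^sub>M I (\<lambda>_. lborel)"
proof -
  interpret L: product_sigma_finite "\<lambda>_::'a. lborel :: real measure" by standard
  have m: "(\<lambda>x. \<lambda>i\<in>I. c i + x i) \<in> measurable (Pi\<^sub>M I (\<lambda>_. lborel :: real measure)) (Pi\<^sub>M I (\<lambda>_. lborel))"
    by measurable
  show ?thesis
  proof (rule L.PiM_eqI)
    show "finite I" by fact
    show "sets (distr (Pi\<^sub>M I (\<lambda>_. lborel :: real measure)) (Pi\<^sub>M I (\<lambda>_. lborel)) (\<lambda>x. \<lambda>i\<in>I. c i + x i)) =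
      sets (Pi\<^sub>M I (\<lambda>i. lborel))"
      by simp
    fix A assume "\<And>i. i \<in> I \<Longrightarrow> A i \<in> sets (lborel :: real measure)"
    then have A: "\<And>i. i \<in> I \<Longrightarrow> A i \<in> sets borel" by simp
    have "emeasure (distr (Pi\<^sub>M I (\<lambda>_. lborel :: real measure)) (Pi\<^sub>M I (\<lambda>_. lborel)) (\<lambda>x. \<lambda>i\<in>I. c i + x i)) (Pi\<^sub>E I A)
      = emeasure (Pi\<^sub>M I (\<lambda>_. lborel)) (Pi\<^sub>E I (\<lambda>i. (+) (c i) -` A i))"
    proof (subst emeasure_distr[OF m])
      show "Pi\<^sub>E I A \<in> sets (Pi\<^sub>M I (\<lambda>_. lborel))"
        using A I by (intro sets_PiM_I_finite) auto
    qed (auto intro!: arg_cong[where f="emeasure _"] simp: space_PiM PiE_def Pi_def)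
    also have "\<dots> = (\<Prod>i\<in>I. emeasure lborel ((+) (c i) -` A i))"
      using A I by (intro L.emeasure_PiM) (auto intro!: measurable_sets_borel[of _ borel])
    also have "\<dots> = (\<Prod>i\<in>I. emeasure (distr lborel borel ((+) (c i))) (A i))"
      using A by (intro prod.cong refl) (simp add: emeasure_distr)
    finally show "emeasure (distr (Pi\<^sub>M I (\<lambda>_. lborel :: real measure)) (Pi\<^sub>M I (\<lambda>_. lborel)) (\<lambda>x. \<lambda>i\<in>I. c i + x i)) (Pi\<^sub>E I A) =
         (\<Prod>i\<in>I. emeasure lborel (A i))" by (simp add: lborel_distr_plus)
  qed
qed

lemma sets_normal [simp, measurable_cong]: "sets (normal \<sigma>) = sets borel"
  by (simp add: normal_def)

lemma space_normal [simp]: "space (normal \<sigma>) = UNIV"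
  by (simp add: normal_def)

lemma sets_gauss [measurable_cong]: "sets (gauss n \<sigma>) = sets (Pi\<^sub>M {..<n} (\<lambda>_. borel))"
  by (auto simp: gauss_def intro!: sets_PiM_cong)

lemma space_gauss: "space (gauss n \<sigma>) = PiE {..<n} (\<lambda>_. UNIV)"
  by (simp add: gauss_def space_PiM)

lemma prob_space_normal: "0 < \<sigma> \<Longrightarrow> prob_space (normal \<sigma>)"
  unfolding normal_def by (rule prob_space_normal_density)

lemma prob_space_gauss: "0 < \<sigma> \<Longrightarrow> prob_space (gauss n \<sigma>)"
  unfolding gauss_def by (intro prob_space_PiM prob_space_normal)

lemma dotf_commute: "dotf n u v = dotf n v u"
  by (simp add: dotf_def mult.commute)

lemma measurable_dotf [measurable]:
  assumes "\<And>k. k < n \<Longrightarrow> (\<lambda>x. f x k) \<in> borel_measurable M"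
    "\<And>k. k < n \<Longrightarrow> (\<lambda>x. g x k) \<in> borel_measurable M"
  shows "(\<lambda>x. dotf n (f x) (g x)) \<in> borel_measurable M"
  unfolding dotf_def using assms by (auto intro!: borel_measurable_sum borel_measurable_times)

text \<open>The density depends on \<open>x\<close> only through \<open>dotf n x x\<close>, which is
  the source of rotation invariance.\<close>

lemma gauss_density:
  assumes "0 < \<sigma>"
  shows "gauss n \<sigma> = density (Pi\<^sub>M {..<n} (\<lambda>_. lborel))
    (\<lambda>x. ennreal ((1 / sqrt (2 * pi * \<sigma>\<^sup>2)) ^ n * exp (- dotf n x x / (2 * \<sigma>\<^sup>2))))"
proof -
  have "gauss n \<sigma> = density (Pi\<^sub>M {..<n} (\<lambda>_. lborel)) (\<lambda>x. \<Prod>i<n. ennreal (normal_density 0 \<sigma> (x i)))"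
    unfolding gauss_def normal_def
    by (rule PiM_density) (use prob_space_normal[OF assms] in \<open>auto simp: normal_def[symmetric] prob_space_imp_sigma_finite\<close>)
  also have "(\<lambda>x. \<Prod>i<n. ennreal (normal_density 0 \<sigma> (x i))) =
    (\<lambda>x. ennreal ((1 / sqrt (2 * pi * \<sigma>\<^sup>2)) ^ n * exp (- dotf n x x / (2 * \<sigma>\<^sup>2))))"
    by (rule ext) (simp add: prod_ennreal normal_density_def prod.distrib prod_dividef
        exp_sum[symmetric] sum_negf sum_divide_distrib dotf_def power2_eq_square power_one_over)
  finally show ?thesis .
qed

text \<open>For a unit vector \<open>u\<close> this is \<open>e\<close> with its component along
  \<open>u\<close> replaced by \<open>z\<close>. The restriction to \<open>{..<n}\<close> keeps the
  result in the space of the product measure, whose elements are \<open>undefined\<close>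
  elsewhere.\<close>

definition line_shift :: "nat \<Rightarrow> (nat \<Rightarrow> real) \<Rightarrow> (nat \<Rightarrow> real) \<Rightarrow> real \<Rightarrow> nat \<Rightarrow> real" where
  "line_shift n u e z = (\<lambda>k\<in>{..<n}. (z - dotf n u e) * u k + e k)"

lemma dotf_line_shift: "dotf n v (line_shift n u e z) = (z - dotf n u e) * dotf n v u + dotf n v e"
proof -
  have "dotf n v (line_shift n u e z) = (\<Sum>k<n. (z - dotf n u e) * (v k * u k) + v k * e k)"
    unfolding line_shift_def by (simp add: dotf_def[of n v] algebra_simps)
  then show ?thesis by (simp add: sum.distrib dotf_def[of n v] sum_distrib_left)
qed

lemma measurable_line_shift [measurable]:
  "(\<lambda>(e, z). line_shift n u e z) \<in> measurable (Pi\<^sub>M {..<n} (\<lambda>_. borel) \<Otimes>\<^sub>M borel) (Pi\<^sub>M {..<n} (\<lambda>_. borel))"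
  unfolding line_shift_def case_prod_beta by measurable

lemma nn_integral_PiM_lborel_translation:
  assumes "finite I" "f \<in> borel_measurable (Pi\<^sub>M I (\<lambda>_. lborel :: real measure))"
  shows "(\<integral>\<^sup>+x. f (\<lambda>i\<in>I. c i + x i) \<partial>Pi\<^sub>M I (\<lambda>_. lborel)) = (\<integral>\<^sup>+x. f x \<partial>Pi\<^sub>M I (\<lambda>_. lborel))"
  by (subst (2) PiM_lborel_translation[OF assms(1), symmetric, of c])
     (use assms(2) in \<open>auto simp: nn_integral_distr\<close>)

lemma measurable_PiM_lborel: "borel_measurable (Pi\<^sub>M I (\<lambda>_. lborel)) = borel_measurable (Pi\<^sub>M I (\<lambda>_. borel))"
  by (intro measurable_cong_sets sets_PiM_cong) auto

text \<open>The map \<open>(e, z) \<mapsto> (e + (z - u\<cdot>e) u, - u\<cdot>e)\<close> with \<open>u\<close> a unit vector is a rotation by a right angle in the plane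
  of \<open>u\<close> and the last coordinate axis. It is a composition of three shears, each of which preserves
  Lebesgue measure by translation invariance in the fibres.\<close>

lemma nn_integral_rotate:
  assumes u: "dotf n u u = 1"
    and [measurable]: "(\<lambda>(e, z). H e z) \<in> borel_measurable (Pi\<^sub>M {..<n} (\<lambda>_. borel) \<Otimes>\<^sub>M borel)"
  defines "L \<equiv> Pi\<^sub>M {..<n} (\<lambda>_. lborel :: real measure)"
  shows "(\<integral>\<^sup>+e. \<integral>\<^sup>+z. H (line_shift n u e z) (- dotf n u e) \<partial>lborel \<partial>L) = (\<integral>\<^sup>+e. \<integral>\<^sup>+z. H e z \<partial>lborel \<partial>L)"
proof -
  interpret L: product_sigma_finite "\<lambda>_::nat. lborel :: real measure" by standard
  interpret L: sigma_finite_measure L unfolding L_def by (rule L.sigma_finite) simp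
  interpret P: pair_sigma_finite L "lborel :: real measure" by standard
  have sL[measurable_cong]: "sets L = sets (Pi\<^sub>M {..<n} (\<lambda>_. borel))" unfolding L_def by (intro sets_PiM_cong) auto
  define S where "S = (\<lambda>z e. \<lambda>k\<in>{..<n}. z * u k + e k)"
  have [measurable]: "(\<lambda>(e, z). S z e) \<in> measurable (Pi\<^sub>M {..<n} (\<lambda>_. borel) \<Otimes>\<^sub>M borel) (Pi\<^sub>M {..<n} (\<lambda>_. borel))"
    unfolding case_prod_beta S_def by measurable
  have S: "(\<integral>\<^sup>+e. \<integral>\<^sup>+z. G (S z e) z \<partial>lborel \<partial>L) = (\<integral>\<^sup>+e. \<integral>\<^sup>+z. G e z \<partial>lborel \<partial>L)"
    if [measurable]: "(\<lambda>(e, z). G e z) \<in> borel_measurable (Pi\<^sub>M {..<n} (\<lambda>_. borel) \<Otimes>\<^sub>M borel)" for G :: "(nat \<Rightarrow> real) \<Rightarrow> real \<Rightarrow> ennreal"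
  proof -
    have "(\<integral>\<^sup>+e. \<integral>\<^sup>+z. G (S z e) z \<partial>lborel \<partial>L) = (\<integral>\<^sup>+z. \<integral>\<^sup>+e. G (S z e) z \<partial>L \<partial>lborel)"
      by (intro P.Fubini'[symmetric]) measurable
    also have "\<dots> = (\<integral>\<^sup>+z. \<integral>\<^sup>+e. G e z \<partial>L \<partial>lborel)"
      unfolding L_def S_def
      by (intro nn_integral_cong nn_integral_PiM_lborel_translation) (auto simp: measurable_PiM_lborel)
    also have "\<dots> = (\<integral>\<^sup>+e. \<integral>\<^sup>+z. G e z \<partial>lborel \<partial>L)"
      by (intro P.Fubini') measurable
    finally show ?thesis .
  qed
  have T: "(\<integral>\<^sup>+e. \<integral>\<^sup>+z. G e (- dotf n u e + z) \<partial>lborel \<partial>L) = (\<integral>\<^sup>+e. \<integral>\<^sup>+z. G e z \<partial>lborel \<partial>L)"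
    if [measurable]: "(\<lambda>(e, z). G e z) \<in> borel_measurable (Pi\<^sub>M {..<n} (\<lambda>_. borel) \<Otimes>\<^sub>M borel)" for G :: "(nat \<Rightarrow> real) \<Rightarrow> real \<Rightarrow> ennreal"
  proof (rule nn_integral_cong)
    fix e assume e: "e \<in> space L"
    then have e': "e \<in> space (Pi\<^sub>M {..<n} (\<lambda>_. borel))" using sets_eq_imp_space_eq[OF sL] by simp
    have [measurable]: "(\<lambda>z. G e z) \<in> borel_measurable borel"
      using measurable_compose[OF measurable_Pair1'[OF e'] that] by simp
    have "(\<integral>\<^sup>+z. G e z \<partial>lborel) = (\<integral>\<^sup>+z. G e z \<partial>distr lborel borel ((+) (- dotf n u e)))"
      by (simp add: lborel_distr_plus)
    also have "\<dots> = (\<integral>\<^sup>+z. G e (- dotf n u e + z) \<partial>lborel)" by (subst nn_integral_distr) auto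
    finally show "(\<integral>\<^sup>+z. G e (- dotf n u e + z) \<partial>lborel) = (\<integral>\<^sup>+z. G e z \<partial>lborel)" by simp
  qed
  have d: "dotf n u (S z e) = z + dotf n u e" for z e
    using u by (simp add: dotf_def S_def algebra_simps sum.distrib flip: sum_distrib_left)
  have "(\<integral>\<^sup>+e. \<integral>\<^sup>+z. H e z \<partial>lborel \<partial>L) = (\<integral>\<^sup>+e. \<integral>\<^sup>+z. H (S z e) z \<partial>lborel \<partial>L)"
    by (rule S[symmetric]) measurable
  also have "\<dots> = (\<integral>\<^sup>+e. \<integral>\<^sup>+z. H (S (- dotf n u e + z) e) (- dotf n u e + z) \<partial>lborel \<partial>L)"
    by (rule T[of "\<lambda>e z. H (S z e) z", symmetric]) measurable
  also have "\<dots> = (\<integral>\<^sup>+e. \<integral>\<^sup>+z. H (S (- dotf n u (S z e) + z) (S z e)) (- dotf n u (S z e) + z) \<partial>lborel \<partial>L)"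
    by (rule S[of "\<lambda>e z. H (S (- dotf n u e + z) e) (- dotf n u e + z)", symmetric]) measurable
  also have "\<dots> = (\<integral>\<^sup>+e. \<integral>\<^sup>+z. H (line_shift n u e z) (- dotf n u e) \<partial>lborel \<partial>L)"
  proof -
    have "S (- dotf n u e) (S z e) = line_shift n u e z" for z e
      by (auto simp: S_def line_shift_def algebra_simps)
    then show ?thesis by (simp add: d)
  qed
  finally show ?thesis by simp
qed

text \<open>If \<open>z\<close> is an independent normal variable, then
  \<open>line_shift n u e z\<close> has the same law as \<open>e\<close>, by rotation invariance of
  the pair \<open>(e, z)\<close>. The integrand sees only the part of \<open>e\<close> orthogonal to
  \<open>u\<close>, so this is conditioning on that part, without conditional distributions.\<close>

lemma gauss_fibre:
  assumes \<sigma>: "0 < \<sigma>" and u: "dotf n u u = 1" and A[measurable]: "A \<in> sets (Pi\<^sub>M {..<n} (\<lambda>_. borel))"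
  shows "emeasure (gauss n \<sigma>) A = (\<integral>\<^sup>+e. emeasure (normal \<sigma>) {z. line_shift n u e z \<in> A} \<partial>gauss n \<sigma>)"
proof -
  define L where "L = Pi\<^sub>M {..<n} (\<lambda>_. lborel :: real measure)"
  have sL[measurable_cong]: "sets L = sets (Pi\<^sub>M {..<n} (\<lambda>_. borel))" unfolding L_def by (intro sets_PiM_cong) auto
  define D where "D = (\<lambda>x. ennreal ((1 / sqrt (2 * pi * \<sigma>\<^sup>2)) ^ n * exp (- dotf n x x / (2 * \<sigma>\<^sup>2))))"
  define \<phi> where "\<phi> = (\<lambda>z. ennreal (normal_density 0 \<sigma> z))"
  have [measurable]: "D \<in> borel_measurable (Pi\<^sub>M {..<n} (\<lambda>_. borel))" "\<phi> \<in> borel_measurable borel"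
    unfolding D_def \<phi>_def by measurable
  have g: "gauss n \<sigma> = density L D" unfolding L_def D_def by (rule gauss_density[OF \<sigma>])
  have nn: "normal \<sigma> = density lborel \<phi>" unfolding normal_def \<phi>_def ..
  interpret N: prob_space "normal \<sigma>" by (rule prob_space_normal[OF \<sigma>])
  have [measurable]: "(\<lambda>z. line_shift n u e z) \<in> measurable borel (Pi\<^sub>M {..<n} (\<lambda>_. borel))" for e
    unfolding line_shift_def by measurable
  have i\<phi>: "(\<integral>\<^sup>+z. \<phi> z \<partial>lborel) = 1"
    using N.emeasure_space_1 by (simp add: nn emeasure_density)
  \<comment> \<open>The rotation preserves \<open>dotf n e e + z\<^sup>2\<close>, hence the joint
    density of \<open>(e, z)\<close>.\<close>
  have swap: "D e * \<phi> z = D (line_shift n u e z) * \<phi> (- dotf n u e)" for e z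
  proof -
    have "dotf n (line_shift n u e z) (line_shift n u e z) = dotf n e e + z\<^sup>2 - (dotf n u e)\<^sup>2"
      using u by (simp add: dotf_line_shift[of n "line_shift n u e z"] dotf_commute[of n "line_shift n u e z"] dotf_line_shift)
         (simp add: dotf_commute[of n e u] algebra_simps power2_eq_square)
    then show ?thesis
      by (simp add: D_def \<phi>_def normal_density_def ennreal_mult'[symmetric] exp_add[symmetric] add_divide_distrib
        diff_divide_distrib flip: minus_divide_left)
  qed
  have "emeasure (gauss n \<sigma>) A = (\<integral>\<^sup>+e. D e * indicator A e \<partial>L)"
    unfolding g by (rule emeasure_density) measurable
  also have "\<dots> = (\<integral>\<^sup>+e. \<integral>\<^sup>+z. D e * indicator A e * \<phi> z \<partial>lborel \<partial>L)"
    by (simp add: nn_integral_cmult i\<phi>)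
  also have "\<dots> = (\<integral>\<^sup>+e. \<integral>\<^sup>+z. D (line_shift n u e z) * indicator A (line_shift n u e z) * \<phi> (- dotf n u e) \<partial>lborel \<partial>L)"
    unfolding L_def by (rule nn_integral_rotate[OF u, symmetric]) measurable
  also have "\<dots> = (\<integral>\<^sup>+e. \<integral>\<^sup>+z. D e * (\<phi> z * indicator {z. line_shift n u e z \<in> A} z) \<partial>lborel \<partial>L)"
    by (simp only: mult.assoc mult.commute[of "indicator _ _"]) (simp only: mult.assoc[symmetric] swap[symmetric], simp add: indicator_def)
  also have "\<dots> = (\<integral>\<^sup>+e. D e * (\<integral>\<^sup>+z. \<phi> z * indicator {z. line_shift n u e z \<in> A} z \<partial>lborel) \<partial>L)"
    by (simp add: nn_integral_cmult)
  also have "\<dots> = (\<integral>\<^sup>+e. D e * emeasure (normal \<sigma>) {z. line_shift n u e z \<in> A} \<partial>L)"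
    by (simp add: nn emeasure_density)
  also have "\<dots> = (\<integral>\<^sup>+e. emeasure (normal \<sigma>) {z. line_shift n u e z \<in> A} \<partial>gauss n \<sigma>)"
  proof -
    have "(\<lambda>e. emeasure (normal \<sigma>) {z. line_shift n u e z \<in> A}) \<in> borel_measurable (Pi\<^sub>M {..<n} (\<lambda>_. borel))"
      by (rule N.measurable_emeasure) measurable
    then show ?thesis unfolding g by (subst nn_integral_density) auto
  qed
  finally show ?thesis .
qed

text \<open>In the fibres along the normal direction the hyperplane is a single point. Applied to
  differences of joining values, this excludes ties.\<close>

lemma gauss_null_hyperplane:
  assumes \<sigma>: "0 < \<sigma>" and v: "dotf n v v \<noteq> 0"
  shows "emeasure (gauss n \<sigma>) {e \<in> space (gauss n \<sigma>). dotf n v e = 0} = 0"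
proof -
  define c where "c = sqrt (dotf n v v)"
  have "dotf n v v > 0" using v by (smt (verit) dotf_def sum_nonneg zero_le_square)
  then have c: "c > 0" "c * c = dotf n v v" by (auto simp: c_def)
  define u where "u = (\<lambda>k. v k / c)"
  have u: "dotf n u u = 1" using c v by (simp add: u_def dotf_def sum_divide_distrib[symmetric])
  have vu: "dotf n v u = c" using c v by (simp add: u_def dotf_def sum_divide_distrib[symmetric] field_simps)
  have vu': "dotf n v e = c * dotf n u e" for e using c by (simp add: u_def dotf_def sum_distrib_left)
  have "emeasure (gauss n \<sigma>) {e \<in> space (gauss n \<sigma>). dotf n v e = 0}
    = (\<integral>\<^sup>+e. emeasure (normal \<sigma>) {z. line_shift n u e z \<in> {e \<in> space (gauss n \<sigma>). dotf n v e = 0}} \<partial>gauss n \<sigma>)"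
    by (rule gauss_fibre[OF \<sigma> u]) (simp add: sets_gauss[symmetric, of n \<sigma>] )
  also have "\<dots> = (\<integral>\<^sup>+e. 0 \<partial>gauss n \<sigma>)"
  proof (rule nn_integral_cong)
    fix e
    have "{z. line_shift n u e z \<in> {e \<in> space (gauss n \<sigma>). dotf n v e = 0}} = {0}"
    proof -
      have "line_shift n u e z \<in> space (gauss n \<sigma>)" for z by (simp add: space_gauss line_shift_def)
      moreover have "dotf n v (line_shift n u e z) = c * z" for z
        using u by (simp add: dotf_line_shift vu) (simp add: vu' algebra_simps)
      ultimately show ?thesis using c by auto
    qed
    then show "emeasure (normal \<sigma>) {z. line_shift n u e z \<in> {e \<in> space (gauss n \<sigma>). dotf n v e = 0}} = 0"
      by (simp add: normal_def emeasure_density nn_integral_indicator_singleton)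
  qed
  finally show ?thesis by simp
qed

section \<open>Normal tails\<close>

definition upper_tail :: "real \<Rightarrow> real" where
  "upper_tail x = measure (normal 1) {x<..}"

lemma normal_scale:
  assumes \<sigma>: "0 < \<sigma>" and A: "A \<in> sets borel"
  shows "measure (normal \<sigma>) A = measure (normal 1) {z. \<sigma> * z \<in> A}"
proof -
  interpret N: prob_space "normal 1" by (rule prob_space_normal) simp
  have "distributed (normal 1) lborel (\<lambda>x. x) (normal_density 0 1)"
    unfolding distributed_def normal_def by (auto simp: distr_id2)
  then have "distributed (normal 1) lborel (\<lambda>x. 0 + \<sigma> * x) (normal_density (0 + \<sigma> * 0) (\<bar>\<sigma>\<bar> * 1))"
    using \<sigma> by (intro N.normal_density_affine) auto
  then have "distr (normal 1) lborel (\<lambda>x. \<sigma> * x) = normal \<sigma>"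
    using \<sigma> by (simp add: distributed_def normal_def)
  then have "measure (normal \<sigma>) A = measure (distr (normal 1) lborel (\<lambda>x. \<sigma> * x)) A" by simp
  also have "\<dots> = measure (normal 1) ((\<lambda>x. \<sigma> * x) -` A \<inter> space (normal 1))"
    using A by (intro measure_distr) auto
  also have "(\<lambda>x. \<sigma> * x) -` A \<inter> space (normal 1) = {z. \<sigma> * z \<in> A}" by auto
  finally show ?thesis .
qed

lemma normal_greaterThan: "0 < \<sigma> \<Longrightarrow> measure (normal \<sigma>) {x<..} = upper_tail (x / \<sigma>)"
  by (subst normal_scale) (auto simp: upper_tail_def field_simps intro!: arg_cong[where f="measure _"])

lemma normal_lessThan:
  assumes "0 < \<sigma>" shows "measure (normal \<sigma>) {..<x} = upper_tail (- x / \<sigma>)"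
proof -
  interpret N: prob_space "normal \<sigma>" by (rule prob_space_normal) fact
  have "distributed (normal \<sigma>) lborel (\<lambda>x. x) (normal_density 0 \<sigma>)"
    unfolding distributed_def normal_def by (auto simp: distr_id2)
  then have "distributed (normal \<sigma>) lborel (\<lambda>x. 0 + (-1) * x) (normal_density (0 + (-1) * 0) (\<bar>-1\<bar> * \<sigma>))"
    using assms by (intro N.normal_density_affine) auto
  then have "distr (normal \<sigma>) lborel uminus = normal \<sigma>"
    by (simp add: distributed_def normal_def)
  then have "measure (normal \<sigma>) {..<x} = measure (distr (normal \<sigma>) lborel uminus) {..<x}" by simp
  also have "\<dots> = measure (normal \<sigma>) (uminus -` {..<x} \<inter> space (normal \<sigma>))"
    by (intro measure_distr) auto
  also have "uminus -` {..<x} \<inter> space (normal \<sigma>) = {-x<..}" by auto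
  finally show ?thesis using assms by (simp add: normal_greaterThan)
qed

lemma normal_singleton [simp]: "emeasure (normal \<sigma>) {x} = 0"
  by (simp add: normal_def emeasure_density nn_integral_indicator_singleton)

text \<open>The closed half-line is the form in which \<open>nn_integral_FTC_atLeast\<close>
  applies; the endpoint is a null set.\<close>

lemma upper_tail_eq_integral:
  "ennreal (upper_tail a) = (\<integral>\<^sup>+x. ennreal (std_normal_density x) * indicator {a..} x \<partial>lborel)"
proof -
  interpret N: prob_space "normal 1" by (rule prob_space_normal) simp
  have "ennreal (upper_tail a) = emeasure (normal 1) {a<..}"
    by (simp add: upper_tail_def N.emeasure_eq_measure)
  also have "\<dots> = emeasure (normal 1) ({a<..} \<union> {a})"
    by (intro emeasure_Un_null_set[symmetric]) (auto simp: null_sets_def)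
  also have "{a<..} \<union> {a} = {a..}" by auto
  finally show ?thesis by (simp add: normal_def emeasure_density)
qed

lemma upper_tail_nonneg: "0 \<le> upper_tail a"
  by (simp add: upper_tail_def)

lemma upper_tail_antimono: "a \<le> b \<Longrightarrow> upper_tail b \<le> upper_tail a"
  unfolding upper_tail_def
  using prob_space_normal[of 1] by (intro finite_measure.finite_measure_mono) (auto simp: prob_space_def)

section \<open>Mills' ratio\<close>

lemma std_normal_density_has_deriv:
  "(std_normal_density has_real_derivative - x * std_normal_density x) (at x)"
  unfolding std_normal_density_def
  by (auto intro!: derivative_eq_intros simp: power2_eq_square field_simps)

lemma std_normal_density_tendsto: "(std_normal_density \<longlongrightarrow> 0) at_top"
  unfolding std_normal_density_def by real_asymp

text \<open>Insert the factor x / a, which is at least 1 on the half-line; the integrand then has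
  the antiderivative - \<open>std_normal_density x\<close> / a.\<close>

lemma upper_tail_le:
  assumes a: "0 < a"
  shows "upper_tail a \<le> std_normal_density a / a"
proof -
  have "ennreal (upper_tail a) \<le> (\<integral>\<^sup>+x. ennreal (x / a * std_normal_density x) * indicator {a..} x \<partial>lborel)"
    unfolding upper_tail_eq_integral using a
    by (intro nn_integral_mono) (auto simp: indicator_def field_simps intro!: ennreal_leI mult_right_mono)
  also have "\<dots> = ennreal (0 - (- std_normal_density a / a))"
  proof (rule nn_integral_FTC_atLeast[where F="\<lambda>x. - std_normal_density x / a"])
    show "((\<lambda>x. - std_normal_density x / a) has_real_derivative x / a * std_normal_density x) (at x)" for x
      using DERIV_cdivide[OF DERIV_minus[OF std_normal_density_has_deriv[of x]], of a] by simp
    show "((\<lambda>x. - std_normal_density x / a) \<longlongrightarrow> 0) at_top"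
      using tendsto_divide[OF tendsto_minus[OF std_normal_density_tendsto] tendsto_const, of a] a by simp
  qed (use a in auto)
  finally show ?thesis using a by (simp add: ennreal_le_iff)
qed

text \<open>The function - \<phi>(x) x / (1 + x^2) has a derivative that is at most the density
  \<phi>(x). For x \<ge> 1 this derivative is nonnegative, so that it can be integrated as an
  \<open>ennreal\<close> function; this is the reason for \<open>1 \<le> a\<close>.\<close>

lemma upper_tail_ge:
  assumes a: "1 \<le> a"
  shows "std_normal_density a * a / (1 + a\<^sup>2) \<le> upper_tail a"
proof -
  let ?f = "\<lambda>x::real. std_normal_density x * (x^4 + 2 * x\<^sup>2 - 1) / (1 + x\<^sup>2)\<^sup>2"
  have p: "1 + x\<^sup>2 > 0" for x :: real by (simp add: add_pos_nonneg)
  have p': "(1 + x\<^sup>2)\<^sup>2 = x^4 + 2 * x\<^sup>2 + 1" for x :: real by (simp add: algebra_simps power2_eq_square power4_eq_xxxx)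
  have "ennreal (0 - (- (std_normal_density a * a / (1 + a\<^sup>2)))) = (\<integral>\<^sup>+x. ennreal (?f x) * indicator {a..} x \<partial>lborel)"
  proof (rule nn_integral_FTC_atLeast[symmetric])
    show "((\<lambda>x. - (std_normal_density x * x / (1 + x\<^sup>2))) has_real_derivative ?f x) (at x)" for x
    proof -
      have ne: "1 + x\<^sup>2 \<noteq> 0" using p[of x] by simp
      have "((\<lambda>x. - (std_normal_density x * x / (1 + x\<^sup>2))) has_real_derivative
        - (((- x * std_normal_density x * x + 1 * std_normal_density x) * (1 + x\<^sup>2) - std_normal_density x * x * (2 * x)) / ((1 + x\<^sup>2) * (1 + x\<^sup>2)))) (at x)"
        using ne by (auto intro!: derivative_eq_intros std_normal_density_has_deriv)
      also have "- (((- x * std_normal_density x * x + 1 * std_normal_density x) * (1 + x\<^sup>2) - std_normal_density x * x * (2 * x)) / ((1 + x\<^sup>2) * (1 + x\<^sup>2))) = ?f x"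
      proof -
        have "- ((- x * s * x + 1 * s) * (1 + x\<^sup>2) - s * x * (2 * x)) = s * (x^4 + 2 * x\<^sup>2 - 1)" for s
          by (simp add: algebra_simps power2_eq_square power4_eq_xxxx)
        then show ?thesis by (metis minus_divide_left power2_eq_square)
      qed
      finally show ?thesis .
    qed
    show "((\<lambda>x. - (std_normal_density x * x / (1 + x\<^sup>2))) \<longlongrightarrow> 0) at_top"
      unfolding std_normal_density_def by real_asymp
    show "0 \<le> ?f x" if "a \<le> x" for x
    proof -
      have "1 \<le> x\<^sup>2" using that a by (simp add: power2_eq_square) (smt (verit) mult_le_cancel_left1)
      then have "0 \<le> x^4 + 2 * x\<^sup>2 - 1" by (smt (verit) zero_le_even_power even_numeral)
      then show ?thesis by simp
    qed
  qed simp
  also have "\<dots> \<le> ennreal (upper_tail a)"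
    unfolding upper_tail_eq_integral
  proof (intro nn_integral_mono mult_right_mono ennreal_leI)
    fix x :: real
    have "(x^4 + 2 * x\<^sup>2 - 1) / (1 + x\<^sup>2)\<^sup>2 \<le> 1"
      unfolding p' by (subst divide_le_eq_1) (smt (verit) zero_le_even_power even_numeral)
    then have "std_normal_density x * ((x^4 + 2 * x\<^sup>2 - 1) / (1 + x\<^sup>2)\<^sup>2) \<le> std_normal_density x * 1"
      by (intro mult_left_mono) auto
    then show "?f x \<le> std_normal_density x" by simp
  qed simp
  finally show ?thesis using a by (simp add: upper_tail_nonneg ennreal_le_iff)
qed

lemma upper_tail_pos: "0 < upper_tail a"
proof -
  have "0 < std_normal_density (max a 1) * max a 1 / (1 + (max a 1)\<^sup>2)"
    by (intro divide_pos_pos mult_pos_pos add_pos_nonneg) (auto simp: std_normal_density_def)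
  also have "\<dots> \<le> upper_tail (max a 1)" by (rule upper_tail_ge) simp
  also have "\<dots> \<le> upper_tail a" by (rule upper_tail_antimono) simp
  finally show ?thesis .
qed

lemma upper_tail_2: "upper_tail 2 \<le> 1 / 4"
proof -
  have "sqrt 4 \<le> sqrt (2 * pi)" using pi_gt3 by (intro real_sqrt_le_mono) simp
  then have s: "2 \<le> sqrt (2 * pi)" by simp
  have "std_normal_density 2 \<le> 1 / sqrt (2 * pi)"
    unfolding std_normal_density_def by (intro mult_left_le) auto
  also have "\<dots> \<le> 1 / 2" using s by (intro divide_left_mono) auto
  finally show ?thesis using upper_tail_le[of 2] by simp
qed

text \<open>Two tails of at most 1/4 each. Any positive constant would do; this one becomes the
  factor 2 in the bound on \<open>F\<close> in \<open>knot_gap_tail\<close>.\<close>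

lemma normal_abs_le_2:
  assumes "0 < \<sigma>"
  shows "1 / 2 \<le> measure (normal \<sigma>) {z. \<bar>z\<bar> \<le> 2 * \<sigma>}"
proof -
  interpret N: prob_space "normal \<sigma>" by (rule prob_space_normal) fact
  have "1 = measure (normal \<sigma>) ({z. \<bar>z\<bar> \<le> 2 * \<sigma>} \<union> ({2*\<sigma><..} \<union> {..<-2*\<sigma>}))"
    using N.prob_space by (intro trans[OF N.prob_space[symmetric]] arg_cong[where f="measure _"]) auto
  also have "\<dots> \<le> measure (normal \<sigma>) {z. \<bar>z\<bar> \<le> 2 * \<sigma>} + (measure (normal \<sigma>) {2*\<sigma><..} + measure (normal \<sigma>) {..<-2*\<sigma>})"
    by (intro order_trans[OF measure_Un_le] add_left_mono measure_Un_le) auto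
  also have "\<dots> \<le> measure (normal \<sigma>) {z. \<bar>z\<bar> \<le> 2 * \<sigma>} + (1/4 + 1/4)"
    using upper_tail_2 assms by (intro add_left_mono add_mono) (auto simp: normal_greaterThan normal_lessThan)
  finally show ?thesis by simp
qed

text \<open>Bound for the ratio of the tails at u and m when u (u - m) = t and m \<ge> K. The
  exponential compares the densities, the second factor comes from the two bounds on Mills'
  ratio.\<close>

definition mills_factor :: "real \<Rightarrow> real \<Rightarrow> real" where
  "mills_factor K t = exp (- t + t\<^sup>2 / (2 * (K\<^sup>2 + t))) * (1 + 1 / K\<^sup>2)"

text \<open>The exponent is governed by u^2 - m^2 = t + m t / u. Since u m \<le> m^2 + t, the second
  term is at least t - t^2 / (m^2 + t), so half of the difference is nearly t once m is
  large.\<close>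

lemma upper_tail_ratio:
  assumes K: "1 \<le> K" "K \<le> m" and t: "0 \<le> t" and u: "m \<le> u" "u * (u - m) = t"
  shows "upper_tail u \<le> mills_factor K t * upper_tail m"
proof -
  have m: "1 \<le> m" "0 < m" "0 < u" using K u by auto
  have um: "u * m \<le> m\<^sup>2 + t"
  proof -
    have "m * (u - m) \<le> u * (u - m)" using u m by (intro mult_right_mono) auto
    then show ?thesis using u(2) by (simp add: algebra_simps power2_eq_square)
  qed
  have "t - t\<^sup>2 / (m\<^sup>2 + t) \<le> m * t / u"
  proof -
    have p: "0 < m\<^sup>2 + t" using m t by (simp add: add_pos_nonneg)
    have "t - t\<^sup>2 / (m\<^sup>2 + t) = t * m\<^sup>2 / (m\<^sup>2 + t)"
      using p by (simp add: field_simps power2_eq_square)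
    also have "\<dots> \<le> m * t / u"
    proof -
      have "(t * m) * (u * m) \<le> (t * m) * (m\<^sup>2 + t)" using um t m by (intro mult_left_mono) auto
      then show ?thesis using p m by (simp add: field_simps power2_eq_square)
    qed
    finally show ?thesis .
  qed
  moreover have "u\<^sup>2 - m\<^sup>2 = t + m * t / u"
  proof -
    have "t / u = u - m" using u(2) m by (auto simp: field_simps)
    then have "m * t / u = m * (u - m)" by (metis times_divide_eq_right)
    then show ?thesis using u(2) by (simp add: algebra_simps power2_eq_square)
  qed
  moreover have "t\<^sup>2 / (m\<^sup>2 + t) \<le> t\<^sup>2 / (K\<^sup>2 + t)"
    using K t by (intro divide_left_mono mult_pos_pos add_pos_nonneg add_right_mono power_mono) auto
  ultimately have "- (u\<^sup>2 / 2) \<le> - (m\<^sup>2 / 2) + (- t + t\<^sup>2 / (K\<^sup>2 + t) / 2)"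
  proof -
    have "- (u2 / 2) \<le> - (m2 / 2) + (- t + q' / 2)"
      if "t - q \<le> r" "u2 - m2 = t + r" "q \<le> q'" for q q' r u2 m2 :: real
      using that by linarith
    from this[of "t\<^sup>2 / (m\<^sup>2 + t)"] show ?thesis if "t - t\<^sup>2 / (m\<^sup>2 + t) \<le> m * t / u"
      "u\<^sup>2 - m\<^sup>2 = t + m * t / u" "t\<^sup>2 / (m\<^sup>2 + t) \<le> t\<^sup>2 / (K\<^sup>2 + t)" using that by blast
  qed
  then have e: "- (u\<^sup>2 / 2) \<le> - (m\<^sup>2 / 2) + (- t + t\<^sup>2 / (2 * (K\<^sup>2 + t)))"
    by (simp add: mult.commute)
  have "upper_tail u \<le> std_normal_density u / u" by (rule upper_tail_le) fact
  also have "\<dots> \<le> std_normal_density u / m" using u m by (intro divide_left_mono) auto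
  also have "\<dots> \<le> (std_normal_density m * exp (- t + t\<^sup>2 / (2 * (K\<^sup>2 + t)))) / m"
    using e m by (intro divide_right_mono) (auto simp: std_normal_density_def mult_exp_exp intro!: divide_right_mono)
  also have "\<dots> = exp (- t + t\<^sup>2 / (2 * (K\<^sup>2 + t))) * ((1 + m\<^sup>2) / m\<^sup>2) * (std_normal_density m * m / (1 + m\<^sup>2))"
  proof -
    have "s * E / m = E * (q / m\<^sup>2) * (s * m / q)" if "0 < q" for s E q :: real
      using m that by (simp add: field_simps power2_eq_square)
    then show ?thesis using add_pos_nonneg[of 1 "m\<^sup>2"] by simp
  qed
  also have "\<dots> \<le> exp (- t + t\<^sup>2 / (2 * (K\<^sup>2 + t))) * ((1 + m\<^sup>2) / m\<^sup>2) * upper_tail m"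
    using m by (intro mult_left_mono upper_tail_ge) auto
  also have "\<dots> \<le> exp (- t + t\<^sup>2 / (2 * (K\<^sup>2 + t))) * (1 + 1 / K\<^sup>2) * upper_tail m"
  proof (intro mult_right_mono mult_left_mono upper_tail_nonneg)
    have "1 / m\<^sup>2 \<le> 1 / K\<^sup>2" using K m by (intro divide_left_mono power_mono) auto
    then show "(1 + m\<^sup>2) / m\<^sup>2 \<le> 1 + 1 / K\<^sup>2" using m by (simp add: add_divide_distrib)
  qed simp
  finally show ?thesis by (simp add: mills_factor_def)
qed

lemma mills_factor_tendsto: "((\<lambda>K. mills_factor K t) \<longlongrightarrow> exp (- t)) at_top"
  unfolding mills_factor_def by real_asymp

text \<open>In each fibre the event that a given variable enters is an interval \<open>(m, b)\<close>. Cutting off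
  the part above \<open>b\<close> only decreases the ratio of the two tails.\<close>

lemma normal_ratio:
  assumes \<sigma>: "0 < \<sigma>" and K: "1 \<le> K" and t: "0 \<le> t" and I: "finite I"
    and i0: "i0 \<in> I" "0 < \<gamma> i0" "K * \<sigma> \<le> \<alpha> i0 / \<gamma> i0"
  shows "measure (normal \<sigma>) {z. (\<forall>i\<in>I. \<alpha> i < \<gamma> i * z) \<and> (\<forall>i\<in>I. 0 < \<gamma> i \<longrightarrow> t * \<sigma>\<^sup>2 < z * (z - \<alpha> i / \<gamma> i))}
    \<le> mills_factor K t * measure (normal \<sigma>) {z. \<forall>i\<in>I. \<alpha> i < \<gamma> i * z}"
    (is "measure _ ?D \<le> _ * measure _ ?E")
proof -
  interpret N: prob_space "normal \<sigma>" by (rule prob_space_normal) fact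
  define Q where "Q = (\<lambda>i. \<alpha> i / \<gamma> i) ` {i\<in>I. 0 < \<gamma> i}"
  define m where "m = Max Q"
  have Q: "finite Q" "Q \<noteq> {}" using I i0 by (auto simp: Q_def)
  have mQ: "m \<in> Q" unfolding m_def using Q by (rule Max_in)
  have mK: "K * \<sigma> \<le> m" using i0 Q unfolding m_def by (intro order_trans[OF i0(3)] Max_ge) (auto simp: Q_def)
  have m0: "0 < m" using mK K \<sigma> by (smt (verit) mult_pos_pos)
  \<comment> \<open>The constraints with nonpositive slope: a set closed downwards, which only
    bounds \<open>z\<close> from above.\<close>
  define U where "U = {z. \<forall>i\<in>I. \<gamma> i \<le> 0 \<longrightarrow> \<alpha> i < \<gamma> i * z}"
  \<comment> \<open>The larger root of u (u - m) = t \<sigma>^2. For z > m the function z (z - m) is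
    increasing, so the second condition in \<open>?D\<close> means z > u.\<close>
  define u where "u = (m + sqrt (m\<^sup>2 + 4 * (t * \<sigma>\<^sup>2))) / 2"
  have sq: "(sqrt (m\<^sup>2 + 4 * (t * \<sigma>\<^sup>2)))\<^sup>2 = m\<^sup>2 + 4 * (t * \<sigma>\<^sup>2)" using t by simp
  have uu: "u * (u - m) = t * \<sigma>\<^sup>2" using sq unfolding u_def by (simp add: field_simps power2_eq_square)
  have "sqrt (m\<^sup>2) \<le> sqrt (m\<^sup>2 + 4 * (t * \<sigma>\<^sup>2))" using t by (intro real_sqrt_le_mono) simp
  then have um: "m \<le> u" using m0 by (simp add: u_def)
  have E: "?E = {m<..} \<inter> U"
  proof -
    have "(m < z) = (\<forall>i\<in>{i\<in>I. 0 < \<gamma> i}. \<alpha> i < \<gamma> i * z)" for z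
      unfolding m_def using Q by (subst Max_less_iff) (auto simp: Q_def field_simps)
    then show ?thesis unfolding U_def by (auto simp: not_less[symmetric])
  qed
  have D: "?D \<subseteq> {u<..} \<inter> U"
  proof
    fix z assume z: "z \<in> ?D"
    then have zE: "z \<in> {m<..} \<inter> U" unfolding E[symmetric] by auto
    obtain i where i: "i \<in> I" "0 < \<gamma> i" "m = \<alpha> i / \<gamma> i" using mQ by (auto simp: Q_def)
    have "t * \<sigma>\<^sup>2 < z * (z - m)" using z i by auto
    have "u < z"
    proof (rule ccontr)
      assume "\<not> u < z"
      then have "z * (z - m) \<le> u * (u - m)" using zE m0 by (intro mult_mono) auto
      then show False using \<open>t * \<sigma>\<^sup>2 < z * (z - m)\<close> uu by simp
    qed
    then show "z \<in> {u<..} \<inter> U" using zE by auto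
  qed
  have Um: "U \<in> sets borel"
  proof -
    have "{z. \<gamma> i \<le> 0 \<longrightarrow> \<alpha> i < \<gamma> i * z} \<in> sets borel" for i by measurable
    then have "{z \<in> space borel. \<forall>i\<in>I. \<gamma> i \<le> 0 \<longrightarrow> \<alpha> i < \<gamma> i * z} \<in> sets borel"
      using i0 by (intro sets.sets_Collect_finite_All' I) auto
    then show ?thesis by (simp add: U_def)
  qed
  have Ud: "z \<in> U" if "z' \<in> U" "z \<le> z'" for z z'
    unfolding U_def
  proof (intro CollectI ballI impI)
    fix i assume "i \<in> I" "\<gamma> i \<le> 0"
    then have "\<alpha> i < \<gamma> i * z'" using \<open>z' \<in> U\<close> by (auto simp: U_def)
    also have "\<dots> \<le> \<gamma> i * z" using \<open>z \<le> z'\<close> \<open>\<gamma> i \<le> 0\<close> by (rule mult_left_mono_neg)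
    finally show "\<alpha> i < \<gamma> i * z" .
  qed
  show ?thesis
  proof (cases "u \<in> U")
    case False
    have "{u<..} \<inter> U = {}"
    proof (rule ccontr)
      assume "{u<..} \<inter> U \<noteq> {}"
      then obtain z where "u < z" "z \<in> U" by blast
      then show False using Ud[of z u] False by simp
    qed
    then have "?D = {}" using D by blast
    then have "measure (normal \<sigma>) ?D = 0" by (metis measure_empty)
    moreover have "0 \<le> mills_factor K t * measure (normal \<sigma>) ?E" by (simp add: mills_factor_def)
    ultimately show ?thesis by linarith
  next
    case True
    define a where "a = measure (normal \<sigma>) {u<..}"
    define d where "d = measure (normal \<sigma>) {m<..}"
    define c where "c = measure (normal \<sigma>) (UNIV - U)"
    have nU: "UNIV - U \<subseteq> {u<..}"
    proof
      fix z assume "z \<in> UNIV - U"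
      then show "z \<in> {u<..}" using Ud[of u z] True by (cases "u < z") auto
    qed
    have "measure (normal \<sigma>) ({u<..} \<inter> U) = a - c"
      unfolding a_def c_def using Um nU
      by (subst N.finite_measure_Diff[symmetric]) (auto intro!: arg_cong[where f="measure _"])
    moreover have "measure (normal \<sigma>) ({m<..} \<inter> U) = d - c"
      unfolding d_def c_def using Um nU um
    proof (subst N.finite_measure_Diff[symmetric])
      have "{m<..} \<inter> U = {m<..} - (UNIV - U)" by auto
      then show "measure (normal \<sigma>) ({m<..} \<inter> U) = measure (normal \<sigma>) ({m<..} - (UNIV - U))" by (rule arg_cong)
      show "UNIV - U \<subseteq> {m<..}" using nU um by auto
    qed auto
    moreover have "measure (normal \<sigma>) ?D \<le> measure (normal \<sigma>) ({u<..} \<inter> U)"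
      using D Um by (intro N.finite_measure_mono) auto
    moreover have "a \<le> mills_factor K t * d"
    proof -
      have "u / \<sigma> * (u / \<sigma> - m / \<sigma>) = t" using uu \<sigma> by (simp add: field_simps power2_eq_square)
      then show ?thesis unfolding a_def d_def using \<sigma> K mK um t
        by (simp add: normal_greaterThan) (intro upper_tail_ratio, auto simp: field_simps)
    qed
    \<comment> \<open>Removing the same mass c from numerator and denominator of a / d \<le> 1
      lowers the quotient: (a - c) / (d - c) \<le> a / d.\<close>
    moreover have "a - c \<le> mills_factor K t * (d - c)"
    proof -
      have "0 \<le> c" "c \<le> a" unfolding a_def c_def using nU by (auto intro!: N.finite_measure_mono)
      have d: "0 < d" unfolding d_def using \<sigma> by (simp add: normal_greaterThan upper_tail_pos)
      have "a \<le> d" unfolding a_def d_def using um by (intro N.finite_measure_mono) auto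
      have "a / d * c \<le> c" using \<open>a \<le> d\<close> d \<open>0 \<le> c\<close> by (intro mult_left_le_one_le) (auto simp: \<open>0 \<le> c\<close> \<open>c \<le> a\<close> order_trans[OF \<open>0 \<le> c\<close> \<open>c \<le> a\<close>])
      then have "a - c \<le> a / d * (d - c)" using d by (simp add: right_diff_distrib)
      also have "\<dots> \<le> mills_factor K t * (d - c)"
        using \<open>a \<le> mills_factor K t * d\<close> d \<open>c \<le> a\<close> \<open>a \<le> d\<close> by (intro mult_right_mono) (auto simp: field_simps)
      finally show ?thesis .
    qed
    ultimately show ?thesis unfolding E by simp
  qed
qed

section \<open>The gap between the two largest joining values\<close>

text \<open>Whatever the shift \<open>b\<close>, the strip misses one of the half-lines beyond a / c
  and - a / c, namely the one towards which \<open>b\<close> already pushes. A bound below 1 that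
  does not involve \<open>b\<close> is what the conditional argument needs.\<close>

lemma normal_strip_le:
  assumes "0 < \<sigma>" "0 < c"
  shows "measure (normal \<sigma>) {z. \<bar>b + c * z\<bar> \<le> a} \<le> 1 - upper_tail (a / (c * \<sigma>))"
proof -
  interpret N: prob_space "normal \<sigma>" by (rule prob_space_normal) fact
  have "{z. \<bar>b + c * z\<bar> \<le> a} \<subseteq> UNIV - (if 0 \<le> b then {a / c<..} else {..<- (a / c)})"
    using assms by (auto simp: field_simps abs_le_iff)
  then have "measure (normal \<sigma>) {z. \<bar>b + c * z\<bar> \<le> a}
    \<le> measure (normal \<sigma>) (UNIV - (if 0 \<le> b then {a / c<..} else {..<- (a / c)}))"
    by (intro N.finite_measure_mono) auto
  also have "\<dots> = 1 - measure (normal \<sigma>) (if 0 \<le> b then {a / c<..} else {..<- (a / c)})"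
    using N.prob_compl[of "if 0 \<le> b then {a / c<..} else {..<- (a / c)}"] by simp
  also have "\<dots> = 1 - upper_tail (a / (c * \<sigma>))"
    using assms by (simp add: normal_greaterThan normal_lessThan)
  finally show ?thesis .
qed

lemma measurable_dotf_const [measurable]:
  "(\<lambda>e. dotf n v e) \<in> borel_measurable (Pi\<^sub>M {..<n} (\<lambda>_. borel))"
  unfolding dotf_def by measurable

lemma upper_tail_le_1: "upper_tail a \<le> 1"
  unfolding upper_tail_def using prob_space_normal[of 1] by (simp add: prob_space.prob_le_1)

text \<open>\<open>w\<close> is the residual of \<open>r i\<close> after regression on the other vectors.\<close>

lemma gauss_small_ball:
  assumes \<sigma>: "0 < \<sigma>" and \<tau>: "0 < \<tau>" and a: "0 \<le> a" and S: "finite S"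
    and w: "\<And>i. i \<in> S \<Longrightarrow> \<exists>w. (\<forall>l\<in>S - {i}. dotf n (r l) w = 0) \<and> dotf n (r i) w = dotf n w w \<and> \<tau>\<^sup>2 \<le> dotf n w w"
  shows "measure (gauss n \<sigma>) {e \<in> space (gauss n \<sigma>). \<forall>i\<in>S. \<bar>dotf n (r i) e\<bar> \<le> a} \<le> (1 - upper_tail (a / (\<tau> * \<sigma>))) ^ card S"
proof -
  interpret G: prob_space "gauss n \<sigma>" by (rule prob_space_gauss) fact
  interpret N: prob_space "normal \<sigma>" by (rule prob_space_normal) fact
  define \<theta> where "\<theta> = 1 - upper_tail (a / (\<tau> * \<sigma>))"
  have \<theta>: "0 \<le> \<theta>" using upper_tail_le_1 by (simp add: \<theta>_def)
  define A where "A = (\<lambda>T. {e \<in> space (gauss n \<sigma>). \<forall>i\<in>T. \<bar>dotf n (r i) e\<bar> \<le> a})"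
  have A[measurable]: "A T \<in> sets (gauss n \<sigma>)" if "finite T" for T
    unfolding A_def using that by measurable
  \<comment> \<open>Induction over subsets of \<open>S\<close>. The vector \<open>w\<close>
    belonging to \<open>i\<close> is orthogonal to all other \<open>r l\<close>, so moving along it
    changes the \<open>i\<close>-th condition only; in each fibre this condition costs another
    factor \<theta>.\<close>
  have "finite T \<Longrightarrow> T \<subseteq> S \<Longrightarrow> measure (gauss n \<sigma>) (A T) \<le> \<theta> ^ card T" for T
  proof (induction T rule: finite_induct)
    case empty
    then show ?case by simp
  next
    case (insert i T)
    obtain w where w: "\<forall>l\<in>S - {i}. dotf n (r l) w = 0" "dotf n (r i) w = dotf n w w" "\<tau>\<^sup>2 \<le> dotf n w w"
      using assms(5)[of i] insert by auto
    define c where "c = sqrt (dotf n w w)"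
    have "0 < \<tau>\<^sup>2" using \<tau> by simp
    then have "0 < dotf n w w" using w(3) by linarith
    then have c0: "0 < c" "c * c = dotf n w w" by (auto simp: c_def)
    have "sqrt (\<tau>\<^sup>2) \<le> c" unfolding c_def using w(3) by (rule real_sqrt_le_mono)
    then have c: "\<tau> \<le> c" using \<tau> by simp
    define u where "u = (\<lambda>k. w k / c)"
    have du: "dotf n v u = dotf n v w / c" for v by (simp add: dotf_def u_def sum_divide_distrib)
    have "dotf n u u = dotf n w w / c / c" unfolding du[of u] dotf_commute[of n u w] du[of w] ..
    then have u: "dotf n u u = 1" using c0(1) unfolding c0(2)[symmetric] by simp
    have "emeasure (gauss n \<sigma>) (A (insert i T))
      = (\<integral>\<^sup>+e. emeasure (normal \<sigma>) {z. line_shift n u e z \<in> A (insert i T)} \<partial>gauss n \<sigma>)"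
      by (rule gauss_fibre[OF \<sigma> u]) (use insert A[of "insert i T"] in \<open>simp add: sets_gauss\<close>)
    also have "\<dots> \<le> (\<integral>\<^sup>+e. ennreal \<theta> * indicator (A T) e \<partial>gauss n \<sigma>)"
    proof (rule nn_integral_mono)
      fix e assume e: "e \<in> space (gauss n \<sigma>)"
      have sp: "line_shift n u e z \<in> space (gauss n \<sigma>)" for z by (simp add: space_gauss line_shift_def)
      have l: "dotf n (r l) (line_shift n u e z) = dotf n (r l) e" if "l \<in> T" for l z
      proof -
        have "l \<in> S - {i}" using that insert by auto
        then have "dotf n (r l) w = 0" using w(1) by blast
        then show ?thesis by (simp add: dotf_line_shift du)
      qed
      have i: "dotf n (r i) (line_shift n u e z) = (dotf n (r i) e - dotf n u e * c) + c * z" for z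
      proof -
      have "dotf n (r i) u = c" unfolding du w(2) c0(2)[symmetric] using c0(1) by simp
      then show ?thesis by (simp add: dotf_line_shift algebra_simps)
    qed
      show "emeasure (normal \<sigma>) {z. line_shift n u e z \<in> A (insert i T)} \<le> ennreal \<theta> * indicator (A T) e"
      proof (cases "e \<in> A T")
        case False
        then have "{z. line_shift n u e z \<in> A (insert i T)} = {}" using e l by (auto simp: A_def)
        then show ?thesis by simp
      next
        case True
        have "{z. line_shift n u e z \<in> A (insert i T)} = {z. \<bar>(dotf n (r i) e - dotf n u e * c) + c * z\<bar> \<le> a}"
          using True l sp by (auto simp: A_def i)
        also have "emeasure (normal \<sigma>) \<dots> \<le> 1 - upper_tail (a / (c * \<sigma>))"
          using normal_strip_le[OF \<sigma> c0(1)] by (simp add: N.emeasure_eq_measure ennreal_leI)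
        also have "\<dots> \<le> ennreal \<theta>"
          unfolding \<theta>_def using a c \<tau> \<sigma> c0
          by (intro ennreal_leI diff_left_mono upper_tail_antimono divide_left_mono mult_right_mono) auto
        finally show ?thesis using True by simp
      qed
    qed
    also have "\<dots> = ennreal \<theta> * emeasure (gauss n \<sigma>) (A T)"
      using A insert by (simp add: nn_integral_cmult_indicator)
    also have "\<dots> \<le> ennreal \<theta> * ennreal (\<theta> ^ card T)"
      using insert by (intro mult_left_mono) (auto simp: G.emeasure_eq_measure intro!: ennreal_leI)
    finally show ?case using insert \<theta> by (simp add: G.emeasure_eq_measure ennreal_mult'[symmetric] ennreal_le_iff)
  qed
  from this[OF S] show ?thesis by (simp add: A_def \<theta>_def)
qed

text \<open>\<open>g q\<close> is the joining value of the variable and sign \<open>q\<close> at the first knot, and \<open>h q q'\<close> that of \<open>q'\<close> after \<open>q\<close>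
  has joined.\<close>

lemma knot_gap_tail:
  fixes r :: "nat \<Rightarrow> nat \<Rightarrow> real" and c :: "nat \<times> real \<Rightarrow> real"
  assumes \<sigma>: "0 < \<sigma>" and J: "finite J" and \<eta>: "0 < \<eta>" "\<eta> \<le> 1" and C: "0 < C" and \<delta>: "0 < \<delta>"
    and K: "1 \<le> K" and t: "0 \<le> t"
    and R: "\<And>i j. R i j = dotf n (r i) (r j)" and Rpos: "\<And>j. j \<in> J \<Longrightarrow> 0 < R j j"
    and RC: "\<And>i j. i \<in> J \<Longrightarrow> j \<in> J \<Longrightarrow> R i i \<le> C * R j j"
    and c: "\<And>j s. j \<in> J \<Longrightarrow> s \<in> {-1, 1} \<Longrightarrow> \<eta> \<le> s * c (j, s) \<and> s * c (j, s) \<le> 2 - \<eta>"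
    and S: "\<And>j. j \<in> J \<Longrightarrow> \<exists>S\<subseteq>J - {j}. D \<le> card S \<and> (\<forall>i\<in>S. \<bar>R i j\<bar> < \<eta> / (2 - \<eta>) * R j j \<and>
      (\<exists>w. (\<forall>l\<in>S - {i}. dotf n (r l) w = 0) \<and> dotf n (r i) w = dotf n w w \<and> \<delta>\<^sup>2 * R i i \<le> dotf n w w))"
    and D: "0 < D"
  defines "Q \<equiv> J \<times> {-1, 1}"
  defines "g \<equiv> \<lambda>(i, s) e. dotf n (r i) e / c (i, s)"
  defines "den \<equiv> \<lambda>(j, s) (i, s'). c (i, s') - R i j / R j j * c (j, s)"
  defines "h \<equiv> \<lambda>(j, s) (i, s') e. (dotf n (r i) e - R i j / R j j * dotf n (r j) e) / den (j, s) (i, s')"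
  shows "measure (gauss n \<sigma>) {e \<in> space (gauss n \<sigma>). \<exists>q\<in>Q. (\<forall>q'\<in>Q - {q}. g q' e < g q e) \<and>
      (\<forall>q'\<in>Q - {q}. 0 < snd q' * den q q' \<longrightarrow> t * \<sigma>\<^sup>2 < (c q)\<^sup>2 / R (fst q) (fst q) * (g q e * (g q e - h q q' e)))}
    \<le> mills_factor K t + 4 * real (card J) * (1 - upper_tail ((2 * K / \<eta> + 2) * sqrt C / \<delta>)) ^ D"
proof -
  interpret G: prob_space "gauss n \<sigma>" by (rule prob_space_gauss) fact
  interpret N: prob_space "normal \<sigma>" by (rule prob_space_normal) fact
  define \<theta> where "\<theta> = 1 - upper_tail ((2 * K / \<eta> + 2) * sqrt C / \<delta>)"
  have \<theta>: "0 \<le> \<theta>" "\<theta> \<le> 1" using upper_tail_le_1 upper_tail_nonneg by (auto simp: \<theta>_def)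
  define E where "E = (\<lambda>q. {e \<in> space (gauss n \<sigma>). \<forall>q'\<in>Q - {q}. g q' e < g q e})"
  define B where "B = (\<lambda>q. {e \<in> space (gauss n \<sigma>). (\<forall>q'\<in>Q - {q}. g q' e < g q e) \<and>
      (\<forall>q'\<in>Q - {q}. 0 < snd q' * den q q' \<longrightarrow> t * \<sigma>\<^sup>2 < (c q)\<^sup>2 / R (fst q) (fst q) * (g q e * (g q e - h q q' e)))})"
  have Q: "finite Q" using J by (simp add: Q_def)
  have [measurable]: "g q \<in> borel_measurable (Pi\<^sub>M {..<n} (\<lambda>_. borel))" for q
    unfolding g_def by (cases q) simp
  have [measurable]: "h q q' \<in> borel_measurable (Pi\<^sub>M {..<n} (\<lambda>_. borel))" for q q'
    unfolding h_def by (cases q; cases q') simp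
  have gm: "g q \<in> borel_measurable (gauss n \<sigma>)" "h q q' \<in> borel_measurable (gauss n \<sigma>)" for q q' by measurable
  have Qq: "finite (Q - {q})" for q using Q by simp
  have E[measurable]: "E q \<in> sets (gauss n \<sigma>)" for q unfolding E_def
    by (intro sets.sets_Collect_finite_All Qq borel_measurable_less gm)
  have B[measurable]: "B q \<in> sets (gauss n \<sigma>)" for q unfolding B_def
    by (intro sets.sets_Collect_conj sets.sets_Collect_finite_All sets.sets_Collect_imp sets.sets_Collect_const Qq borel_measurable_less gm
       borel_measurable_const borel_measurable_times borel_measurable_diff)
  have m0: "0 \<le> mills_factor K t" by (simp add: mills_factor_def)
  have key: "measure (gauss n \<sigma>) (B q) \<le> mills_factor K t * measure (gauss n \<sigma>) (E q) + 2 * \<theta> ^ D" if q: "q \<in> Q" for q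
  proof -
    obtain j s where js: "q = (j, s)" "j \<in> J" "s \<in> {-1, 1}" using q by (auto simp: Q_def)
    obtain S where S: "S \<subseteq> J - {j}" "D \<le> card S" "\<And>i. i \<in> S \<Longrightarrow> \<bar>R i j\<bar> < \<eta> / (2 - \<eta>) * R j j"
      "\<And>i. i \<in> S \<Longrightarrow> \<exists>w. (\<forall>l\<in>S - {i}. dotf n (r l) w = 0) \<and> dotf n (r i) w = dotf n w w \<and> \<delta>\<^sup>2 * R i i \<le> dotf n w w"
      using assms(13)[OF js(2)] by metis
    have finS: "finite S" using S(1) J by (auto intro: finite_subset)
    have Rj: "0 < R j j" using Rpos js by simp
    define \<rho> where "\<rho> = sqrt (R j j)"
    have \<rho>: "0 < \<rho>" "\<rho> * \<rho> = R j j" using Rj by (auto simp: \<rho>_def)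
    have ss: "s * s = 1" using js by auto
    define cq where "cq = s * c q"
    have cq: "\<eta> \<le> cq" "cq \<le> 2 - \<eta>" "0 < cq" "c q = s * cq" using c[OF js(2,3)] \<eta> ss by (auto simp: cq_def js mult.assoc[symmetric])
    \<comment> \<open>In the fibre coordinate \<open>z\<close> along \<open>u\<close> the joining
      value \<open>g q\<close> is \<kappa> z; the sign in \<open>u\<close> below makes it increase
      with \<open>z\<close>. Thus \<kappa> \<sigma> is the standard deviation of
      \<open>g q\<close>.\<close>
    define \<kappa> where "\<kappa> = \<rho> / cq"
    have \<kappa>: "0 < \<kappa>" using \<rho> cq by (simp add: \<kappa>_def)
    define u where "u = (\<lambda>k. s * r j k / \<rho>)"
    have du: "dotf n v u = s * dotf n v (r j) / \<rho>" for v
      by (simp add: dotf_def u_def sum_divide_distrib sum_distrib_left mult.left_commute)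
    have "dotf n u u = s * (s * R j j / \<rho>) / \<rho>" unfolding du[of u] dotf_commute[of n u "r j"] du[of "r j"] R ..
    also have "\<dots> = (s * s) * (R j j / (\<rho> * \<rho>))" by simp
    finally have u: "dotf n u u = 1" using \<rho>(1) Rj unfolding ss \<rho>(2) by simp
    \<comment> \<open>The inner product of the noise with the part of \<open>r i\<close> orthogonal
      to \<open>r j\<close>; it is constant on fibres.\<close>
    define x where "x = (\<lambda>i e. dotf n (r i) e - R i j / R j j * dotf n (r j) e)"
    have x_eq: "x i e = dotf n (r i) e - R i j / R j j * dotf n (r j) e" for i e by (simp add: x_def)
    have ue: "dotf n u e = s * dotf n (r j) e / \<rho>" for e by (simp add: dotf_commute[of n u e] du dotf_commute[of n e])
    have rl: "dotf n (r i) (line_shift n u e z) = x i e + s * R i j / \<rho> * z" for i e z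
    proof -
      have "dotf n u e * dotf n (r i) u = (s * s) * (R i j / (\<rho> * \<rho>)) * dotf n (r j) e"
        by (simp add: ue du R)
      then have "dotf n u e * dotf n (r i) u = R i j / R j j * dotf n (r j) e" by (simp only: ss \<rho>(2) mult_1)
      moreover have "dotf n (r i) u = s * R i j / \<rho>" by (simp add: du R)
      moreover have "dotf n (r i) (line_shift n u e z) = z * dotf n (r i) u - dotf n u e * dotf n (r i) u + dotf n (r i) e"
        by (simp add: dotf_line_shift left_diff_distrib)
      ultimately show ?thesis by (simp only: x_def mult.commute)
    qed
    have xl: "x i (line_shift n u e z) = x i e" for i e z
    proof -
      have "b / a * (s * a / \<rho>) = s * b / \<rho>" if "0 < a" for a b :: real using that by simp
      from this[OF Rj] have "R i j / R j j * (s * R j j / \<rho>) = s * R i j / \<rho>" .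
      moreover have "x j e = 0" using Rj by (simp add: x_def)
      moreover have "x i (line_shift n u e z) = x i e + s * R i j / \<rho> * z - R i j / R j j * x j e - R i j / R j j * (s * R j j / \<rho>) * z"
      proof -
        have "a - b * (c' + d * z) = a - b * c' - b * d * z" for a b c' d :: real by (simp add: algebra_simps)
        then show ?thesis unfolding x_eq[of i "line_shift n u e z"] rl .
      qed
      ultimately show ?thesis by (simp only: mult_zero_right diff_zero add_diff_cancel_right')
    qed
    \<comment> \<open>Chosen so that a single i in S with |x i e| > b forces the left endpoint above
      K \<sigma>: there \<kappa> \<le> \<rho>/\<eta>, and the signed denominator is at most
      2.\<close>
    define b where "b = 2 * K * \<sigma> * \<rho> / \<eta>"
    define F where "F = {e \<in> space (gauss n \<sigma>). \<forall>i\<in>S. \<bar>x i e\<bar> \<le> b}"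
    have [measurable]: "x i \<in> borel_measurable (Pi\<^sub>M {..<n} (\<lambda>_. borel))" for i unfolding x_def by measurable
    have F[measurable]: "F \<in> sets (gauss n \<sigma>)" unfolding F_def using finS by measurable
    have sp: "line_shift n u e z \<in> space (gauss n \<sigma>)" for e z by (simp add: space_gauss line_shift_def)
    have \<eta>2: "\<eta> / (2 - \<eta>) \<le> 1" using \<eta> by simp
    \<comment> \<open>The hypothesis on \<open>S\<close> bounds the conditional variances of the \<open>r i\<close>, not those of their parts \<open>x i\<close> orthogonal to
      \<open>r j\<close>. The component along \<open>r j\<close> is independent of the \<open>x i\<close> and small with probability at least a half; then
      small \<open>x i\<close> make all \<open>r i\<close> small.\<close>
    have Fsmall: "measure (gauss n \<sigma>) F \<le> 2 * \<theta> ^ D"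
    proof -
      \<comment> \<open>The component along \<open>r j\<close> adds at most |R_ij|/\<rho> \<le>
        \<rho> times |z| \<le> 2 \<sigma>. The value \<tau> is a lower bound for the conditional
        standard deviations in units of \<sigma>, obtained from R_ii \<ge> R_jj / C.\<close>
      define a where "a = b + 2 * \<sigma> * \<rho>"
      define \<tau> where "\<tau> = \<delta> * \<rho> / sqrt C"
      define A where "A = {e \<in> space (gauss n \<sigma>). \<forall>i\<in>S. \<bar>dotf n (r i) e\<bar> \<le> a}"
      have A: "A \<in> sets (gauss n \<sigma>)" unfolding A_def using finS by measurable
      have "measure (gauss n \<sigma>) A \<le> (1 - upper_tail (a / (\<tau> * \<sigma>))) ^ card S"
        unfolding A_def
      proof (rule gauss_small_ball)
        show "0 < \<tau>" using \<delta> \<rho> C by (simp add: \<tau>_def)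
        show "0 \<le> a" using K \<sigma> \<rho> \<eta> by (simp add: a_def b_def)
        fix i assume i: "i \<in> S"
        obtain w where w: "\<forall>l\<in>S - {i}. dotf n (r l) w = 0" "dotf n (r i) w = dotf n w w" "\<delta>\<^sup>2 * R i i \<le> dotf n w w"
          using S(4)[OF i] by auto
        have "\<tau>\<^sup>2 = \<delta>\<^sup>2 * (R j j / C)" using C \<rho> by (simp add: \<tau>_def power_divide power_mult_distrib power2_eq_square[of \<rho>])
        also have "\<dots> \<le> \<delta>\<^sup>2 * R i i" using RC[of j i] i S(1) js C by (intro mult_left_mono) (auto simp: field_simps)
        finally show "\<exists>w. (\<forall>l\<in>S - {i}. dotf n (r l) w = 0) \<and> dotf n (r i) w = dotf n w w \<and> \<tau>\<^sup>2 \<le> dotf n w w"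
          using w by (intro exI[of _ w]) auto
      qed (use \<sigma> finS in auto)
      \<comment> \<open>The scales \<rho> and \<sigma> cancel, so \<theta> depends neither on
        \<open>j\<close> nor on the dimension.\<close>
      also have "a / (\<tau> * \<sigma>) = (2 * K / \<eta> + 2) * sqrt C / \<delta>"
        using \<sigma> \<rho> \<delta> C \<eta> by (simp add: a_def b_def \<tau>_def field_simps)
      finally have "measure (gauss n \<sigma>) A \<le> \<theta> ^ card S" by (simp add: \<theta>_def)
      also have "\<dots> \<le> \<theta> ^ D" using \<theta> S(2) by (intro power_decreasing) auto
      finally have mA: "measure (gauss n \<sigma>) A \<le> \<theta> ^ D" .
      have "ennreal (1 / 2 * measure (gauss n \<sigma>) F) = (\<integral>\<^sup>+e. ennreal (1 / 2) * indicator F e \<partial>gauss n \<sigma>)"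
        by (subst nn_integral_cmult_indicator) (simp_all only: F G.emeasure_eq_measure ennreal_mult'' measure_nonneg)
      also have "\<dots> \<le> (\<integral>\<^sup>+e. emeasure (normal \<sigma>) {z. line_shift n u e z \<in> A} \<partial>gauss n \<sigma>)"
      proof (rule nn_integral_mono)
        fix e
        show "ennreal (1 / 2) * indicator F e \<le> emeasure (normal \<sigma>) {z. line_shift n u e z \<in> A}"
        proof (cases "e \<in> F")
          case True
          have "ennreal (1 / 2) \<le> emeasure (normal \<sigma>) {z. \<bar>z\<bar> \<le> 2 * \<sigma>}"
            unfolding N.emeasure_eq_measure by (rule ennreal_leI[OF normal_abs_le_2[OF \<sigma>]])
          also have "\<dots> \<le> emeasure (normal \<sigma>) {z. line_shift n u e z \<in> A}"
          proof (rule emeasure_mono)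
            have [measurable]: "(\<lambda>z. line_shift n u e z) \<in> measurable borel (Pi\<^sub>M {..<n} (\<lambda>_. borel))"
              unfolding line_shift_def by measurable
            have "A \<in> sets (Pi\<^sub>M {..<n} (\<lambda>_. borel))" using A by (simp add: sets_gauss)
            then show "{z. line_shift n u e z \<in> A} \<in> sets (normal \<sigma>)" by simp
            show "{z. \<bar>z\<bar> \<le> 2 * \<sigma>} \<subseteq> {z. line_shift n u e z \<in> A}"
            proof safe
              fix z :: real assume z: "\<bar>z\<bar> \<le> 2 * \<sigma>"
              have "\<bar>x i e + s * R i j / \<rho> * z\<bar> \<le> a" if i: "i \<in> S" for i
              proof -
                have "\<bar>R i j\<bar> \<le> 1 * R j j" using S(3)[OF i] \<eta>2 Rj by (intro order_trans[OF less_imp_le mult_right_mono]) auto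
                then have "\<bar>s * R i j / \<rho>\<bar> \<le> \<rho>" using \<rho> js by (auto simp: abs_mult field_simps)
                then have "\<bar>s * R i j / \<rho> * z\<bar> \<le> \<rho> * (2 * \<sigma>)" unfolding abs_mult[of _ z] using z \<rho> by (intro mult_mono) auto
                moreover have "\<bar>x i e\<bar> \<le> b" using True i by (auto simp: F_def)
                ultimately show ?thesis unfolding a_def by (simp only: mult_ac)
              qed
              then show "line_shift n u e z \<in> A" using sp by (simp add: A_def rl)
            qed
          qed
          finally show ?thesis using True by simp
        qed simp
      qed
      also have "\<dots> = emeasure (gauss n \<sigma>) A"
        by (rule gauss_fibre[OF \<sigma> u, symmetric]) (use A in \<open>simp add: sets_gauss\<close>)
      finally have "1 / 2 * measure (gauss n \<sigma>) F \<le> measure (gauss n \<sigma>) A"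
        by (simp add: G.emeasure_eq_measure ennreal_le_iff)
      then show ?thesis using mA by simp
    qed
    have "emeasure (gauss n \<sigma>) (B q) = (\<integral>\<^sup>+e. emeasure (normal \<sigma>) {z. line_shift n u e z \<in> B q} \<partial>gauss n \<sigma>)"
      by (rule gauss_fibre[OF \<sigma> u]) (use B in \<open>simp add: sets_gauss\<close>)
    also have "\<dots> \<le> (\<integral>\<^sup>+e. ennreal (mills_factor K t) * emeasure (normal \<sigma>) {z. line_shift n u e z \<in> E q} + indicator F e \<partial>gauss n \<sigma>)"
    proof (rule nn_integral_mono)
      fix e assume e: "e \<in> space (gauss n \<sigma>)"
      show "emeasure (normal \<sigma>) {z. line_shift n u e z \<in> B q}
        \<le> ennreal (mills_factor K t) * emeasure (normal \<sigma>) {z. line_shift n u e z \<in> E q} + indicator F e"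
      proof (cases "e \<in> F")
        case True
        have "emeasure (normal \<sigma>) {z. line_shift n u e z \<in> B q} \<le> 1" by (rule N.emeasure_le_1)
        then show ?thesis using True by (simp add: add_increasing)
      next
        case False
        \<comment> \<open>On the fibre of \<open>e\<close> the inequality \<open>g q' < g q\<close>
          reads \<alpha> q' < \<gamma> q' * z, and \<kappa> \<alpha> q' / \<gamma> q' is the joining
          value \<open>h q q'\<close>, free of \<open>z\<close>.\<close>
        define \<alpha> where "\<alpha> = (\<lambda>q'. x (fst q') e / c q')"
        define \<gamma> where "\<gamma> = (\<lambda>q'. \<kappa> * den q q' / c q')"
        have c0: "c q' \<noteq> 0" "snd q' * snd q' = 1" "0 < snd q' * c q'" if "q' \<in> Q" for q'
        proof -
          obtain i s' where "q' = (i, s')" "i \<in> J" "s' \<in> {-1, 1}" using \<open>q' \<in> Q\<close> by (auto simp: Q_def)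
          then show "c q' \<noteq> 0" "snd q' * snd q' = 1" "0 < snd q' * c q'" using c[of i s'] \<eta> by auto
        qed
        have gq: "g q (line_shift n u e z) = \<kappa> * z" for z
        proof -
          have "x j e = 0" using Rj by (simp add: x_def)
          then show ?thesis using \<rho> cq js ss by (auto simp: g_def rl \<kappa>_def field_simps)
        qed
        have gq': "(g q' (line_shift n u e z) < g q (line_shift n u e z)) = (\<alpha> q' < \<gamma> q' * z)" if q': "q' \<in> Q" for q' z
        proof -
          obtain i s' where qi: "q' = (i, s')" by (cases q')
          have "s * R i j / \<rho> = \<kappa> * (R i j / R j j * c q)"
            using cq \<rho> Rj by (simp add: \<kappa>_def) (simp add: field_simps flip: \<rho>(2))
          then have "g q' (line_shift n u e z) = \<alpha> q' + \<kappa> * (R i j / R j j * c q) / c q' * z"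
            by (simp add: g_def qi rl \<alpha>_def add_divide_distrib)
          moreover have "\<gamma> q' = \<kappa> - \<kappa> * (R i j / R j j * c q) / c q'"
            using c0(1)[OF q'] by (simp add: \<gamma>_def den_def qi js(1) diff_divide_distrib right_diff_distrib)
          ultimately have "\<gamma> q' * z = \<kappa> * z - \<kappa> * (R i j / R j j * c q) / c q' * z"
            "g q' (line_shift n u e z) = \<alpha> q' + \<kappa> * (R i j / R j j * c q) / c q' * z"
            by (simp_all only: left_diff_distrib)
          then show ?thesis unfolding gq by linarith
        qed
        have h: "h q q' (line_shift n u e z) = \<kappa> * (\<alpha> q' / \<gamma> q')" if q': "q' \<in> Q" for q' z
        proof -
          obtain i s' where qi: "q' = (i, s')" by (cases q')
          have "h q q' (line_shift n u e z) = x i (line_shift n u e z) / den q q'"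
            by (simp only: h_def js(1) qi x_def prod.case)
          also have "\<dots> = x i e / den q q'" by (simp only: xl)
          also have "\<dots> = \<kappa> * (\<alpha> q' / \<gamma> q')"
          proof -
            have "X / B = \<kappa> * ((X / A) / (\<kappa> * B / A))" if "A \<noteq> 0" for A B X :: real
              using that \<kappa> by simp
            then show ?thesis unfolding \<alpha>_def \<gamma>_def qi fst_conv using c0(1)[OF q'] qi by blast
          qed
          finally show ?thesis .
        qed
        have \<gamma>pos: "(0 < snd q' * den q q') = (0 < \<gamma> q')" if q': "q' \<in> Q" for q'
        proof -
          have "snd q' * den q q' = (snd q' * c q') * (den q q' / c q')" using c0(1)[OF q'] by simp
          then show ?thesis using c0(3)[OF q'] \<kappa> by (simp add: \<gamma>_def zero_less_mult_iff zero_less_divide_iff)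
             (smt (verit) mult_less_0_iff zero_less_mult_iff)
        qed
        have T: "(c q)\<^sup>2 / R (fst q) (fst q) * (g q (line_shift n u e z) * (g q (line_shift n u e z) - h q q' (line_shift n u e z)))
          = z * (z - \<alpha> q' / \<gamma> q')" if "q' \<in> Q" for q' z
        proof -
          have "(c q)\<^sup>2 / R j j * \<kappa>\<^sup>2 = 1"
            using cq \<rho> Rj js(3) by (auto simp: \<kappa>_def power_divide power_mult_distrib power2_eq_square[of \<rho>])
          moreover have "(c q)\<^sup>2 / R (fst q) (fst q) * (g q (line_shift n u e z) * (g q (line_shift n u e z) - h q q' (line_shift n u e z)))
             = ((c q)\<^sup>2 / R j j * \<kappa>\<^sup>2) * (z * (z - \<alpha> q' / \<gamma> q'))"
          proof -
            have "A * (\<kappa> * z * (\<kappa> * z - \<kappa> * B)) = (A * \<kappa>\<^sup>2) * (z * (z - B))" for A B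
              by (simp add: algebra_simps power2_eq_square)
            then show ?thesis unfolding gq h[OF that] unfolding js(1) fst_conv .
          qed
          ultimately show ?thesis by (simp only: mult_1)
        qed
        obtain i where i: "i \<in> S" "b < \<bar>x i e\<bar>" using False e by (auto simp: F_def not_le)
        \<comment> \<open>The sign is that of \<open>x i e\<close>, which makes the threshold
          belonging to \<open>i0\<close> positive.\<close>
        define i0 where "i0 = (i, if 0 \<le> x i e then 1 else -1 :: real)"
        have i0: "i0 \<in> Q - {q}" using i S(1) js by (auto simp: i0_def Q_def)
        have dd: "0 < snd i0 * den q i0" "snd i0 * den q i0 \<le> 2"
        proof -
          have "\<bar>R i j / R j j * c q\<bar> = \<bar>R i j\<bar> / R j j * cq"
            using cq Rj js(3) by (auto simp: abs_mult)
          also have "\<dots> \<le> \<bar>R i j\<bar> / R j j * (2 - \<eta>)" using cq Rj by (intro mult_left_mono) auto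
          \<comment> \<open>The factor \<eta>/(2 - \<eta>) compensates the largest possible |c q|,
            namely 2 - \<eta>. So the correction stays below the smallest possible signed
            denominator \<eta>, and the corrected one stays below (2 - \<eta>) + \<eta> = 2.\<close>
          also have "\<dots> < \<eta>" using S(3)[OF i(1)] \<eta> Rj by (simp add: field_simps)
          finally have "\<bar>R i j / R j j * c q\<bar> < \<eta>" .
          moreover have "\<eta> \<le> snd i0 * c i0 \<and> snd i0 * c i0 \<le> 2 - \<eta>"
            using c[of i "snd i0"] i S(1) by (auto simp: i0_def)
          moreover have "snd i0 * den q i0 = snd i0 * c i0 - snd i0 * (R i j / R j j * c q)"
            by (simp add: den_def js(1) i0_def right_diff_distrib)
          moreover have "\<bar>snd i0 * (R i j / R j j * c q)\<bar> = \<bar>R i j / R j j * c q\<bar>"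
            unfolding abs_mult[of "snd i0"] by (simp add: i0_def)
          ultimately show "0 < snd i0 * den q i0" "snd i0 * den q i0 \<le> 2" by linarith+
        qed
        have large: "K * \<sigma> \<le> \<alpha> i0 / \<gamma> i0"
        proof -
          have "\<alpha> i0 / \<gamma> i0 = x i e / (\<kappa> * den q i0)" using c0(1)[of i0] i0 \<kappa> by (simp add: \<alpha>_def \<gamma>_def) (simp add: i0_def)
          also have "\<dots> = (snd i0 * x i e) / (\<kappa> * (snd i0 * den q i0))" by (simp add: i0_def)
          also have "snd i0 * x i e = \<bar>x i e\<bar>" by (simp add: i0_def)
          finally have *: "\<alpha> i0 / \<gamma> i0 = \<bar>x i e\<bar> / (\<kappa> * (snd i0 * den q i0))" .
          have "K * \<sigma> * (\<kappa> * (snd i0 * den q i0)) \<le> K * \<sigma> * (\<rho> / \<eta> * 2)"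
            using dd \<kappa> K \<sigma> \<rho> cq \<eta> by (intro mult_left_mono mult_mono) (auto simp: \<kappa>_def intro!: divide_left_mono)
          also have "\<dots> = b" by (simp add: b_def)
          finally have "K * \<sigma> * (\<kappa> * (snd i0 * den q i0)) \<le> \<bar>x i e\<bar>" using i by simp
          then show ?thesis unfolding * using dd \<kappa> by (subst pos_le_divide_eq) auto
        qed
        have "{z. line_shift n u e z \<in> B q} = {z. (\<forall>i\<in>Q - {q}. \<alpha> i < \<gamma> i * z) \<and> (\<forall>i\<in>Q - {q}. 0 < \<gamma> i \<longrightarrow> t * \<sigma>\<^sup>2 < z * (z - \<alpha> i / \<gamma> i))}"
          using sp gq' \<gamma>pos T by (simp add: B_def)
        moreover have "{z. line_shift n u e z \<in> E q} = {z. \<forall>i\<in>Q - {q}. \<alpha> i < \<gamma> i * z}"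
          using sp gq' by (simp add: E_def)
        moreover have "0 < \<gamma> i0" using dd \<gamma>pos i0 by simp
        ultimately have "measure (normal \<sigma>) {z. line_shift n u e z \<in> B q} \<le> mills_factor K t * measure (normal \<sigma>) {z. line_shift n u e z \<in> E q}"
          using normal_ratio[where \<alpha>=\<alpha> and \<gamma>=\<gamma> and I="Q - {q}", OF \<sigma> K t Qq i0 _ large] by simp
        then show ?thesis using False m0 by (simp add: N.emeasure_eq_measure ennreal_mult'[symmetric] ennreal_leI)
      qed
    qed
    also have "\<dots> = ennreal (mills_factor K t) * (\<integral>\<^sup>+e. emeasure (normal \<sigma>) {z. line_shift n u e z \<in> E q} \<partial>gauss n \<sigma>) + emeasure (gauss n \<sigma>) F"
    proof -
      have [measurable]: "E q \<in> sets (Pi\<^sub>M {..<n} (\<lambda>_. borel))" using E[of q] by (simp add: sets_gauss)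
      have "(\<lambda>e. emeasure (normal \<sigma>) {z. line_shift n u e z \<in> E q}) \<in> borel_measurable (Pi\<^sub>M {..<n} (\<lambda>_. borel))"
        by (rule N.measurable_emeasure) measurable
      then have "(\<lambda>e. emeasure (normal \<sigma>) {z. line_shift n u e z \<in> E q}) \<in> borel_measurable (gauss n \<sigma>)"
        by (simp add: measurable_cong_sets[OF sets_gauss refl])
      then show ?thesis by (simp add: nn_integral_add nn_integral_cmult)
    qed
    also have "(\<integral>\<^sup>+e. emeasure (normal \<sigma>) {z. line_shift n u e z \<in> E q} \<partial>gauss n \<sigma>) = emeasure (gauss n \<sigma>) (E q)"
      by (rule gauss_fibre[OF \<sigma> u, symmetric]) (use E in \<open>simp add: sets_gauss\<close>)
    finally have "measure (gauss n \<sigma>) (B q) \<le> mills_factor K t * measure (gauss n \<sigma>) (E q) + measure (gauss n \<sigma>) F"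
      using m0 by (simp add: G.emeasure_eq_measure ennreal_mult'[symmetric] ennreal_plus[symmetric] ennreal_le_iff del: ennreal_plus)
    then show ?thesis using Fsmall by simp
  qed
  have "{e \<in> space (gauss n \<sigma>). \<exists>q\<in>Q. (\<forall>q'\<in>Q - {q}. g q' e < g q e) \<and>
      (\<forall>q'\<in>Q - {q}. 0 < snd q' * den q q' \<longrightarrow> t * \<sigma>\<^sup>2 < (c q)\<^sup>2 / R (fst q) (fst q) * (g q e * (g q e - h q q' e)))}
    = (\<Union>q\<in>Q. B q)" by (auto simp: B_def)
  also have "measure (gauss n \<sigma>) \<dots> \<le> (\<Sum>q\<in>Q. measure (gauss n \<sigma>) (B q))"
    using Q by (intro measure_UNION_le) auto
  also have "\<dots> \<le> (\<Sum>q\<in>Q. mills_factor K t * measure (gauss n \<sigma>) (E q) + 2 * \<theta> ^ D)"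
    by (intro sum_mono key)
  also have "\<dots> = mills_factor K t * (\<Sum>q\<in>Q. measure (gauss n \<sigma>) (E q)) + real (card Q) * (2 * \<theta> ^ D)"
    by (simp add: sum.distrib sum_distrib_left)
  also have "(\<Sum>q\<in>Q. measure (gauss n \<sigma>) (E q)) = measure (gauss n \<sigma>) (\<Union>q\<in>Q. E q)"
    using Q by (intro G.finite_measure_finite_Union[symmetric])
      (auto simp: disjoint_family_on_def E_def dest: less_asym)
  also have "mills_factor K t * measure (gauss n \<sigma>) (\<Union>q\<in>Q. E q) \<le> mills_factor K t * 1"
    by (intro mult_left_mono m0) simp
  \<comment> \<open>Two signs per variable; together with the factor 2 of \<open>Fsmall\<close> they
    give the constant 4.\<close>
  also have "card Q = 2 * card J" using J by (simp add: Q_def card_cartesian_product)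
  finally show ?thesis by (simp add: \<theta>_def)
qed

section \<open>Optimality conditions for the lasso\<close>

lemma dotf_diff: "dotf n u (\<lambda>k. v k - w k) = dotf n u v - dotf n u w"
  by (simp add: dotf_def right_diff_distrib sum_subtractf)

lemma dotf_add: "dotf n u (\<lambda>k. v k + w k) = dotf n u v + dotf n u w"
  by (simp add: dotf_def distrib_left sum.distrib)

lemma dotf_scale: "dotf n u (\<lambda>k. c * v k) = c * dotf n u v"
  by (simp add: dotf_def sum_distrib_left mult.left_commute)

lemma dotf_nonneg: "0 \<le> dotf n u u"
  by (simp add: dotf_def sum_nonneg)

lemma dotf_eq_0_iff: "dotf n u u = 0 \<longleftrightarrow> (\<forall>k<n. u k = 0)"
  by (auto simp: dotf_def sum_nonneg_eq_0_iff)

lemma dotf_cong: "(\<And>k. k < n \<Longrightarrow> u k = u' k) \<Longrightarrow> (\<And>k. k < n \<Longrightarrow> v k = v' k) \<Longrightarrow> dotf n u v = dotf n u' v'"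
  by (simp add: dotf_def)

text \<open>With the index set as a parameter, one theory covers the full lasso and the lasso
  restricted to an active set, without renumbering variables.\<close>

definition fitf :: "(nat \<Rightarrow> nat \<Rightarrow> real) \<Rightarrow> nat set \<Rightarrow> (nat \<Rightarrow> real) \<Rightarrow> nat \<Rightarrow> real" where
  "fitf x I b k = (\<Sum>i\<in>I. b i * x i k)"

lemma dotf_fitf: "dotf n u (fitf x I b) = (\<Sum>i\<in>I. b i * dotf n u (x i))"
  unfolding dotf_def fitf_def sum_distrib_left by (subst sum.swap) (simp add: mult.left_commute)

lemma fitf_diff: "fitf x I (\<lambda>i. b i - c i) k = fitf x I b k - fitf x I c k"
  by (simp add: fitf_def left_diff_distrib sum_subtractf)

lemma fitf_affine: "fitf x I (\<lambda>i. b i - l * c i) k = fitf x I b k - l * fitf x I c k"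
  by (simp add: fitf_def left_diff_distrib sum_subtractf sum_distrib_left mult.assoc)

lemma fitf_cong: "(\<And>i. i \<in> I \<Longrightarrow> b i = c i) \<Longrightarrow> fitf x I b = fitf x I c"
  by (simp add: fitf_def fun_eq_iff)

lemma fitf_mono_neutral:
  assumes "finite I" "A \<subseteq> I" "\<And>i. i \<in> I - A \<Longrightarrow> b i = 0" shows "fitf x I b = fitf x A b"
  unfolding fitf_def fun_eq_iff using assms by (auto intro: sum.mono_neutral_right)

definition objf :: "nat \<Rightarrow> (nat \<Rightarrow> nat \<Rightarrow> real) \<Rightarrow> nat set \<Rightarrow> (nat \<Rightarrow> real) \<Rightarrow> real \<Rightarrow> (nat \<Rightarrow> real) \<Rightarrow> real" where
  "objf n x I y l b = 1 / 2 * dotf n (\<lambda>k. y k - fitf x I b k) (\<lambda>k. y k - fitf x I b k) + l * (\<Sum>i\<in>I. \<bar>b i\<bar>)"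

text \<open>The subgradient conditions. For \<open>l = 0\<close> they are the normal equations; this
  case occurs when the sequence of knots has ended.\<close>

definition kktf :: "nat \<Rightarrow> (nat \<Rightarrow> nat \<Rightarrow> real) \<Rightarrow> nat set \<Rightarrow> (nat \<Rightarrow> real) \<Rightarrow> real \<Rightarrow> (nat \<Rightarrow> real) \<Rightarrow> bool" where
  "kktf n x I y l b \<longleftrightarrow> (\<forall>i\<in>I. \<bar>dotf n (x i) (\<lambda>k. y k - fitf x I b k)\<bar> \<le> l \<and>
     (b i \<noteq> 0 \<longrightarrow> dotf n (x i) (\<lambda>k. y k - fitf x I b k) = l * sgn (b i)))"

text \<open>Independence of an indexed family, so that equal columns count as dependent.\<close>

definition indepf :: "nat \<Rightarrow> (nat \<Rightarrow> nat \<Rightarrow> real) \<Rightarrow> nat set \<Rightarrow> bool" where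
  "indepf n x I \<longleftrightarrow> (\<forall>b. (\<forall>k<n. fitf x I b k = 0) \<longrightarrow> (\<forall>i\<in>I. b i = 0))"

text \<open>In the expansion of the square the cross term is dominated by the change of the penalty,
  coordinate by coordinate, by the subgradient inequality. The quadratic surplus is kept because it
  makes the fit unique.\<close>

lemma kktf_imp_le:
  assumes "finite I" "kktf n x I y l b"
  shows "objf n x I y l b + 1 / 2 * dotf n (\<lambda>k. fitf x I b' k - fitf x I b k) (\<lambda>k. fitf x I b' k - fitf x I b k)
    \<le> objf n x I y l b'"
proof -
  define res where "res = (\<lambda>k. y k - fitf x I b k)"
  define f where "f = (\<lambda>k. fitf x I b' k - fitf x I b k)"
  have "dotf n (\<lambda>k. y k - fitf x I b' k) (\<lambda>k. y k - fitf x I b' k) = dotf n res res - 2 * dotf n res f + dotf n f f"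
    unfolding dotf_def res_def f_def sum_distrib_left sum_subtractf[symmetric] sum.distrib[symmetric]
    by (intro sum.cong refl) (simp add: algebra_simps)
  moreover have "dotf n res f \<le> l * (\<Sum>i\<in>I. \<bar>b' i\<bar>) - l * (\<Sum>i\<in>I. \<bar>b i\<bar>)"
  proof -
    have "dotf n res f = (\<Sum>i\<in>I. (b' i - b i) * dotf n (x i) res)"
      unfolding f_def dotf_diff dotf_fitf sum_subtractf[symmetric] by (simp add: dotf_commute left_diff_distrib)
    also have "\<dots> \<le> (\<Sum>i\<in>I. l * \<bar>b' i\<bar> - l * \<bar>b i\<bar>)"
    proof (rule sum_mono)
      fix i assume "i \<in> I"
      then have 1: "\<bar>dotf n (x i) res\<bar> \<le> l" "b i \<noteq> 0 \<longrightarrow> dotf n (x i) res = l * sgn (b i)"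
        using assms(2) by (auto simp: kktf_def res_def)
      have "b' i * dotf n (x i) res \<le> \<bar>b' i\<bar> * \<bar>dotf n (x i) res\<bar>" by (metis abs_ge_self abs_mult)
      also have "\<dots> \<le> \<bar>b' i\<bar> * l" using 1 by (intro mult_left_mono) auto
      finally have "b' i * dotf n (x i) res \<le> l * \<bar>b' i\<bar>" by (simp add: mult.commute)
      moreover have "b i * dotf n (x i) res = l * \<bar>b i\<bar>"
        using 1 by (cases "b i = 0") (auto simp: abs_sgn mult_ac)
      ultimately show "(b' i - b i) * dotf n (x i) res \<le> l * \<bar>b' i\<bar> - l * \<bar>b i\<bar>" by (simp add: left_diff_distrib)
    qed
    finally show ?thesis by (simp add: sum_subtractf sum_distrib_left)
  qed
  ultimately show ?thesis unfolding objf_def f_def[symmetric] res_def[symmetric] by (simp add: algebra_simps)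
qed

text \<open>The optimality conditions in one coordinate, whose value is changed from b to b + t.
  \<open>up\<close> and \<open>dn\<close> divide by t from the two sides; t is taken so small that t
  q uses up at most half of the supposed violation.\<close>

lemma abs_perturb:
  fixes b l q r :: real
  assumes l: "0 \<le> l" and q: "0 \<le> q" and *: "\<And>t. 0 \<le> l * (\<bar>b + t\<bar> - \<bar>b\<bar>) - t * r + t\<^sup>2 * q"
  shows "\<bar>r\<bar> \<le> l \<and> (b \<noteq> 0 \<longrightarrow> r = l * sgn b)"
proof -
  have up: "r \<le> c" if "0 < e" "\<And>t. 0 < t \<Longrightarrow> t < e \<Longrightarrow> l * (\<bar>b + t\<bar> - \<bar>b\<bar>) \<le> t * c" for c e
  proof (rule ccontr)
    assume "\<not> r \<le> c"
    define w where "w = (r - c) / (q + 1)"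
    have w: "0 < w" "w * (q + 1) = r - c" using \<open>\<not> r \<le> c\<close> q by (auto simp: w_def)
    define t where "t = min (e / 2) (w / 2)"
    have t: "0 < t" "t < e" "t \<le> w / 2" using w \<open>0 < e\<close> by (auto simp: t_def)
    have "0 \<le> t * c - t * r + t\<^sup>2 * q" using *[of t] that(2)[of t] t by linarith
    then have "0 \<le> t * (c - r + t * q)" by (simp add: algebra_simps power2_eq_square)
    then have "r - c \<le> t * q" using t by (simp add: zero_le_mult_iff)
    also have "\<dots> \<le> t * (q + 1)" using t by simp
    also have "\<dots> \<le> w / 2 * (q + 1)" using t q by (intro mult_right_mono) auto
    also have "\<dots> = (r - c) / 2" using w(2) by simp
    finally show False using \<open>\<not> r \<le> c\<close> by simp
  qed
  have dn: "c \<le> r" if "0 < e" "\<And>t. 0 < t \<Longrightarrow> t < e \<Longrightarrow> l * (\<bar>b - t\<bar> - \<bar>b\<bar>) \<le> - t * c" for c e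
  proof (rule ccontr)
    assume "\<not> c \<le> r"
    define w where "w = (c - r) / (q + 1)"
    have w: "0 < w" "w * (q + 1) = c - r" using \<open>\<not> c \<le> r\<close> q by (auto simp: w_def)
    define t where "t = min (e / 2) (w / 2)"
    have t: "0 < t" "t < e" "t \<le> w / 2" using w \<open>0 < e\<close> by (auto simp: t_def)
    have "0 \<le> - t * c + t * r + t\<^sup>2 * q" using *[of "-t"] that(2)[of t] t by simp
    then have "0 \<le> t * (r - c + t * q)" by (simp add: algebra_simps power2_eq_square)
    then have "c - r \<le> t * q" using t by (simp add: zero_le_mult_iff)
    also have "\<dots> \<le> t * (q + 1)" using t by simp
    also have "\<dots> \<le> w / 2 * (q + 1)" using t q by (intro mult_right_mono) auto
    also have "\<dots> = (c - r) / 2" using w(2) by simp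
    finally show False using \<open>\<not> c \<le> r\<close> by simp
  qed
  have "r \<le> l"
  proof (rule up[of 1])
    fix t :: real assume "0 < t"
    then have "l * (\<bar>b + t\<bar> - \<bar>b\<bar>) \<le> l * t" using l by (intro mult_left_mono) auto
    then show "l * (\<bar>b + t\<bar> - \<bar>b\<bar>) \<le> t * l" by (simp add: mult.commute)
  qed simp
  moreover have "-l \<le> r"
  proof (rule dn[of 1])
    fix t :: real assume "0 < t"
    then have "l * (\<bar>b - t\<bar> - \<bar>b\<bar>) \<le> l * t" using l by (intro mult_left_mono) auto
    then show "l * (\<bar>b - t\<bar> - \<bar>b\<bar>) \<le> - t * - l" by (simp add: mult.commute)
  qed simp
  moreover have "r = l * sgn b" if "b \<noteq> 0"
  proof (rule antisym)
    show "r \<le> l * sgn b"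
      by (rule up[of "\<bar>b\<bar>"]) (use that in \<open>auto simp: sgn_if abs_if\<close>)
    show "l * sgn b \<le> r"
      by (rule dn[of "\<bar>b\<bar>"]) (use that in \<open>auto simp: sgn_if abs_if\<close>)
  qed
  ultimately show ?thesis by (auto simp: abs_le_iff)
qed

lemma min_imp_kktf:
  assumes I: "finite I" and l: "0 \<le> l" and min: "\<And>b'. objf n x I y l b \<le> objf n x I y l b'"
  shows "kktf n x I y l b"
  unfolding kktf_def
proof
  fix i assume i: "i \<in> I"
  define res where "res = (\<lambda>k. y k - fitf x I b k)"
  have "\<bar>dotf n (x i) res\<bar> \<le> l \<and> (b i \<noteq> 0 \<longrightarrow> dotf n (x i) res = l * sgn (b i))"
  proof (rule abs_perturb[OF l])
    show "0 \<le> 1 / 2 * dotf n (x i) (x i)" using dotf_nonneg by simp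
    fix t :: real
    let ?b = "b(i := b i + t)"
    have f: "fitf x I ?b k = fitf x I b k + t * x i k" for k
      unfolding fitf_def using I i by (simp add: sum.remove[of I i] algebra_simps)
    have "(\<Sum>m\<in>I. \<bar>?b m\<bar>) = (\<Sum>m\<in>I. \<bar>b m\<bar>) + (\<bar>b i + t\<bar> - \<bar>b i\<bar>)"
      using I i by (simp add: sum.remove[of I i])
    moreover have "dotf n (\<lambda>k. y k - fitf x I ?b k) (\<lambda>k. y k - fitf x I ?b k) = dotf n res res - 2 * t * dotf n (x i) res + t\<^sup>2 * dotf n (x i) (x i)"
      unfolding dotf_def res_def f sum_distrib_left sum_subtractf[symmetric] sum.distrib[symmetric]
      by (intro sum.cong refl) (simp add: algebra_simps power2_eq_square)
    ultimately have "objf n x I y l ?b - objf n x I y l b = 1 / 2 * (dotf n res res - 2 * t * dotf n (x i) res + t\<^sup>2 * dotf n (x i) (x i)) - 1 / 2 * dotf n res res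
        + l * ((\<Sum>m\<in>I. \<bar>b m\<bar>) + (\<bar>b i + t\<bar> - \<bar>b i\<bar>)) - l * (\<Sum>m\<in>I. \<bar>b m\<bar>)"
      unfolding objf_def res_def[symmetric] by (simp only:)
    then have "objf n x I y l ?b = objf n x I y l b + (l * (\<bar>b i + t\<bar> - \<bar>b i\<bar>) - t * dotf n (x i) res + t\<^sup>2 * (1 / 2 * dotf n (x i) (x i)))"
      by (simp add: algebra_simps)
    then show "0 \<le> l * (\<bar>b i + t\<bar> - \<bar>b i\<bar>) - t * dotf n (x i) res + t\<^sup>2 * (1 / 2 * dotf n (x i) (x i))"
      using min[of ?b] by simp
  qed
  then show "\<bar>dotf n (x i) (\<lambda>k. y k - fitf x I b k)\<bar> \<le> l \<and>
     (b i \<noteq> 0 \<longrightarrow> dotf n (x i) (\<lambda>k. y k - fitf x I b k) = l * sgn (b i))" by (simp add: res_def)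
qed

section \<open>Existence and uniqueness of the lasso solution\<close>

lemma objf_cong: "(\<And>i. i \<in> I \<Longrightarrow> b i = c i) \<Longrightarrow> objf n x I y l b = objf n x I y l c"
  using fitf_cong[of I b c x] by (simp add: objf_def)

text \<open>A continuous function attains its minimum on the compact box \<open>B\<close>. Outside
  the box the penalty alone exceeds the objective at 0, which is where \<open>M\<close> comes
  from.\<close>

lemma objf_min_exists:
  assumes I: "finite I" and l: "0 < l"
  shows "\<exists>b. \<forall>b'. objf n x I y l b \<le> objf n x I y l b'"
proof -
  define T where "T = product_topology (\<lambda>_::nat. euclideanreal) I"
  define M where "M = objf n x I y l (\<lambda>_. 0) / l"
  define B where "B = PiE I (\<lambda>_. {-M..M})"
  have M: "0 \<le> M" using l by (auto simp: M_def objf_def dotf_nonneg)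
  have pr: "continuous_map T euclideanreal (\<lambda>b. b i)" if "i \<in> I" for i
    unfolding T_def using that by (rule continuous_map_product_projection)
  have fc: "continuous_map T euclideanreal (\<lambda>b. fitf x I b k)" for k
    unfolding fitf_def using I by (intro continuous_map_sum continuous_map_real_mult pr continuous_map_canonical_const) auto
  have "continuous_map T euclideanreal (objf n x I y l)"
    unfolding objf_def dotf_def
    by (intro continuous_map_add continuous_map_real_mult continuous_map_sum continuous_map_diff continuous_map_real_abs pr fc continuous_map_canonical_const) (use I in auto)
  moreover have "compactin T B" unfolding T_def B_def compactin_PiE by (simp add: compact_Icc)
  ultimately have "compact (objf n x I y l ` B)" using image_compactin by fastforce
  moreover have z: "restrict (\<lambda>_. 0) I \<in> B" using M by (auto simp: B_def)
  ultimately obtain b where b: "b \<in> B" "\<And>b'. b' \<in> B \<Longrightarrow> objf n x I y l b \<le> objf n x I y l b'"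
    using compact_attains_inf[of "objf n x I y l ` B"] by blast
  have "objf n x I y l b \<le> objf n x I y l b'" for b'
  proof (cases "restrict b' I \<in> B")
    case True
    then show ?thesis using b(2)[OF True] objf_cong[of I "restrict b' I" b' n x y l] by simp
  next
    case False
    then obtain i where i: "i \<in> I" "M < \<bar>b' i\<bar>" unfolding B_def by (force simp: PiE_iff)
    have "objf n x I y l b \<le> objf n x I y l (\<lambda>_. 0)"
      using b(2)[OF z] objf_cong[of I "restrict (\<lambda>_. 0) I" "\<lambda>_. 0" n x y l] by simp
    also have "\<dots> = l * M" using l by (simp add: M_def)
    also have "\<dots> \<le> l * \<bar>b' i\<bar>" using i l by simp
    also have "\<dots> \<le> l * (\<Sum>i\<in>I. \<bar>b' i\<bar>)" using i I l by (intro mult_left_mono member_le_sum) auto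
    also have "\<dots> \<le> objf n x I y l b'" unfolding objf_def by (simp add: dotf_nonneg)
    finally show ?thesis .
  qed
  then show ?thesis by blast
qed

lemma kktf_fit_unique:
  assumes "finite I" "kktf n x I y l b" "kktf n x I y l b'" "k < n"
  shows "fitf x I b k = fitf x I b' k"
proof -
  have "dotf n (\<lambda>k. fitf x I b' k - fitf x I b k) (\<lambda>k. fitf x I b' k - fitf x I b k) \<le> 0"
    using kktf_imp_le[OF assms(1,2), of b'] kktf_imp_le[OF assms(1,3), of b]
      dotf_nonneg[of n "\<lambda>k. fitf x I b k - fitf x I b' k"] by linarith
  then have "dotf n (\<lambda>k. fitf x I b' k - fitf x I b k) (\<lambda>k. fitf x I b' k - fitf x I b k) = 0"
    using dotf_nonneg antisym by blast
  then show ?thesis unfolding dotf_eq_0_iff using assms(4) by simp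
qed

text \<open>\<open>gpf\<close> is the only consequence of general position that is used: up to signs, no column is an
  affine combination of linearly independent other ones.\<close>

definition gpf :: "nat \<Rightarrow> (nat \<Rightarrow> nat \<Rightarrow> real) \<Rightarrow> nat set \<Rightarrow> bool" where
  "gpf n x I \<longleftrightarrow> (\<forall>F i s a. F \<subseteq> I \<and> i \<in> I - F \<and> indepf n x F \<and> (\<forall>j\<in>insert i F. s j \<in> {-1, 1 :: real}) \<and> (\<Sum>j\<in>F. a j) = 1 \<longrightarrow>
     \<not> (\<forall>k<n. s i * x i k = (\<Sum>j\<in>F. a j * (s j * x j k))))"

text \<open>Suppose x_i is a combination of the others with coefficients c_j. The inner product with
  \<open>res\<close> gives s_i = sum of c_j s_j for the signs of the correlations. Hence s_i x_i is
  a combination of the s_j x_j whose coefficients s_i c_j s_j sum to 1, which general position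
  forbids.\<close>

lemma gpf_equicorrelation_indep:
  assumes gp: "gpf n x I" and I: "finite I" and l: "0 < l"
    and F: "F \<subseteq> I" "\<And>i. i \<in> F \<Longrightarrow> \<bar>dotf n (x i) res\<bar> = l"
  shows "indepf n x F"
proof -
  have "finite F" using F I finite_subset by auto
  then show ?thesis using F
  proof (induction F rule: finite_induct)
    case empty
    then show ?case by (simp add: indepf_def)
  next
    case (insert i F)
    have ind: "indepf n x F" using insert by auto
    define s where "s = (\<lambda>j. sgn (dotf n (x j) res))"
    have s: "s j \<in> {-1, 1}" "dotf n (x j) res = l * s j" "s j * s j = 1" if "j \<in> insert i F" for j
      using insert.prems(2)[OF that] l by (auto simp: s_def sgn_if abs_if split: if_splits)
    show ?case unfolding indepf_def
    proof (intro allI impI)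
      fix b assume b: "\<forall>k<n. fitf x (insert i F) b k = 0"
      then have b': "b i * x i k + fitf x F b k = 0" if "k < n" for k
        using that insert by (simp add: fitf_def)
      show "\<forall>j\<in>insert i F. b j = 0"
      proof (cases "b i = 0")
        case True
        then have "\<forall>k<n. fitf x F b k = 0" using b' by simp
        then show ?thesis using ind True by (auto simp: indepf_def)
      next
        case False
        define c where "c = (\<lambda>j. - (b j / b i))"
        have xi: "x i k = fitf x F c k" if "k < n" for k
          using b'[OF that] False by (simp add: fitf_def c_def sum_negf sum_divide_distrib[symmetric] field_simps)
        have "dotf n res (x i) = dotf n res (fitf x F c)" by (rule dotf_cong) (simp_all add: xi)
        then have "l * s i = (\<Sum>j\<in>F. c j * (l * s j))"
          using s by (simp add: dotf_fitf dotf_commute)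
        also have "\<dots> = l * (\<Sum>j\<in>F. c j * s j)" by (simp add: sum_distrib_left mult.left_commute)
        finally have si: "s i = (\<Sum>j\<in>F. c j * s j)" using l by simp
        define a where "a = (\<lambda>j. s i * (c j * s j))"
        have "(\<Sum>j\<in>F. a j) = 1" using s(3)[of i] by (simp add: a_def flip: sum_distrib_left si)
        moreover have "\<forall>k<n. s i * x i k = (\<Sum>j\<in>F. a j * (s j * x j k))"
        proof (intro allI impI)
          fix k assume "k < n"
          have "(\<Sum>j\<in>F. a j * (s j * x j k)) = (\<Sum>j\<in>F. s i * (c j * x j k))"
          proof (rule sum.cong[OF refl])
            fix j assume "j \<in> F"
            have "a j * (s j * x j k) = s i * (c j * x j k) * (s j * s j)" by (simp add: a_def)
            then show "a j * (s j * x j k) = s i * (c j * x j k)" using s(3)[of j] \<open>j \<in> F\<close> by simp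
          qed
          also have "\<dots> = s i * fitf x F c k" by (simp add: fitf_def sum_distrib_left)
          finally show "s i * x i k = (\<Sum>j\<in>F. a j * (s j * x j k))" using xi[OF \<open>k < n\<close>] by simp
        qed
        moreover have "F \<subseteq> I \<and> i \<in> I - F \<and> indepf n x F \<and> (\<forall>j\<in>insert i F. s j \<in> {-1, 1})"
          using insert ind s by auto
        ultimately show ?thesis using gp unfolding gpf_def by meson
      qed
    qed
  qed
qed

text \<open>Both solutions have the same fit, hence the same residual, hence vanish off the same
  equicorrelation set; there the columns are independent.\<close>

lemma kktf_unique:
  assumes I: "finite I" and l: "0 < l" and gp: "gpf n x I"
    and b: "kktf n x I y l b" and b': "kktf n x I y l b'" and i: "i \<in> I"
  shows "b i = b' i"
proof -
  have fit: "fitf x I b k = fitf x I b' k" if "k < n" for k by (rule kktf_fit_unique[OF I b b' that])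
  define res where "res = (\<lambda>k. y k - fitf x I b k)"
  define E where "E = {i \<in> I. \<bar>dotf n (x i) res\<bar> = l}"
  have res': "dotf n u (\<lambda>k. y k - fitf x I b' k) = dotf n u res" for u
    by (rule dotf_cong) (simp_all add: res_def fit)
  have out: "b j = 0" "b' j = 0" if "j \<in> I - E" for j
  proof -
    have "b j \<noteq> 0 \<Longrightarrow> dotf n (x j) res = l * sgn (b j)" "b' j \<noteq> 0 \<Longrightarrow> dotf n (x j) res = l * sgn (b' j)"
      using b b' that by (auto simp: kktf_def res' res_def[symmetric])
    moreover have "\<bar>l * sgn a\<bar> = l" if "a \<noteq> 0" for a :: real using that l by (simp add: abs_mult abs_sgn_eq)
    moreover have "\<bar>dotf n (x j) res\<bar> \<noteq> l" using that by (auto simp: E_def)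
    ultimately show "b j = 0" "b' j = 0" by metis+
  qed
  have ind: "indepf n x E"
    by (rule gpf_equicorrelation_indep[OF gp I l]) (auto simp: E_def)
  have E: "finite I" "E \<subseteq> I" using I by (auto simp: E_def)
  have "\<forall>k<n. fitf x E (\<lambda>j. b j - b' j) k = 0"
    using fit fitf_mono_neutral[OF E, of b x] fitf_mono_neutral[OF E, of b' x] out by (simp add: fitf_diff)
  then have "\<forall>j\<in>E. b j - b' j = 0" using ind[unfolded indepf_def, rule_format, of "\<lambda>j. b j - b' j"] by blast
  then show ?thesis using out[of i] i by (cases "i \<in> E") auto
qed

section \<open>General position and pseudoinverses of matrices\<close>

context vec_space begin

text \<open>Passage from indexed families to sets of vectors. Injectivity is part of independence of
  a family (coefficients 1 and -1 on two equal members) and lets cardinalities of index sets be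
  used.\<close>

lemma lin_indpt_image:
  assumes A: "finite A" and f: "\<And>j. j \<in> A \<Longrightarrow> f j \<in> carrier_vec n"
    and ind: "\<And>b. (\<And>k. k < n \<Longrightarrow> (\<Sum>j\<in>A. b j * f j $ k) = 0) \<Longrightarrow> \<forall>j\<in>A. b j = 0"
  shows "inj_on f A" "lin_indpt (f ` A)"
proof -
  show inj: "inj_on f A"
  proof (rule inj_onI, rule ccontr)
    fix i j assume ij: "i \<in> A" "j \<in> A" "f i = f j" "i \<noteq> j"
    have "\<forall>l\<in>A. (if l = i then 1 else if l = j then - 1 else 0) = (0 :: 'a)"
    proof (rule ind)
      fix k assume "k < n"
      have "(\<Sum>l\<in>A. (if l = i then 1 else if l = j then - 1 else 0) * f l $ k)
        = (\<Sum>l\<in>A. (if l = i then f i $ k else 0) + (if l = j then - f j $ k else 0))"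
        using ij by (intro sum.cong) auto
      also have "\<dots> = 0" using A ij by (simp add: sum.distrib)
      finally show "(\<Sum>l\<in>A. (if l = i then 1 else if l = j then - 1 else 0) * f l $ k) = 0" .
    qed
    then show False using ij by auto
  qed
  show "lin_indpt (f ` A)"
  proof (rule finite_lin_indpt2)
    show "finite (f ` A)" using A by simp
    show "f ` A \<subseteq> carrier_vec n" using f by auto
    fix a assume "lincomb a (f ` A) = 0\<^sub>v n"
    then have "\<forall>j\<in>A. a (f j) = 0"
    proof (intro ind)
      fix k assume k: "k < n" and l: "lincomb a (f ` A) = 0\<^sub>v n"
      have "(\<Sum>v\<in>f ` A. a v * v $ k) = 0"
        using lincomb_index[OF k, of "f ` A" a] l k f by auto
      then show "(\<Sum>j\<in>A. a (f j) * f j $ k) = 0"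
        by (simp add: sum.reindex[OF inj])
    qed
    then show "\<forall>v\<in>f ` A. a v = 0" by simp
  qed
qed

lemma dim_span_lin_indpt:
  assumes "finite B" "B \<subseteq> carrier_vec n" "lin_indpt B"
  shows "vectorspace.dim class_ring (vs (span B)) = card B"
proof -
  have sub: "submodule class_ring (span B) V" using assms by (intro span_is_submodule) auto
  interpret W: vectorspace class_ring "vs (span B)"
    using assms span_is_subspace subspace_def subspace_is_vs by simp
  have BW: "B \<subseteq> span B" using assms in_own_span by simp
  have "W.basis B"
    unfolding W.basis_def using span_li_not_depend[OF BW sub] assms BW by auto
  then show ?thesis using W.dim_basis assms by simp
qed

end

lemma fitf_image_indep:
  assumes "indepf n x F" "\<And>k. k < n \<Longrightarrow> (\<Sum>j\<in>F. b j * x j k) = 0"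
  shows "\<forall>j\<in>F. b j = 0"
proof -
  have "\<forall>k<n. fitf x F b k = 0" using assms(2) by (simp add: fitf_def)
  then show ?thesis using assms(1) unfolding indepf_def by blast
qed

text \<open>The signed columns in \<open>F\<close> span an affine subspace of dimension
  \<open>card F - 1\<close>, which may contain at most \<open>card F\<close> of the signed columns.
  An affine combination would put the column \<open>i\<close> into it as well.\<close>

lemma general_position_imp_gpf:
  assumes X: "X \<in> carrier_mat n p" and gp: "general_position X"
  shows "gpf n (\<lambda>i k. X $$ (k, i)) {..<p}"
  unfolding gpf_def
proof (intro allI impI notI, elim conjE)
  fix F i and s a :: "nat \<Rightarrow> real"
  assume F: "F \<subseteq> {..<p}" and i: "i \<in> {..<p} - F" and ind: "indepf n (\<lambda>i k. X $$ (k, i)) F"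
    and s: "\<forall>j\<in>insert i F. s j \<in> {-1, 1}" and a: "sum a F = 1"
    and eq: "\<forall>k<n. s i * X $$ (k, i) = (\<Sum>j\<in>F. a j * (s j * X $$ (k, j)))"
  interpret vec_space "TYPE(real)" n .
  have finF: "finite F" using F finite_subset by auto
  obtain j0 where j0: "j0 \<in> F" using a by fastforce
  define v where "v = (\<lambda>j. s j \<cdot>\<^sub>v col X j)"
  have v: "v j \<in> carrier_vec n" for j using X by (simp add: v_def col_def)
  have vk: "v j $ k = s j * X $$ (k, j)" if "k < n" "j < p" for j k using X that by (simp add: v_def)
  define w where "w = (\<lambda>j. v j - v j0)"
  have w: "w j \<in> carrier_vec n" for j using v by (simp add: w_def)
  have wk: "w j $ k = s j * X $$ (k, j) - s j0 * X $$ (k, j0)" if "k < n" "j \<in> F" for j k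
    using that F j0 v[of j] v[of j0] by (auto simp: w_def vk index_minus_vec(1) subset_iff carrier_vecD)
  define F' where "F' = F - {j0}"
  have F': "finite F'" "F' \<subseteq> F" using finF by (auto simp: F'_def)
  have wind: "\<forall>j\<in>F'. b j = 0" if b: "\<And>k. k < n \<Longrightarrow> (\<Sum>j\<in>F'. b j * w j $ k) = 0" for b
  proof -
    \<comment> \<open>A relation among the differences v_j - v_j0, rewritten as a relation among the
      columns.\<close>
    define c where "c = (\<lambda>j. if j = j0 then - (\<Sum>j\<in>F'. b j) * s j0 else b j * s j)"
    have "\<forall>j\<in>F. c j = 0"
    proof (rule fitf_image_indep[OF ind])
      fix k assume k: "k < n"
      have "(\<Sum>j\<in>F. c j * X $$ (k, j)) = c j0 * X $$ (k, j0) + (\<Sum>j\<in>F'. c j * X $$ (k, j))"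
        using finF j0 by (simp add: F'_def sum.remove)
      also have "(\<Sum>j\<in>F'. c j * X $$ (k, j)) = (\<Sum>j\<in>F'. b j * (s j * X $$ (k, j)))"
        by (intro sum.cong) (auto simp: c_def F'_def)
      also have "c j0 * X $$ (k, j0) = - (\<Sum>j\<in>F'. b j * (s j0 * X $$ (k, j0)))"
        by (simp add: c_def sum_distrib_right mult.assoc)
      also have "\<dots> + (\<Sum>j\<in>F'. b j * (s j * X $$ (k, j))) = (\<Sum>j\<in>F'. b j * w j $ k)"
        using F' k by (simp add: sum_negf[symmetric] sum.distrib[symmetric] wk subset_iff right_diff_distrib)
      also have "\<dots> = 0" using b k by simp
      finally show "(\<Sum>j\<in>F. c j * X $$ (k, j)) = 0" .
    qed
    then have "\<forall>j\<in>F'. b j * s j = 0" by (auto simp: F'_def c_def split: if_splits)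
    moreover have "s j \<noteq> 0" if "j \<in> F'" for j using s F' that by force
    ultimately show ?thesis by simp
  qed
  define B where "B = w ` F'"
  have inj: "inj_on w F'" and indB: "lin_indpt B"
    unfolding B_def by (rule lin_indpt_image[OF F'(1) w wind]; assumption)+
  have B: "finite B" "B \<subseteq> carrier_vec n" "card B = card F - 1"
    using F' w finF j0 card_image[OF inj] by (auto simp: B_def F'_def)
  define W where "W = span B"
  have subW: "VectorSpace.subspace class_ring W V" unfolding W_def using B by (intro span_is_subspace) auto
  have aff: "affine_subspace n (card F - 1) ((\<lambda>w. v j0 + w) ` W)"
    unfolding affine_subspace_def
  proof (rule bexI[of _ "v j0"], rule exI[of _ W], intro conjI)
    show "VectorSpace.subspace class_ring W V" by (rule subW)
    show "vectorspace.dim class_ring (vs W) = card F - 1"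
      unfolding W_def B(3)[symmetric] by (rule dim_span_lin_indpt[OF B(1,2) indB])
  qed (use v in auto)
  \<comment> \<open>General position speaks of dimensions below min n p only.\<close>
  have "card F \<le> n"
  proof -
    have cX: "col X j \<in> carrier_vec n" for j using X by (simp add: col_def)
    have cind: "\<forall>j\<in>F. b j = 0" if "\<And>k. k < n \<Longrightarrow> (\<Sum>j\<in>F. b j * col X j $ k) = 0" for b
    proof (rule fitf_image_indep[OF ind])
      fix k assume "k < n"
      have "(\<Sum>j\<in>F. b j * X $$ (k, j)) = (\<Sum>j\<in>F. b j * col X j $ k)"
        using X F \<open>k < n\<close> by (intro sum.cong) auto
      then show "(\<Sum>j\<in>F. b j * X $$ (k, j)) = 0" using that \<open>k < n\<close> by simp
    qed
    have "inj_on (col X) F" "lin_indpt (col X ` F)"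
      by (rule lin_indpt_image[OF finF cX cind]; assumption)+
    moreover have "col X ` F \<subseteq> carrier_vec n" using cX by auto
    ultimately show ?thesis
      using li_le_dim(2)[OF fin_dim, of "col X ` F"] by (simp add: dim_is_n card_image)
  qed
  moreover have "0 < card F" using j0 finF card_gt_0_iff by blast
  moreover have "card F \<le> p" using card_mono[OF _ F] by simp
  ultimately have k: "card F - 1 < min n p" by auto
  have mem: "v j \<in> (\<lambda>w. v j0 + w) ` W" if j: "j \<in> insert i F" for j
  proof -
    have "\<exists>c. \<forall>k<n. v j $ k = v j0 $ k + (\<Sum>l\<in>F'. c l * w l $ k)"
    proof (cases "j = i")
      case True
      have "v j $ k = v j0 $ k + (\<Sum>l\<in>F'. a l * w l $ k)" if k: "k < n" for k
      proof -
        have "(\<Sum>l\<in>F'. a l * w l $ k) = (\<Sum>l\<in>F. a l * (s l * X $$ (k, l) - s j0 * X $$ (k, j0)))"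
          using finF j0 F' k by (simp add: F'_def sum.remove wk)
        also have "\<dots> = (\<Sum>l\<in>F. a l * (s l * X $$ (k, l))) - s j0 * X $$ (k, j0)"
          using a by (simp add: right_diff_distrib sum_subtractf flip: sum_distrib_right)
        finally show ?thesis using eq k i j0 F True by (auto simp: vk subset_iff)
      qed
      then show ?thesis by (intro exI[of _ a]) simp
    next
      case False
      then have jF: "j \<in> F" using j by simp
      have "v j $ k = v j0 $ k + (\<Sum>l\<in>F'. (if l = j then 1 else 0) * w l $ k)" if k: "k < n" for k
      proof (cases "j = j0")
        case True
        then have "(\<Sum>l\<in>F'. (if l = j then 1 else 0) * w l $ k) = 0" by (intro sum.neutral) (auto simp: F'_def)
        then show ?thesis using True by simp
      next
        case False
        have "(\<Sum>l\<in>F'. (if l = j then 1 else 0) * w l $ k) = (\<Sum>l\<in>F'. (if l = j then w l $ k else 0))"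
          by (intro sum.cong) auto
        also have "\<dots> = w j $ k" using False jF F' by (simp add: F'_def)
        finally show ?thesis using wk[OF k jF] vk[OF k] jF j0 F by (auto simp: subset_iff)
      qed
      then show ?thesis by (intro exI[of _ "\<lambda>l. if l = j then 1 else 0"]) simp
    qed
    then obtain c where c: "\<And>k. k < n \<Longrightarrow> v j $ k = v j0 $ k + (\<Sum>l\<in>F'. c l * w l $ k)" by blast
    \<comment> \<open>\<open>lincomb\<close> takes coefficients indexed by vectors, so those indexed
      by \<open>F'\<close> are carried over along the injection \<open>w\<close>.\<close>
    define q where "q = lincomb (\<lambda>u. c (inv_into F' w u)) B"
    have q: "q \<in> carrier_vec n" unfolding q_def using B by (intro lincomb_closed) auto
    have "q \<in> W" unfolding W_def q_def using B(1,2) by (auto simp: span_def)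
    moreover have "v j = v j0 + q"
    proof (rule eq_vecI)
      show "dim_vec (v j) = dim_vec (v j0 + q)" using v q carrier_vecD by (metis index_add_vec(2))
      fix k assume "k < dim_vec (v j0 + q)"
      then have k: "k < n" using q by auto
      have "q $ k = (\<Sum>l\<in>F'. c l * w l $ k)"
        unfolding q_def lincomb_index[OF k B(2)] unfolding B_def sum.reindex[OF inj]
        by (intro sum.cong) (auto simp: inj)
      then show "v j $ k = (v j0 + q) $ k" using c[OF k] k q by (simp add: carrier_vecD)
    qed
    ultimately show ?thesis by blast
  qed
  have "card (insert i F) \<le> (card F - 1) + 1"
  proof -
    have "\<forall>k L J s. k < min (dim_row X) (dim_col X) \<and> affine_subspace (dim_row X) k L \<and>
        J \<subseteq> {..<dim_col X} \<and> (\<forall>j\<in>J. s j \<in> {-1, 1 :: real} \<and> s j \<cdot>\<^sub>v col X j \<in> L)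
        \<longrightarrow> card J \<le> k + 1" using gp unfolding general_position_def .
    from this[rule_format, of "card F - 1" "(\<lambda>w. v j0 + w) ` W" "insert i F" s]
    show ?thesis using k aff F i s mem X by (auto simp: v_def)
  qed
  then show False using i finF \<open>0 < card F\<close> by simp
qed

section \<open>The Moore-Penrose pseudoinverse\<close>

lemma moore_penrose_unique:
  fixes B :: "real mat"
  assumes B: "B \<in> carrier_mat n m" and G: "G \<in> carrier_mat m n" and H: "H \<in> carrier_mat m n"
    and g: "B * G * B = B" "G * B * G = G" "transpose_mat (B * G) = B * G" "transpose_mat (G * B) = G * B"
    and h: "B * H * B = B" "H * B * H = H" "transpose_mat (B * H) = B * H" "transpose_mat (H * B) = H * B"
  shows "G = H"
proof -
  have BG: "B * G \<in> carrier_mat n n" "B * H \<in> carrier_mat n n" "G * B \<in> carrier_mat m m" "H * B \<in> carrier_mat m m"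
    using B G H by auto
  \<comment> \<open>B G and B H are both the orthogonal projection onto the column space of B, hence
    equal; dually for G B and H B. Then G = G B G = H B G = H B H = H.\<close>
  have "(B * H) * (B * G) = B * G"
    using assoc_mult_mat[OF BG(2) B G] h(1) by simp
  then have "B * G = transpose_mat ((B * H) * (B * G))" using g(3) by simp
  also have "\<dots> = (B * G) * (B * H)" unfolding transpose_mult[OF BG(2,1)] g(3) h(3) ..
  also have "\<dots> = B * H" using assoc_mult_mat[OF BG(1) B H] g(1) by simp
  finally have 1: "B * G = B * H" .
  have "(G * B) * (H * B) = G * B"
    using assoc_mult_mat[OF G B BG(4)] assoc_mult_mat[OF B H B] h(1) by simp
  then have "G * B = transpose_mat ((G * B) * (H * B))" using g(4) by simp
  also have "\<dots> = (H * B) * (G * B)" unfolding transpose_mult[OF BG(3,4)] g(4) h(4) ..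
  also have "\<dots> = H * B" using assoc_mult_mat[OF H B BG(3)] assoc_mult_mat[OF B G B] g(1) by simp
  finally have 2: "G * B = H * B" .
  have "G = H * B * G" using g(2) 2 by simp
  also have "\<dots> = H * (B * H)" using assoc_mult_mat[OF H B G] 1 by simp
  also have "\<dots> = H" using assoc_mult_mat[OF H B H] h(2) by simp
  finally show ?thesis .
qed

lemma pinv_eqI:
  assumes B: "B \<in> carrier_mat n m" and G: "G \<in> carrier_mat m n"
    and g: "B * G * B = B" "G * B * G = G" "transpose_mat (B * G) = B * G" "transpose_mat (G * B) = G * B"
  shows "pinv B = G"
  unfolding pinv_def
proof (rule the_equality)
  show "G \<in> carrier_mat (dim_col B) (dim_row B) \<and> B * G * B = B \<and> G * B * G = G \<and> transpose_mat (B * G) = B * G \<and> transpose_mat (G * B) = G * B"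
    using assms by auto
  fix H assume "H \<in> carrier_mat (dim_col B) (dim_row B) \<and> B * H * B = B \<and> H * B * H = H \<and> transpose_mat (B * H) = B * H \<and> transpose_mat (H * B) = H * B"
  then show "H = G" using B moore_penrose_unique[OF B _ G _ _ _ _ g, of H] by auto
qed

text \<open>The Gram matrix is nonsingular because v^T B^T B v is the squared length of B v. With
  its inverse \<open>Q\<close>, both candidates satisfy the Penrose conditions, and uniqueness
  identifies the definite description.\<close>

lemma pinv_full_column_rank:
  fixes B :: "real mat"
  assumes B: "B \<in> carrier_mat n m"
    and inj: "\<And>v. v \<in> carrier_vec m \<Longrightarrow> B *\<^sub>v v = 0\<^sub>v n \<Longrightarrow> v = 0\<^sub>v m"
  obtains Q where "Q \<in> carrier_mat m m" "Q * (transpose_mat B * B) = 1\<^sub>m m" "(transpose_mat B * B) * Q = 1\<^sub>m m"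
    "pinv B = Q * transpose_mat B" "pinv (transpose_mat B) = B * Q"
proof -
  define M where "M = transpose_mat B * B"
  have M: "M \<in> carrier_mat m m" using B by (simp add: M_def)
  have BT: "transpose_mat B \<in> carrier_mat m n" using B by simp
  have "det M \<noteq> 0"
  proof
    assume "det M = 0"
    then obtain v where v: "v \<in> carrier_vec m" "v \<noteq> 0\<^sub>v m" "M *\<^sub>v v = 0\<^sub>v m"
      using det_0_iff_vec_prod_zero_field[OF M] by auto
    have Bv: "B *\<^sub>v v \<in> carrier_vec n" using B v by simp
    have "(B *\<^sub>v v) \<bullet> (B *\<^sub>v v) = v \<bullet> (transpose_mat B *\<^sub>v (B *\<^sub>v v))"
      using B v Bv transpose_vec_mult_scalar[of B n m v "B *\<^sub>v v"]
      by (metis BT comm_scalar_prod mult_mat_vec_carrier)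
    also have "transpose_mat B *\<^sub>v (B *\<^sub>v v) = M *\<^sub>v v"
      unfolding M_def by (rule assoc_mult_mat_vec[OF BT B v(1), symmetric])
    finally have 0: "(B *\<^sub>v v) \<bullet> (B *\<^sub>v v) = 0" unfolding v(3) by (simp only: scalar_prod_right_zero[OF v(1)])
    define w where "w = B *\<^sub>v v"
    have w: "w \<in> carrier_vec n" "w \<bullet> w = 0" using Bv 0 by (simp_all only: w_def)
    then have "(\<Sum>i\<in>{0..<n}. w $ i * w $ i) = 0" by (simp add: scalar_prod_def)
    then have "\<forall>i\<in>{0..<n}. w $ i * w $ i = 0"
      by (subst (asm) sum_nonneg_eq_0_iff) auto
    then have "w = 0\<^sub>v n" using w(1) by (intro eq_vecI) auto
    then have "B *\<^sub>v v = 0\<^sub>v n" by (simp only: w_def)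
    then show False using inj v by blast
  qed
  then obtain Q where Q: "Q \<in> carrier_mat m m" "Q * M = 1\<^sub>m m" "M * Q = 1\<^sub>m m"
    using det_non_zero_imp_unit[OF M, of "()"] unfolding Units_def ring_mat_def by auto
  have MT: "transpose_mat M = M" unfolding M_def using B by (simp add: transpose_mult[of _ m n _ m])
  have QT: "transpose_mat Q = Q"
  proof -
    have QT: "transpose_mat Q \<in> carrier_mat m m" using Q by simp
    have "transpose_mat Q * M = 1\<^sub>m m" using Q(3) MT transpose_mult[OF M Q(1)] by simp
    then have "transpose_mat Q * M * Q = Q" using Q by simp
    then show ?thesis using Q QT M by (simp add: assoc_mult_mat[of _ m m M m Q m])
  qed
  have "pinv B = Q * transpose_mat B"
  proof (rule pinv_eqI[OF B])
    show QB: "Q * transpose_mat B \<in> carrier_mat m n" using Q BT by simp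
    have 1: "Q * transpose_mat B * B = 1\<^sub>m m" unfolding assoc_mult_mat[OF Q(1) BT B] M_def[symmetric] by (rule Q(2))
    show "B * (Q * transpose_mat B) * B = B"
      unfolding assoc_mult_mat[OF B QB B] 1 by (rule right_mult_one_mat[OF B])
    show "Q * transpose_mat B * B * (Q * transpose_mat B) = Q * transpose_mat B"
      unfolding 1 by (rule left_mult_one_mat[OF QB])
    show "transpose_mat (B * (Q * transpose_mat B)) = B * (Q * transpose_mat B)"
      unfolding transpose_mult[OF B QB] transpose_mult[OF Q(1) BT] QT transpose_transpose
      by (rule assoc_mult_mat[OF B Q(1) BT])
    show "transpose_mat (Q * transpose_mat B * B) = Q * transpose_mat B * B" unfolding 1 by simp
  qed
  moreover have "pinv (transpose_mat B) = B * Q"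
  proof (rule pinv_eqI[OF BT])
    show BQ: "B * Q \<in> carrier_mat n m" using Q B by simp
    have 1: "transpose_mat B * (B * Q) = 1\<^sub>m m" unfolding assoc_mult_mat[OF BT B Q(1), symmetric] M_def[symmetric] by (rule Q(3))
    show "transpose_mat B * (B * Q) * transpose_mat B = transpose_mat B"
      unfolding 1 by (rule left_mult_one_mat[OF BT])
    show "B * Q * transpose_mat B * (B * Q) = B * Q"
      unfolding assoc_mult_mat[OF BQ BT BQ] 1 by (rule right_mult_one_mat[OF BQ])
    show "transpose_mat (transpose_mat B * (B * Q)) = transpose_mat B * (B * Q)" unfolding 1 by simp
    show "transpose_mat (B * Q * transpose_mat B) = B * Q * transpose_mat B"
      unfolding transpose_mult[OF BQ BT] transpose_mult[OF B Q(1)] QT transpose_transpose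
      by (rule assoc_mult_mat[OF B Q(1) BT, symmetric])
  qed
  ultimately show thesis using that Q by (simp add: M_def)
qed

section \<open>Columns selected by an index set\<close>

definition colf :: "real mat \<Rightarrow> nat \<Rightarrow> nat \<Rightarrow> real" where
  "colf X i k = X $$ (k, i)"

text \<open>The inverse of the increasing enumeration is the rank in \<open>A\<close>. This
  bijection turns vectors of dimension \<open>card A\<close> into functions on
  \<open>A\<close>.\<close>

lemma bij_betw_pick: "finite A \<Longrightarrow> bij_betw (pick A) {..<card A} A"
proof (rule bij_betwI[where g="\<lambda>i. card {a \<in> A. a < i}"])
  assume A: "finite A"
  show "pick A \<in> {..<card A} \<rightarrow> A" using pick_in_set_le by auto
  show "(\<lambda>i. card {a \<in> A. a < i}) \<in> A \<rightarrow> {..<card A}"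
    using A by (auto intro!: psubset_card_mono)
  show "card {a \<in> A. a < pick A i} = i" if "i \<in> {..<card A}" for i
    using card_pick_le that by auto
  show "pick A (card {a \<in> A. a < i}) = i" if "i \<in> A" for i
    by (rule pick_card_in_set[OF that])
qed

lemma pick_surj: "finite A \<Longrightarrow> i \<in> A \<Longrightarrow> \<exists>a<card A. i = pick A a"
  using bij_betw_imp_surj_on[OF bij_betw_pick[of A]] by (metis imageE lessThan_iff)

lemma sum_pick: "finite A \<Longrightarrow> (\<Sum>a<card A. f (pick A a)) = (\<Sum>i\<in>A. f i)"
  by (rule sum.reindex_bij_betw[OF bij_betw_pick])

lemma sub_cols_carrier:
  assumes "X \<in> carrier_mat n p" "A \<subseteq> {..<p}"
  shows "sub_cols X A \<in> carrier_mat n (card A)"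
proof -
  have "{j. j < dim_col X \<and> j \<in> A} = A" using assms by auto
  then show ?thesis using assms by (auto simp: sub_cols_def dim_submatrix intro!: carrier_matI)
qed

lemma sub_cols_index:
  assumes "X \<in> carrier_mat n p" "A \<subseteq> {..<p}" "k < n" "a < card A"
  shows "sub_cols X A $$ (k, a) = X $$ (k, pick A a)"
proof -
  have "{j. j < dim_col X \<and> j \<in> A} = A" using assms by auto
  then show ?thesis unfolding sub_cols_def using assms
    by (subst submatrix_index) (auto simp: pick_UNIV)
qed

lemma colf_sub_cols:
  assumes "X \<in> carrier_mat n p" "A \<subseteq> {..<p}" "k < n" "a < card A"
  shows "colf (sub_cols X A) a k = colf X (pick A a) k"
  using sub_cols_index[OF assms] by (simp add: colf_def)

lemma mult_mat_vec_fitf: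
  assumes "X \<in> carrier_mat n p" "b \<in> carrier_vec p"
  shows "X *\<^sub>v b = vec n (fitf (colf X) {..<p} (($) b))"
  using assms by (intro eq_vecI) (auto simp: scalar_prod_def fitf_def colf_def mult.commute atLeast0LessThan intro!: sum.cong)

lemma sub_cols_mult:
  assumes X: "X \<in> carrier_mat n p" and A: "A \<subseteq> {..<p}"
  shows "sub_cols X A *\<^sub>v vec (card A) (\<lambda>a. u (pick A a)) = vec n (fitf (colf X) A u)"
proof (rule eq_vecI)
  have fin: "finite A" using A finite_subset by auto
  note c = sub_cols_carrier[OF X A]
  show "dim_vec (sub_cols X A *\<^sub>v vec (card A) (\<lambda>a. u (pick A a))) = dim_vec (vec n (fitf (colf X) A u))"
    using c by simp
  fix k assume "k < dim_vec (vec n (fitf (colf X) A u))"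
  then have k: "k < n" by simp
  have "(sub_cols X A *\<^sub>v vec (card A) (\<lambda>a. u (pick A a))) $ k = (\<Sum>a<card A. u (pick A a) * colf X (pick A a) k)"
    using c k by (auto simp: scalar_prod_def sub_cols_index[OF X A k] colf_def atLeast0LessThan intro!: sum.cong)
  also have "\<dots> = fitf (colf X) A u k" using sum_pick[OF fin, of "\<lambda>i. u i * colf X i k"] by (simp add: fitf_def)
  finally show "(sub_cols X A *\<^sub>v vec (card A) (\<lambda>a. u (pick A a))) $ k = vec n (fitf (colf X) A u) $ k" using k by simp
qed

lemma vec_pick_repr:
  assumes "finite A" "v \<in> carrier_vec (card A)"
  shows "v = vec (card A) (\<lambda>a. (\<lambda>i. v $ card {b \<in> A. b < i}) (pick A a))"
  using assms by (intro eq_vecI) (auto simp: card_pick_le)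

lemma sub_cols_transpose_mult:
  assumes X: "X \<in> carrier_mat n p" and A: "A \<subseteq> {..<p}" and w: "w \<in> carrier_vec n"
  shows "transpose_mat (sub_cols X A) *\<^sub>v w = vec (card A) (\<lambda>a. dotf n (colf X (pick A a)) (($) w))"
  using sub_cols_carrier[OF X A] w
  by (intro eq_vecI) (auto simp: scalar_prod_def dotf_def colf_def atLeast0LessThan sub_cols_index[OF X A] intro!: sum.cong)

lemma dotf_vec: "dotf n u (($) (vec n f)) = dotf n u f"
  by (simp add: dotf_def)

lemma col_scalar_prod:
  assumes "X \<in> carrier_mat n p" "i < p" "w \<in> carrier_vec n"
  shows "col X i \<bullet> w = dotf n (colf X i) (($) w)"
  using assms by (auto simp: scalar_prod_def dotf_def colf_def atLeast0LessThan intro!: sum.cong)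

section \<open>Pseudoinverse, projection and joining values through the normal equations\<close>

context
  fixes X :: "real mat" and n p :: nat and A :: "nat set"
  assumes X: "X \<in> carrier_mat n p" and A: "A \<subseteq> {..<p}" and ind: "indepf n (colf X) A"
begin

lemma sub_cols_inj:
  assumes v: "v \<in> carrier_vec (card A)" "sub_cols X A *\<^sub>v v = 0\<^sub>v n"
  shows "v = 0\<^sub>v (card A)"
proof -
  have fin: "finite A" using A finite_subset by auto
  define u where "u = (\<lambda>i. v $ card {b \<in> A. b < i})"
  have v': "v = vec (card A) (\<lambda>a. u (pick A a))" using vec_pick_repr[OF fin v(1)] by (simp add: u_def)
  have "vec n (fitf (colf X) A u) = 0\<^sub>v n" using v(2) unfolding v' sub_cols_mult[OF X A] .
  then have "\<forall>k<n. fitf (colf X) A u k = 0" by (metis index_vec index_zero_vec(1))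
  then have "\<forall>i\<in>A. u i = 0" using ind unfolding indepf_def by blast
  then show ?thesis unfolding v' using pick_in_set_le by (intro eq_vecI) auto
qed

lemma pinv_sub_cols:
  obtains Q where "Q \<in> carrier_mat (card A) (card A)"
    "Q * (transpose_mat (sub_cols X A) * sub_cols X A) = 1\<^sub>m (card A)"
    "(transpose_mat (sub_cols X A) * sub_cols X A) * Q = 1\<^sub>m (card A)"
    "pinv (sub_cols X A) = Q * transpose_mat (sub_cols X A)"
    "pinv (transpose_mat (sub_cols X A)) = sub_cols X A * Q"
  by (rule pinv_full_column_rank[OF sub_cols_carrier[OF X A] sub_cols_inj]) auto

lemma gram_mult:
  "(transpose_mat (sub_cols X A) * sub_cols X A) *\<^sub>v vec (card A) (\<lambda>a. u (pick A a))
    = vec (card A) (\<lambda>a. dotf n (colf X (pick A a)) (fitf (colf X) A u))"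
proof -
  note c = sub_cols_carrier[OF X A]
  have "(transpose_mat (sub_cols X A) * sub_cols X A) *\<^sub>v vec (card A) (\<lambda>a. u (pick A a))
    = transpose_mat (sub_cols X A) *\<^sub>v (sub_cols X A *\<^sub>v vec (card A) (\<lambda>a. u (pick A a)))"
    using c by (intro assoc_mult_mat_vec[of _ "card A" n _ "card A"]) auto
  also have "\<dots> = vec (card A) (\<lambda>a. dotf n (colf X (pick A a)) (($) (vec n (fitf (colf X) A u))))"
    unfolding sub_cols_mult[OF X A] by (rule sub_cols_transpose_mult[OF X A]) simp
  finally show ?thesis by (simp only: dotf_vec)
qed

lemma normal_equations_solvable: "\<exists>u. \<forall>i\<in>A. dotf n (colf X i) (fitf (colf X) A u) = c i"
proof -
  have fin: "finite A" using A finite_subset by auto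
  note cc = sub_cols_carrier[OF X A]
  let ?M = "transpose_mat (sub_cols X A) * sub_cols X A"
  have M: "?M \<in> carrier_mat (card A) (card A)" using cc by auto
  obtain Q where Q: "Q \<in> carrier_mat (card A) (card A)" "?M * Q = 1\<^sub>m (card A)"
    using pinv_sub_cols by blast
  define c' where "c' = vec (card A) (\<lambda>a. c (pick A a))"
  have c': "c' \<in> carrier_vec (card A)" by (simp add: c'_def)
  define v where "v = Q *\<^sub>v c'"
  have v: "v \<in> carrier_vec (card A)" using Q c' by (simp add: v_def)
  define u where "u = (\<lambda>i. v $ card {b \<in> A. b < i})"
  have v': "v = vec (card A) (\<lambda>a. u (pick A a))" using vec_pick_repr[OF fin v] by (simp add: u_def)
  have "?M *\<^sub>v v = c'"
    unfolding v_def assoc_mult_mat_vec[OF M Q(1) c', symmetric] Q(2) by (rule one_mult_mat_vec[OF c'])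
  then have e: "vec (card A) (\<lambda>a. dotf n (colf X (pick A a)) (fitf (colf X) A u)) = vec (card A) (\<lambda>a. c (pick A a))"
    unfolding v' gram_mult c'_def .
  have "dotf n (colf X i) (fitf (colf X) A u) = c i" if "i \<in> A" for i
  proof -
    obtain a where "a < card A" "i = pick A a" using pick_surj[OF fin \<open>i \<in> A\<close>] by blast
    then show ?thesis using arg_cong[OF e, of "\<lambda>v. v $ a"] by simp
  qed
  then show ?thesis by blast
qed

text \<open>From here on solutions of the normal equations replace pseudoinverses: \<open>u\<close>
  stands for the least squares coefficients of \<open>y\<close>, and in the lemmas below
  \<open>v\<close> for the inverse Gram matrix applied to the sign vector.\<close>

lemma pinv_mult_eq:
  assumes y: "y \<in> carrier_vec n"
    and u: "\<And>i. i \<in> A \<Longrightarrow> dotf n (colf X i) (fitf (colf X) A u) = dotf n (colf X i) (($) y)"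
  shows "pinv (sub_cols X A) *\<^sub>v y = vec (card A) (\<lambda>a. u (pick A a))"
proof -
  note cc = sub_cols_carrier[OF X A]
  let ?M = "transpose_mat (sub_cols X A) * sub_cols X A"
  let ?u = "vec (card A) (\<lambda>a. u (pick A a))"
  have M: "?M \<in> carrier_mat (card A) (card A)" using cc by auto
  have T: "transpose_mat (sub_cols X A) \<in> carrier_mat (card A) n" using cc by simp
  obtain Q where Q: "Q \<in> carrier_mat (card A) (card A)" "Q * ?M = 1\<^sub>m (card A)" "pinv (sub_cols X A) = Q * transpose_mat (sub_cols X A)"
    using pinv_sub_cols by metis
  have "transpose_mat (sub_cols X A) *\<^sub>v y = ?M *\<^sub>v ?u"
    unfolding gram_mult sub_cols_transpose_mult[OF X A y] using u pick_in_set_le by (intro eq_vecI) auto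
  then have "pinv (sub_cols X A) *\<^sub>v y = Q *\<^sub>v (?M *\<^sub>v ?u)"
    unfolding Q(3) assoc_mult_mat_vec[OF Q(1) T y] by simp
  also have "\<dots> = (Q * ?M) *\<^sub>v ?u" by (rule assoc_mult_mat_vec[OF Q(1) M, symmetric]) simp
  also have "\<dots> = ?u" unfolding Q(2) by (rule one_mult_mat_vec) simp
  finally show ?thesis .
qed

lemma pinv_sub_cols_carrier: "pinv (sub_cols X A) \<in> carrier_mat (card A) n"
proof -
  obtain Q where Q: "Q \<in> carrier_mat (card A) (card A)" "pinv (sub_cols X A) = Q * transpose_mat (sub_cols X A)"
    using pinv_sub_cols by metis
  then show ?thesis using sub_cols_carrier[OF X A] by auto
qed

lemma proj_carrier: "proj X A \<in> carrier_mat n n"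
  unfolding proj_def using sub_cols_carrier[OF X A] pinv_sub_cols_carrier by auto

lemma resid_proj_carrier: "resid_proj X A \<in> carrier_mat n n"
  unfolding resid_proj_def using proj_carrier X by auto

lemma resid_proj_mult:
  assumes y: "y \<in> carrier_vec n"
    and u: "\<And>i. i \<in> A \<Longrightarrow> dotf n (colf X i) (fitf (colf X) A u) = dotf n (colf X i) (($) y)"
  shows "resid_proj X A *\<^sub>v y = vec n (\<lambda>k. y $ k - fitf (colf X) A u k)"
proof -
  have pv: "pinv (sub_cols X A) *\<^sub>v y = vec (card A) (\<lambda>a. u (pick A a))" by (rule pinv_mult_eq[OF y]) (rule u)
  have P: "proj X A *\<^sub>v y = vec n (fitf (colf X) A u)"
    unfolding proj_def assoc_mult_mat_vec[OF sub_cols_carrier[OF X A] pinv_sub_cols_carrier y]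
      pv by (rule sub_cols_mult[OF X A])
  have one: "1\<^sub>m n \<in> carrier_mat n n" by simp
  have "dim_row X = n" using X by simp
  then have "resid_proj X A *\<^sub>v y = 1\<^sub>m n *\<^sub>v y - proj X A *\<^sub>v y"
    unfolding resid_proj_def using minus_mult_distrib_mat_vec[OF one proj_carrier y] by simp
  also have "\<dots> = y - vec n (fitf (colf X) A u)" unfolding P one_mult_mat_vec[OF y] ..
  also have "\<dots> = vec n (\<lambda>k. y $ k - fitf (colf X) A u k)" using y by (intro eq_vecI) auto
  finally show ?thesis .
qed

lemma pinv_transpose_mult:
  assumes s: "s \<in> carrier_vec (card A)"
    and v: "\<And>a. a < card A \<Longrightarrow> dotf n (colf X (pick A a)) (fitf (colf X) A v) = s $ a"
  shows "pinv (transpose_mat (sub_cols X A)) *\<^sub>v s = vec n (fitf (colf X) A v)"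
proof -
  note cc = sub_cols_carrier[OF X A]
  let ?M = "transpose_mat (sub_cols X A) * sub_cols X A"
  let ?v = "vec (card A) (\<lambda>a. v (pick A a))"
  have M: "?M \<in> carrier_mat (card A) (card A)" using cc by auto
  obtain Q where Q: "Q \<in> carrier_mat (card A) (card A)" "Q * ?M = 1\<^sub>m (card A)" "pinv (transpose_mat (sub_cols X A)) = sub_cols X A * Q"
    using pinv_sub_cols by metis
  have "?M *\<^sub>v ?v = s" unfolding gram_mult using v s by (intro eq_vecI) auto
  then have "Q *\<^sub>v s = (Q * ?M) *\<^sub>v ?v"
    using assoc_mult_mat_vec[OF Q(1) M, of ?v] by simp
  then have Qs: "Q *\<^sub>v s = ?v" unfolding Q(2) by simp
  show ?thesis unfolding Q(3) assoc_mult_mat_vec[OF cc Q(1) s] Qs by (rule sub_cols_mult[OF X A])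
qed

lemma hit_value_eq:
  assumes y: "y \<in> carrier_vec n" and s: "sA \<in> carrier_vec (card A)" and j: "j < p"
    and u: "\<And>i. i \<in> A \<Longrightarrow> dotf n (colf X i) (fitf (colf X) A u) = dotf n (colf X i) (($) y)"
    and v: "\<And>a. a < card A \<Longrightarrow> dotf n (colf X (pick A a)) (fitf (colf X) A v) = sA $ a"
  shows "hit_value X y A sA j s = dotf n (colf X j) (\<lambda>k. y $ k - fitf (colf X) A u k) / (s - dotf n (colf X j) (fitf (colf X) A v))"
proof -
  have 1: "resid_proj X A *\<^sub>v y = vec n (\<lambda>k. y $ k - fitf (colf X) A u k)" by (rule resid_proj_mult[OF y]) (rule u)
  have 2: "pinv (transpose_mat (sub_cols X A)) *\<^sub>v sA = vec n (fitf (colf X) A v)" by (rule pinv_transpose_mult[OF s]) (rule v)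
  have 3: "col X j \<bullet> vec n f = dotf n (colf X j) f" for f
    using col_scalar_prod[OF X j, of "vec n f"] by (simp only: vec_carrier dotf_vec)
  show ?thesis unfolding hit_value_def 1 2 3 ..
qed

text \<open>I - P is symmetric and idempotent; concretely, the residual of column \<open>j\<close>
  is orthogonal to the fitted part of column \<open>i\<close>. Thus R is a Gram matrix.\<close>

lemma resid_gram_index:
  assumes u: "\<And>i j. i \<in> A \<Longrightarrow> j < p \<Longrightarrow> dotf n (colf X i) (fitf (colf X) A (u j)) = dotf n (colf X i) (colf X j)"
    and ij: "i < p" "j < p"
  shows "resid_gram X A $$ (i, j) = dotf n (\<lambda>k. colf X i k - fitf (colf X) A (u i) k) (\<lambda>k. colf X j k - fitf (colf X) A (u j) k)"
proof -
  have cj: "col X j \<in> carrier_vec n" "\<And>k. k < n \<Longrightarrow> col X j $ k = colf X j k" using X ij by (auto simp: col_def colf_def)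
  have u': "dotf n (colf X i) (fitf (colf X) A (u j)) = dotf n (colf X i) (($) (col X j))" if "i \<in> A" for i
    unfolding u[OF that ij(2)] by (rule dotf_cong) (simp_all add: cj)
  have P: "resid_proj X A \<in> carrier_mat n n" by (rule resid_proj_carrier)
  have XT: "transpose_mat X \<in> carrier_mat p n" using X by simp
  have PX: "resid_proj X A * X \<in> carrier_mat n p" using P X by simp
  have "resid_gram X A $$ (i, j) = row (transpose_mat X) i \<bullet> col (resid_proj X A * X) j"
    unfolding resid_gram_def assoc_mult_mat[OF XT P X] using XT PX ij by simp
  also have "row (transpose_mat X) i = col X i" using X ij by simp
  also have "col (resid_proj X A * X) j = resid_proj X A *\<^sub>v col X j" using P X ij by (intro col_mult2) auto
  also have "\<dots> = vec n (\<lambda>k. col X j $ k - fitf (colf X) A (u j) k)" by (rule resid_proj_mult[OF cj(1) u'])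
  also have "col X i \<bullet> \<dots> = dotf n (colf X i) (\<lambda>k. col X j $ k - fitf (colf X) A (u j) k)"
    using col_scalar_prod[OF X ij(1)] by (simp add: dotf_vec)
  also have "\<dots> = dotf n (colf X i) (\<lambda>k. colf X j k - fitf (colf X) A (u j) k)"
    by (rule dotf_cong) (simp_all add: cj)
  finally have 1: "resid_gram X A $$ (i, j) = dotf n (colf X i) (\<lambda>k. colf X j k - fitf (colf X) A (u j) k)" .
  let ?r = "\<lambda>k. colf X j k - fitf (colf X) A (u j) k"
  have "dotf n ?r (fitf (colf X) A (u i)) = (\<Sum>l\<in>A. u i l * (dotf n (colf X l) (colf X j) - dotf n (colf X l) (fitf (colf X) A (u j))))"
    unfolding dotf_fitf[of n ?r] by (simp only: dotf_commute[of n ?r] dotf_diff)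
  also have "\<dots> = 0" using u ij by simp
  finally have "dotf n ?r (\<lambda>k. colf X i k - fitf (colf X) A (u i) k) = dotf n ?r (colf X i)"
    by (simp add: dotf_diff)
  then show ?thesis unfolding 1 by (simp only: dotf_commute[of n "colf X i"] dotf_commute[of n "\<lambda>k. colf X i k - fitf (colf X) A (u i) k"])
qed

end

section \<open>The matrix form of the lasso\<close>

lemma lasso_obj_objf:
  assumes X: "X \<in> carrier_mat n p" and y: "y \<in> carrier_vec n" and b: "b \<in> carrier_vec p"
  shows "lasso_obj X y l b = objf n (colf X) {..<p} (($) y) l (($) b)"
proof -
  have "y - X *\<^sub>v b = vec n (\<lambda>k. y $ k - fitf (colf X) {..<p} (($) b) k)"
    unfolding mult_mat_vec_fitf[OF X b] using y by (intro eq_vecI) auto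
  moreover have "vec n f \<bullet> vec n f = dotf n f f" for f :: "nat \<Rightarrow> real"
    by (simp add: scalar_prod_def dotf_def atLeast0LessThan)
  moreover have "l1_norm b = (\<Sum>i<p. \<bar>b $ i\<bar>)" using b by (simp add: l1_norm_def)
  ultimately show ?thesis unfolding lasso_obj_def objf_def by simp
qed

text \<open>Nothing is known about \<open>arg_min_on\<close> unless a minimizer exists. Coercivity
  provides one for positive \<open>l\<close>; at \<open>l = 0\<close> existence has to come from
  elsewhere, hence the separate assumption.\<close>

lemma lasso_kktf_if_min_exists:
  assumes X: "X \<in> carrier_mat n p" and y: "y \<in> carrier_vec n" and l: "0 \<le> l"
    and ex: "\<exists>b. \<forall>b'. objf n (colf X) {..<p} (($) y) l b \<le> objf n (colf X) {..<p} (($) y) l b'"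
  shows "lasso X y l \<in> carrier_vec p" "kktf n (colf X) {..<p} (($) y) l (($) (lasso X y l))"
proof -
  let ?f = "objf n (colf X) {..<p} (($) y) l"
  obtain b where b: "\<And>b'. ?f b \<le> ?f b'" using ex by blast
  have vb: "?f (($) (vec p f)) = ?f f" for f by (rule objf_cong) simp
  have "is_arg_min (lasso_obj X y l) (\<lambda>x. x \<in> carrier_vec p) (vec p b)"
    unfolding is_arg_min_def using b by (auto simp: lasso_obj_objf[OF X y] vb not_less)
  then have "is_arg_min (lasso_obj X y l) (\<lambda>x. x \<in> carrier_vec p) (lasso X y l)"
    unfolding lasso_def arg_min_on_def arg_min_def using X by (auto intro: someI)
  then have c: "lasso X y l \<in> carrier_vec p" and m: "\<And>b'. b' \<in> carrier_vec p \<Longrightarrow> lasso_obj X y l (lasso X y l) \<le> lasso_obj X y l b'"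
    by (auto simp: is_arg_min_def not_less)
  show "lasso X y l \<in> carrier_vec p" by (rule c)
  show "kktf n (colf X) {..<p} (($) y) l (($) (lasso X y l))"
  proof (rule min_imp_kktf)
    fix b'
    show "?f (($) (lasso X y l)) \<le> ?f b'"
      using m[of "vec p b'"] lasso_obj_objf[OF X y c] lasso_obj_objf[OF X y, of "vec p b'"] vb[of b'] by simp
  qed (use l in auto)
qed

lemma lasso_kktf:
  assumes "X \<in> carrier_mat n p" "y \<in> carrier_vec n" "0 < l"
  shows "lasso X y l \<in> carrier_vec p" "kktf n (colf X) {..<p} (($) y) l (($) (lasso X y l))"
  using assms by (auto intro!: lasso_kktf_if_min_exists objf_min_exists)

text \<open>Any point satisfying the optimality conditions proves that a minimizer exists and has
  the fit of every minimizer. This evaluates the fit of \<open>lasso\<close> even at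
  \<open>l = 0\<close>, where its coefficients may be ambiguous.\<close>

lemma lasso_fit:
  assumes X: "X \<in> carrier_mat n p" and y: "y \<in> carrier_vec n" and l: "0 \<le> l"
    and b: "kktf n (colf X) {..<p} (($) y) l b"
  shows "X *\<^sub>v lasso X y l = vec n (fitf (colf X) {..<p} b)"
proof -
  have "\<exists>b. \<forall>b'. objf n (colf X) {..<p} (($) y) l b \<le> objf n (colf X) {..<p} (($) y) l b'"
  proof (intro exI allI)
    fix b'
    show "objf n (colf X) {..<p} (($) y) l b \<le> objf n (colf X) {..<p} (($) y) l b'"
      using kktf_imp_le[OF _ b, of b'] dotf_nonneg[of n "\<lambda>k. fitf (colf X) {..<p} b' k - fitf (colf X) {..<p} b k"]
      by simp
  qed
  note L = lasso_kktf_if_min_exists[OF X y l this]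
  show ?thesis unfolding mult_mat_vec_fitf[OF X L(1)]
    using kktf_fit_unique[OF _ L(2) b] by (intro eq_vecI) auto
qed

lemma lasso_fit_sub_cols:
  assumes X: "X \<in> carrier_mat n p" and A: "A \<subseteq> {..<p}" and y: "y \<in> carrier_vec n" and l: "0 \<le> l"
    and u: "kktf n (colf X) A (($) y) l u"
  shows "sub_cols X A *\<^sub>v lasso (sub_cols X A) y l = vec n (fitf (colf X) A u)"
proof -
  have fin: "finite A" using A finite_subset by auto
  note c = sub_cols_carrier[OF X A]
  let ?B = "sub_cols X A"
  have fit: "fitf (colf ?B) {..<card A} (\<lambda>a. u (pick A a)) k = fitf (colf X) A u k" if "k < n" for k
    using sum_pick[OF fin, of "\<lambda>i. u i * colf X i k"] colf_sub_cols[OF X A that] by (simp add: fitf_def)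
  have "kktf n (colf ?B) {..<card A} (($) y) l (\<lambda>a. u (pick A a))"
    unfolding kktf_def
  proof
    fix a assume a: "a \<in> {..<card A}"
    have "dotf n (colf ?B a) (\<lambda>k. y $ k - fitf (colf ?B) {..<card A} (\<lambda>a. u (pick A a)) k)
      = dotf n (colf X (pick A a)) (\<lambda>k. y $ k - fitf (colf X) A u k)"
      using a by (intro dotf_cong) (auto simp: fit colf_sub_cols[OF X A])
    then show "\<bar>dotf n (colf ?B a) (\<lambda>k. y $ k - fitf (colf ?B) {..<card A} (\<lambda>a. u (pick A a)) k)\<bar> \<le> l \<and>
      (u (pick A a) \<noteq> 0 \<longrightarrow> dotf n (colf ?B a) (\<lambda>k. y $ k - fitf (colf ?B) {..<card A} (\<lambda>a. u (pick A a)) k) = l * sgn (u (pick A a)))"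
      using u pick_in_set_le[of a A] a by (simp add: kktf_def)
  qed
  from lasso_fit[OF c y l this] show ?thesis by (auto simp: fit intro!: eq_vecI)
qed

section \<open>Schur complements as residual sums of squares\<close>

lemma index_mult_mat_sum:
  assumes "P \<in> carrier_mat k m" "N \<in> carrier_mat m q" "a < k" "b < q"
  shows "(P * N) $$ (a, b) = (\<Sum>c<m. P $$ (a, c) * N $$ (c, b))"
  using assms by (simp add: scalar_prod_def atLeast0LessThan)

text \<open>As R is a Gram matrix, the inverse of its block on \<open>T\<close> times the column of
  \<open>i\<close> consists of the coefficients of the regression of \<open>r i\<close> on the
  \<open>r l\<close> with \<open>l\<close> in \<open>T\<close>. The vector \<open>w\<close> is the
  residual of this regression.\<close>

lemma schur_compl_residual:
  assumes Rc: "R \<in> carrier_mat p p" and J: "J \<subseteq> {..<p}"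
    and R: "\<And>i j. i \<in> J \<Longrightarrow> j \<in> J \<Longrightarrow> R $$ (i, j) = dotf n (r i) (r j)"
    and T: "T \<subseteq> J" and i: "i \<in> J" and inv: "invertible_mat (submatrix R T T)"
  shows "\<exists>w. (\<forall>l\<in>T. dotf n (r l) w = 0) \<and> dotf n (r i) w = dotf n w w \<and> schur_compl R T i = dotf n w w"
proof -
  have fin: "finite T" by (rule finite_subset[OF subset_trans[OF T J]]) simp
  define m where "m = card T"
  have setT: "{j. j < p \<and> j \<in> T} = T" using T J by auto
  have seti: "{j. j < p \<and> j \<in> {i}} = {i}" using i J by auto
  have picki: "pick {i} 0 = i" using pick_in_set_le[of 0 "{i}"] by simp
  define M where "M = submatrix R T T"
  have M: "M \<in> carrier_mat m m" using Rc setT by (intro carrier_matI) (simp_all add: M_def dim_submatrix m_def)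
  define C where "C = submatrix R T {i}"
  have C: "C \<in> carrier_mat m 1" using Rc setT seti by (intro carrier_matI) (simp_all add: C_def dim_submatrix m_def)
  define D where "D = submatrix R {i} T"
  have D: "D \<in> carrier_mat 1 m" using Rc setT seti by (intro carrier_matI) (simp_all add: D_def dim_submatrix m_def)
  have pT: "pick T a \<in> T" if "a < m" for a using that pick_in_set_le by (simp add: m_def)
  have pJ: "pick T a \<in> J" if "a < m" for a using pT[OF that] T by auto
  have Me: "M $$ (a, b) = dotf n (r (pick T a)) (r (pick T b))" if "a < m" "b < m" for a b
    using that Rc setT R[OF pJ[OF that(1)] pJ[OF that(2)]] unfolding M_def by (subst submatrix_index) (simp_all add: m_def)
  have Ce: "C $$ (a, 0) = dotf n (r (pick T a)) (r i)" if "a < m" for a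
    using that Rc setT seti R[OF pJ[OF that(1)] i] picki unfolding C_def by (subst submatrix_index) (simp_all add: m_def)
  have De: "D $$ (0, a) = dotf n (r i) (r (pick T a))" if "a < m" for a
    using that Rc setT seti R[OF i pJ[OF that(1)]] picki unfolding D_def by (subst submatrix_index) (simp_all add: m_def)
  obtain B where B: "mat_inverse M = Some B"
  proof (cases "mat_inverse M")
    case None
    obtain N where N: "M * N = 1\<^sub>m (dim_row M)" "N * M = 1\<^sub>m (dim_row N)"
      using inv unfolding M_def[symmetric] invertible_mat_def inverts_mat_def by auto
    have "dim_row N = m" "dim_col N = m"
      using arg_cong[OF N(1), of dim_col] arg_cong[OF N(2), of dim_col] M by auto
    then have "M \<in> Units (ring_mat TYPE(real) m ())"
      using N M unfolding Units_def ring_mat_def by auto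
    then show ?thesis using mat_inverse(1)[OF M None, of "()"] by simp
  qed auto
  have Bi: "M * B = 1\<^sub>m m" "B \<in> carrier_mat m m" using mat_inverse(2)[OF M B] by auto
  define b where "b = (\<lambda>l. (B * C) $$ (card {a \<in> T. a < l}, 0))"
  have BC: "B * C \<in> carrier_mat m 1" using Bi C by simp
  have bp: "b (pick T a) = (B * C) $$ (a, 0)" if "a < m" for a using that card_pick_le by (simp add: b_def m_def)
  define w where "w = (\<lambda>k. r i k - fitf r T b k)"
  have "M * (B * C) = C" using assoc_mult_mat[OF M Bi(2) C] Bi(1) C by simp
  have orth: "dotf n (r l) w = 0" if l: "l \<in> T" for l
  proof -
    obtain a where a: "a < m" "l = pick T a" using pick_surj[OF fin l] by (auto simp: m_def)
    have "dotf n (r l) (fitf r T b) = (\<Sum>a'<m. b (pick T a') * dotf n (r l) (r (pick T a')))"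
      unfolding dotf_fitf m_def by (rule sum_pick[OF fin, symmetric])
    also have "\<dots> = (\<Sum>a'<m. M $$ (a, a') * (B * C) $$ (a', 0))"
      using a by (intro sum.cong) (auto simp: bp Me)
    also have "\<dots> = (M * (B * C)) $$ (a, 0)"
      by (rule index_mult_mat_sum[OF M BC a(1), symmetric]) simp
    also have "\<dots> = dotf n (r l) (r i)" unfolding \<open>M * (B * C) = C\<close> using Ce a by simp
    finally show ?thesis by (simp add: w_def dotf_diff)
  qed
  have "dotf n w w = dotf n (r i) w"
  proof -
    have "dotf n w (fitf r T b) = 0" unfolding dotf_fitf using orth by (simp add: dotf_commute[of n w])
    then have "dotf n w w = dotf n w (r i)" by (subst (2) w_def) (simp add: dotf_diff)
    then show ?thesis by (simp add: dotf_commute)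
  qed
  moreover have "schur_compl R T i = dotf n (r i) w"
  proof -
    have "(D * B * C) $$ (0, 0) = (D * (B * C)) $$ (0, 0)" using assoc_mult_mat[OF D Bi(2) C] by simp
    also have "\<dots> = (\<Sum>a<m. D $$ (0, a) * (B * C) $$ (a, 0))"
      by (rule index_mult_mat_sum[OF D BC]) simp_all
    also have "\<dots> = (\<Sum>a<m. b (pick T a) * dotf n (r i) (r (pick T a)))"
      by (intro sum.cong) (auto simp: bp De)
    also have "\<dots> = dotf n (r i) (fitf r T b)"
      unfolding dotf_fitf m_def by (rule sum_pick[OF fin])
    finally show ?thesis unfolding schur_compl_def M_def[symmetric] C_def[symmetric] D_def[symmetric] B option.sel
      using R[OF i i] by (simp add: w_def dotf_diff)
  qed
  ultimately show ?thesis using orth by metis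
qed

section \<open>The solution path\<close>

lemma fitf_orthogonal_eq:
  assumes "\<And>i. i \<in> A \<Longrightarrow> dotf n (x i) (fitf x A b) = dotf n (x i) (fitf x A c)" "k < n"
  shows "fitf x A b k = fitf x A c k"
proof -
  define z where "z = fitf x A (\<lambda>i. b i - c i)"
  have z: "z = (\<lambda>k. fitf x A b k - fitf x A c k)" by (simp add: z_def fitf_diff fun_eq_iff)
  have "dotf n z z = (\<Sum>i\<in>A. (b i - c i) * dotf n z (x i))" by (subst (2) z_def) (rule dotf_fitf)
  also have "\<dots> = 0"
  proof (intro sum.neutral ballI)
    fix i assume "i \<in> A"
    have "dotf n z (x i) = dotf n (x i) z" by (rule dotf_commute)
    also have "\<dots> = 0" unfolding z dotf_diff using assms(1)[OF \<open>i \<in> A\<close>] by simp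
    finally show "(b i - c i) * dotf n z (x i) = 0" by simp
  qed
  finally show ?thesis unfolding dotf_eq_0_iff using assms(2) by (simp add: z)
qed

lemma normal_equations_unique:
  assumes "indepf n x A" "\<And>i. i \<in> A \<Longrightarrow> dotf n (x i) (fitf x A b) = dotf n (x i) (fitf x A c)" "i \<in> A"
  shows "b i = c i"
proof -
  have "\<forall>k<n. fitf x A (\<lambda>i. b i - c i) k = 0"
    using fitf_orthogonal_eq[of A n x b c] assms(2) by (simp add: fitf_diff)
  then have "\<forall>i\<in>A. b i - c i = 0" using assms(1)[unfolded indepf_def, rule_format, of "\<lambda>i. b i - c i"] by blast
  then show ?thesis using assms(3) by simp
qed

text \<open>Carries conditions on the solution from an open interval of the path to its
  endpoints.\<close>

lemma affine_nonneg_closure: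
  fixes a b :: real
  assumes "l1 < l0" "l1 \<le> m" "m \<le> l0" "\<And>l. l1 < l \<Longrightarrow> l < l0 \<Longrightarrow> 0 \<le> a + l * b"
  shows "0 \<le> a + m * b"
proof -
  have "m \<in> closure {l1<..<l0}" using assms by (simp add: closure_greaterThanLessThan)
  moreover have "continuous_on (closure {l1<..<l0}) (\<lambda>m. a + m * b)" by (intro continuous_intros)
  ultimately show ?thesis
    using assms(4) continuous_ge_on_closure[of "{l1<..<l0}" "\<lambda>m. a + m * b" m 0] by (simp only: greaterThanLessThan_iff)
qed

text \<open>The endpoints are real and need not be knots. A bounded piece of the interval at step k0
  suffices, so the infinite knot at step 0 needs no separate treatment.\<close>

definition lasso_segment where
  "lasso_segment n x I y \<beta> A \<sigma> l1 l0 \<longleftrightarrow> (\<forall>l. l1 < l \<and> l < l0 \<longrightarrow> kktf n x I y l (\<beta> l) \<and>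
     (\<forall>i\<in>I. \<beta> l i \<noteq> 0 \<longleftrightarrow> i \<in> A) \<and> (\<forall>i\<in>A. sgn (\<beta> l i) = \<sigma> i))"

context
  fixes n :: nat and x :: "nat \<Rightarrow> nat \<Rightarrow> real" and I :: "nat set" and y :: "nat \<Rightarrow> real"
    and \<beta> :: "real \<Rightarrow> nat \<Rightarrow> real" and A :: "nat set" and \<sigma> :: "nat \<Rightarrow> real" and l1 l0 :: real
  assumes I: "finite I" and gp: "gpf n x I" and l: "0 \<le> l1" "l1 < l0" and A: "A \<subseteq> I"
    and seg: "lasso_segment n x I y \<beta> A \<sigma> l1 l0"
begin

lemma segment_kkt:
  assumes "l1 < l" "l < l0"
  shows "kktf n x I y l (\<beta> l)" "\<And>i. i \<in> I \<Longrightarrow> \<beta> l i \<noteq> 0 \<longleftrightarrow> i \<in> A" "\<And>i. i \<in> A \<Longrightarrow> sgn (\<beta> l i) = \<sigma> i"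
  using seg assms unfolding lasso_segment_def by blast+

lemma segment_sign: "i \<in> A \<Longrightarrow> \<sigma> i \<in> {-1, 1}"
proof -
  assume i: "i \<in> A"
  define m where "m = (l1 + l0) / 2"
  have m: "l1 < m" "m < l0" using l by (auto simp: m_def)
  show ?thesis using segment_kkt(2,3)[OF m] i A by (auto simp: sgn_if split: if_splits) (metis subsetD)+
qed

lemma segment_fit: "l1 < l \<Longrightarrow> l < l0 \<Longrightarrow> fitf x I (\<beta> l) = fitf x A (\<beta> l)"
  using segment_kkt(2)[of l] by (intro fitf_mono_neutral I A) auto

lemma segment_correlation:
  assumes "l1 < l" "l < l0" "i \<in> A"
  shows "dotf n (x i) (\<lambda>k. y k - fitf x A (\<beta> l) k) = l * \<sigma> i"
proof -
  have i: "i \<in> I" using assms A by auto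
  then have "\<beta> l i \<noteq> 0" using segment_kkt(2)[OF assms(1,2) i] assms by simp
  then have "dotf n (x i) (\<lambda>k. y k - fitf x I (\<beta> l) k) = l * sgn (\<beta> l i)"
    using segment_kkt(1)[OF assms(1,2)] i unfolding kktf_def by blast
  then show ?thesis using segment_fit[OF assms(1,2)] segment_kkt(3)[OF assms] by simp
qed

text \<open>All active columns have the same positive absolute correlation with the
  residual.\<close>

lemma segment_indep: "indepf n x A"
proof -
  define m where "m = (l1 + l0) / 2"
  have m: "l1 < m" "m < l0" "0 < m" using l by (auto simp: m_def)
  show ?thesis
  proof (rule gpf_equicorrelation_indep[OF gp I m(3) A])
    fix i assume "i \<in> A"
    then show "\<bar>dotf n (x i) (\<lambda>k. y k - fitf x A (\<beta> m) k)\<bar> = m"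
      using segment_correlation[OF m(1,2)] segment_sign[of i] m(3) by (auto simp: abs_mult)
  qed
qed

context
  fixes u v :: "nat \<Rightarrow> real"
  assumes u: "\<And>i. i \<in> A \<Longrightarrow> dotf n (x i) (fitf x A u) = dotf n (x i) y"
    and v: "\<And>i. i \<in> A \<Longrightarrow> dotf n (x i) (fitf x A v) = \<sigma> i"
begin

text \<open>Both sides solve the normal equations with right-hand side x_i y - l \<sigma>_i, and the
  active columns are independent.\<close>

lemma segment_affine:
  assumes "l1 < l" "l < l0" "i \<in> A"
  shows "\<beta> l i = u i - l * v i"
proof (rule normal_equations_unique[OF segment_indep _ assms(3)])
  fix j assume j: "j \<in> A"
  have "dotf n (x j) (fitf x A (\<lambda>i. u i - l * v i)) = dotf n (x j) y - l * \<sigma> j"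
    unfolding fitf_affine using u[OF j] v[OF j] by (simp add: dotf_diff dotf_scale)
  moreover have "dotf n (x j) (fitf x A (\<beta> l)) = dotf n (x j) y - l * \<sigma> j"
    using segment_correlation[OF assms(1,2) j] by (simp add: dotf_diff)
  ultimately show "dotf n (x j) (fitf x A (\<beta> l)) = dotf n (x j) (fitf x A (\<lambda>i. u i - l * v i))" by simp
qed

text \<open>Inside the segment the optimality conditions are affine inequalities in the penalty, so
  they persist at the ends. A coefficient may vanish there, so the sign condition becomes
  weak.\<close>

lemma segment_closed:
  assumes m: "l1 \<le> m" "m \<le> l0"
  shows "kktf n x I y m (\<lambda>i. if i \<in> A then u i - m * v i else 0)"
    "\<And>i. i \<in> A \<Longrightarrow> 0 \<le> \<sigma> i * (u i - m * v i)"
proof -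
  let ?b = "\<lambda>m i. if i \<in> A then u i - m * v i else 0"
  show sg: "0 \<le> \<sigma> i * (u i - m * v i)" if i: "i \<in> A" for i
  proof -
    have "0 \<le> \<sigma> i * u i + m * (- \<sigma> i * v i)"
    proof (rule affine_nonneg_closure[OF l(2) m])
      fix l assume l: "l1 < l" "l < l0"
      have "0 \<le> \<sigma> i * \<beta> l i" using segment_kkt(3)[OF l i] by (metis abs_ge_zero abs_sgn mult.commute)
      then show "0 \<le> \<sigma> i * u i + l * (- \<sigma> i * v i)"
        unfolding segment_affine[OF l i] by (simp add: algebra_simps)
    qed
    then show ?thesis by (simp add: algebra_simps)
  qed
  have fit: "fitf x I (?b m) = fitf x A (\<lambda>i. u i - m * v i)" for m
    using fitf_mono_neutral[OF I A, of "?b m" x] fitf_cong[of A "?b m" "\<lambda>i. u i - m * v i" x] by simp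
  have cor: "dotf n (x i) (\<lambda>k. y k - fitf x I (?b m) k) = (dotf n (x i) y - dotf n (x i) (fitf x A u)) + m * dotf n (x i) (fitf x A v)" for i m
    unfolding fit fitf_affine by (simp add: dotf_diff dotf_scale)
  have m0: "0 \<le> m" using l m by simp
  show "kktf n x I y m (?b m)"
    unfolding kktf_def
  proof
    fix i assume i: "i \<in> I"
    show "\<bar>dotf n (x i) (\<lambda>k. y k - fitf x I (?b m) k)\<bar> \<le> m \<and>
      (?b m i \<noteq> 0 \<longrightarrow> dotf n (x i) (\<lambda>k. y k - fitf x I (?b m) k) = m * sgn (?b m i))"
    proof (cases "i \<in> A")
      case True
      have "dotf n (x i) (\<lambda>k. y k - fitf x I (?b m) k) = m * \<sigma> i" unfolding cor using u v True by simp
      moreover have "sgn (u i - m * v i) = \<sigma> i" if "u i - m * v i \<noteq> 0"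
        using sg[OF True] segment_sign[OF True] that by (auto simp: sgn_if)
      ultimately show ?thesis using True segment_sign[OF True] m0 by (auto simp: abs_mult)
    next
      case False
      define a where "a = dotf n (x i) y - dotf n (x i) (fitf x A u)"
      define b where "b = dotf n (x i) (fitf x A v)"
      have *: "\<bar>a + l * b\<bar> \<le> l" if l: "l1 < l" "l < l0" for l
      proof -
        have "fitf x I (\<beta> l) = fitf x I (?b l)"
          unfolding fit segment_fit[OF l] using segment_affine[OF l] by (intro fitf_cong) auto
        then have "\<bar>dotf n (x i) (\<lambda>k. y k - fitf x I (?b l) k)\<bar> \<le> l"
          using segment_kkt(1)[OF l] i by (simp add: kktf_def)
        then show ?thesis unfolding cor a_def b_def .
      qed
      have "0 \<le> a + m * (b + 1)"
      proof (rule affine_nonneg_closure[OF l(2) m])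
        fix l assume "l1 < l" "l < l0"
        from *[OF this] show "0 \<le> a + l * (b + 1)" by (simp add: abs_le_iff algebra_simps)
      qed
      moreover have "0 \<le> - a + m * (1 - b)"
      proof (rule affine_nonneg_closure[OF l(2) m])
        fix l assume "l1 < l" "l < l0"
        from *[OF this] show "0 \<le> - a + l * (1 - b)" by (simp add: abs_le_iff algebra_simps)
      qed
      ultimately have "\<bar>a + m * b\<bar> \<le> m" by (simp add: abs_le_iff algebra_simps)
      then show ?thesis using False unfolding cor a_def b_def by simp
    qed
  qed
qed

end

end

text \<open>When \<open>w j\<close> holds the regression coefficients of column \<open>j\<close> on
  the columns in \<open>A\<close>, this is (I - P_A) X_j.\<close>

definition residf :: "(nat \<Rightarrow> nat \<Rightarrow> real) \<Rightarrow> nat set \<Rightarrow> (nat \<Rightarrow> nat \<Rightarrow> real) \<Rightarrow> nat \<Rightarrow> nat \<Rightarrow> real" where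
  "residf x A w j k = x j k - fitf x A (w j) k"

section \<open>Regression on the active variables\<close>

context
  fixes n :: nat and x :: "nat \<Rightarrow> nat \<Rightarrow> real" and I A :: "nat set" and w :: "nat \<Rightarrow> nat \<Rightarrow> real"
  assumes A: "A \<subseteq> I"
    and w: "\<And>i j. i \<in> A \<Longrightarrow> j \<in> I \<Longrightarrow> dotf n (x i) (fitf x A (w j)) = dotf n (x i) (x j)"
begin

lemma residf_orthogonal: "i \<in> A \<Longrightarrow> j \<in> I \<Longrightarrow> dotf n (x i) (residf x A w j) = 0"
  unfolding residf_def[abs_def] by (simp add: dotf_diff w)

lemma residf_orthogonal_fitf: "j \<in> I \<Longrightarrow> dotf n (residf x A w j) (fitf x A b) = 0"
  unfolding dotf_fitf by (simp add: dotf_commute[of n "residf x A w j"] residf_orthogonal)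

lemma residf_dotf: "j \<in> I \<Longrightarrow> dotf n (residf x A w j) (x i) = dotf n (residf x A w j) (residf x A w i)"
  unfolding residf_def[of x A w i, abs_def] by (simp add: dotf_diff residf_orthogonal_fitf)

lemma residf_response:
  assumes u: "\<And>i. i \<in> A \<Longrightarrow> dotf n (x i) (fitf x A u) = dotf n (x i) y" and j: "j \<in> I"
  shows "dotf n (residf x A w j) y = dotf n (x j) (\<lambda>k. y k - fitf x A u k)"
proof -
  have "dotf n z (fitf x A (w j)) = 0" if "z = (\<lambda>k. y k - fitf x A u k)" for z
    unfolding dotf_fitf that by (simp add: dotf_commute[of n "\<lambda>k. y k - fitf x A u k"] dotf_diff u)
  from this[OF refl] have "dotf n (\<lambda>k. y k - fitf x A u k) (residf x A w j) = dotf n (\<lambda>k. y k - fitf x A u k) (x j)"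
    unfolding residf_def[abs_def] by (simp add: dotf_diff)
  moreover have "dotf n (residf x A w j) (\<lambda>k. y k - fitf x A u k) = dotf n (residf x A w j) y"
    using residf_orthogonal_fitf[OF j] by (simp add: dotf_diff)
  ultimately show ?thesis by (simp add: dotf_commute)
qed

text \<open>A Gram-Schmidt step: enlarging the active set by \<open>j\<close> changes a fit by a
  multiple of the residual of \<open>j\<close>. It serves both right-hand sides: the correlations
  with the response and the signs.\<close>

lemma fitf_insert:
  assumes A': "finite A" "j \<in> I" "j \<notin> A" and R: "dotf n (residf x A w j) (residf x A w j) \<noteq> 0"
    and b: "\<And>i. i \<in> A \<Longrightarrow> dotf n (x i) (fitf x A b) = d i"
    and b': "\<And>i. i \<in> insert j A \<Longrightarrow> dotf n (x i) (fitf x (insert j A) b') = d i" and k: "k < n"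
  shows "fitf x (insert j A) b' k = fitf x A b k +
    (d j - dotf n (x j) (fitf x A b)) / dotf n (residf x A w j) (residf x A w j) * residf x A w j k"
proof -
  define q where "q = (d j - dotf n (x j) (fitf x A b)) / dotf n (residf x A w j) (residf x A w j)"
  define e where "e = (\<lambda>i. if i = j then q else b i - q * w j i)"
  have e: "fitf x (insert j A) e = (\<lambda>k. fitf x A b k + q * residf x A w j k)"
  proof
    fix k
    have "fitf x (insert j A) e k = q * x j k + fitf x A (\<lambda>i. b i - q * w j i) k"
      using A' unfolding fitf_def e_def by (auto intro!: sum.cong)
    then show "fitf x (insert j A) e k = fitf x A b k + q * residf x A w j k"
      by (simp add: fitf_affine residf_def algebra_simps)
  qed
  have "fitf x (insert j A) b' k = fitf x (insert j A) e k"
  proof (rule fitf_orthogonal_eq[OF _ k])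
    fix i assume i: "i \<in> insert j A"
    have "dotf n (x i) (fitf x A b) + q * dotf n (x i) (residf x A w j) = d i"
    proof (cases "i = j")
      case True
      have "dotf n (x j) (residf x A w j) = dotf n (residf x A w j) (residf x A w j)"
        using residf_dotf[OF A'(2)] by (simp add: dotf_commute[of n "x j"])
      then show ?thesis using True R by (simp add: q_def)
    next
      case False
      then show ?thesis using i b residf_orthogonal[OF _ A'(2)] by auto
    qed
    then show "dotf n (x i) (fitf x (insert j A) b') = dotf n (x i) (fitf x (insert j A) e)"
      unfolding b'[OF i] e by (simp add: dotf_add dotf_scale)
  qed
  then show ?thesis by (simp add: e q_def)
qed

end

text \<open>The residual correlation of every inactive variable is bounded by \<open>l1\<close> at the knot \<open>l1\<close>, with equality for
  the variables that enter there; absence of ties leaves exactly one.\<close>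

lemma lasso_knot_join:
  assumes I: "finite I" and gp: "gpf n x I" and l: "0 \<le> l2" "l2 < l1" "l1 < l0" and A: "A0 \<subseteq> I" "A1 \<subseteq> I"
    and seg0: "lasso_segment n x I y \<beta> A0 \<sigma>0 l1 l0" and seg1: "lasso_segment n x I y \<beta> A1 \<sigma>1 l2 l1"
    and kkt: "kktf n x I y l1 (\<beta> l1)"
    and knot: "\<not> (A1 = A0 \<and> (\<forall>i\<in>I. \<beta> l1 i \<noteq> 0 \<longleftrightarrow> i \<in> A0))"
    and u0: "\<And>i. i \<in> A0 \<Longrightarrow> dotf n (x i) (fitf x A0 u0) = dotf n (x i) y"
    and v0: "\<And>i. i \<in> A0 \<Longrightarrow> dotf n (x i) (fitf x A0 v0) = \<sigma>0 i"
    and w: "\<And>i j. i \<in> A0 \<Longrightarrow> j \<in> I \<Longrightarrow> dotf n (x i) (fitf x A0 (w j)) = dotf n (x i) (x j)"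
    and pos: "\<And>i. i \<in> A0 \<Longrightarrow> sgn (u0 i) = \<sigma>0 i"
    and a: "\<And>i. i \<in> I - A0 \<Longrightarrow> \<bar>dotf n (x i) (fitf x A0 v0)\<bar> < 1"
  defines "g \<equiv> \<lambda>i s. dotf n (residf x A0 w i) y / (s - dotf n (x i) (fitf x A0 v0))"
  assumes ties: "\<And>i j s t. i \<in> I - A0 \<Longrightarrow> j \<in> I - A0 \<Longrightarrow> i \<noteq> j \<Longrightarrow> s \<in> {-1, 1} \<Longrightarrow> t \<in> {-1, 1} \<Longrightarrow> g i s \<noteq> g j t"
  obtains j where "j \<in> I - A0" "A1 = insert j A0" "\<And>i. i \<in> A0 \<Longrightarrow> \<sigma>1 i = \<sigma>0 i" "\<sigma>1 j \<in> {-1, 1}" "g j (\<sigma>1 j) = l1"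
    "\<And>i s. i \<in> I - A0 \<Longrightarrow> s \<in> {-1, 1} \<Longrightarrow> (i, s) \<noteq> (j, \<sigma>1 j) \<Longrightarrow> g i s < l1"
    "\<And>m i. 0 \<le> m \<Longrightarrow> m \<le> l1 \<Longrightarrow> i \<in> A0 \<Longrightarrow> 0 < \<sigma>0 i * (u0 i - m * v0 i)"
proof -
  have l1: "0 < l1" using l by simp
  define b where "b = (\<lambda>i. if i \<in> A0 then u0 i - l1 * v0 i else 0)"
  have l10: "0 \<le> l1" using l1 by simp
  have s0: "\<sigma>0 i \<in> {-1, 1}" if "i \<in> A0" for i by (rule segment_sign[OF I gp l10 l(3) A(1) seg0 that])
  \<comment> \<open>The signed coefficient is affine in m, positive at 0 because the least squares
    fit has the signs \<sigma>0, and nonnegative at l0. So it is positive on the whole range below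
    l0, and no variable leaves at l1.\<close>
  have P: "0 < \<sigma>0 i * (u0 i - m * v0 i)" if m: "0 \<le> m" "m \<le> l1" and i: "i \<in> A0" for m i
  proof -
    have e: "0 \<le> \<sigma>0 i * (u0 i - l0 * v0 i)"
      by (rule segment_closed(2)[OF I gp l10 l(3) A(1) seg0 u0 v0 _ _ i]) (use l in auto)
    have "\<sigma>0 i * u0 i = \<bar>u0 i\<bar>" using pos[OF i] by (metis abs_sgn mult.commute)
    moreover have "u0 i \<noteq> 0" using pos[OF i] s0[OF i] by auto
    ultimately have p: "0 < \<sigma>0 i * u0 i" by simp
    have "l0 * (\<sigma>0 i * (u0 i - m * v0 i)) = (l0 - m) * (\<sigma>0 i * u0 i) + m * (\<sigma>0 i * (u0 i - l0 * v0 i))"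
      by (simp add: algebra_simps)
    also have "\<dots> > 0" using m l by (intro add_pos_nonneg mult_pos_pos[OF _ p] mult_nonneg_nonneg[OF _ e]) auto
    finally show ?thesis using l l1 by (simp add: zero_less_mult_iff)
  qed
  have "kktf n x I y l1 b" unfolding b_def
    by (rule segment_closed(1)[OF I gp l10 l(3) A(1) seg0 u0 v0]) (use l in auto)
  then have \<beta>: "\<beta> l1 i = b i" if "i \<in> I" for i by (rule kktf_unique[OF I l1 gp kkt _ that])
  have supp: "b i \<noteq> 0 \<longleftrightarrow> i \<in> A0" for i using P[of l1 i] l1 by (auto simp: b_def)
  have ne: "A1 \<noteq> A0" using knot supp \<beta> by auto
  have ind1: "indepf n x A1" by (rule segment_indep[OF I gp l(1,2) A(2) seg1])
  have fitb: "fitf x I b k = fitf x A0 u0 k - l1 * fitf x A0 v0 k" for k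
  proof -
    have "fitf x I b = fitf x A0 b" by (rule fitf_mono_neutral[OF I A(1)]) (simp add: b_def)
    also have "\<dots> = fitf x A0 (\<lambda>i. u0 i - l1 * v0 i)" by (rule fitf_cong) (simp add: b_def)
    finally show ?thesis by (simp add: fitf_affine)
  qed
  define c where "c = (\<lambda>i s. s - dotf n (x i) (fitf x A0 v0))"
  \<comment> \<open>At the knot the residual correlation is a joining numerator plus l1 times the
    correlation with the sign direction. Solving for the penalty at which it equals s times that
    penalty gives \<open>g i s\<close>.\<close>
  have cor: "dotf n (x i) (\<lambda>k. y k - fitf x I b k) = dotf n (residf x A0 w i) y + l1 * dotf n (x i) (fitf x A0 v0)" if "i \<in> I" for i
    using residf_response[OF A(1) w u0 that] unfolding fitb by (simp only: dotf_diff dotf_scale)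
  have cpos: "0 < s * c i s" if "i \<in> I - A0" "s \<in> {-1, 1}" for i s
    using a[OF that(1)] that(2) by (auto simp: c_def abs_less_iff)
  have gle: "g i s \<le> l1" if i: "i \<in> I - A0" and s: "s \<in> {-1, 1}" for i s
  proof -
    have "\<bar>dotf n (x i) (\<lambda>k. y k - fitf x I b k)\<bar> \<le> l1" using \<open>kktf n x I y l1 b\<close> i by (simp add: kktf_def)
    then have "s * (dotf n (residf x A0 w i) y + l1 * dotf n (x i) (fitf x A0 v0)) \<le> l1"
      using i s by (auto simp: cor)
    moreover have "s * s = 1" using s by auto
    ultimately have le: "s * dotf n (residf x A0 w i) y \<le> l1 * (s * c i s)" by (simp add: c_def algebra_simps)
    have "g i s = (s * dotf n (residf x A0 w i) y) / (s * c i s)" using s by (auto simp: g_def c_def)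
    also have "\<dots> \<le> l1" by (rule iffD2[OF pos_divide_le_eq[OF cpos[OF i s]] le])
    finally show ?thesis .
  qed
  obtain u1 v1 where uv1: "\<And>i. i \<in> A1 \<Longrightarrow> dotf n (x i) (fitf x A1 u1) = dotf n (x i) y"
    "\<And>i. i \<in> A1 \<Longrightarrow> dotf n (x i) (fitf x A1 v1) = \<sigma>1 i"
  proof -
    \<comment> \<open>Solutions of the normal equations are read off the path itself:
      \<open>v\<close> is the negative slope between two points of the segment, and
      \<open>u1\<close> is the extrapolation to penalty 0.\<close>
    define m1 m2 where "m1 = (l2 + l1) / 2" and "m2 = (l2 + m1) / 2"
    have m: "l2 < m1" "m1 < l1" "l2 < m2" "m2 < l1" "m2 < m1"
    proof -
      show 1: "l2 < m1" "m1 < l1" using l by (auto simp: m1_def)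
      then show "l2 < m2" "m2 < m1" by (auto simp: m2_def)
      then show "m2 < l1" using 1 by simp
    qed
    define v where "v = (\<lambda>i. (\<beta> m2 i - \<beta> m1 i) / (m1 - m2))"
    have F: "dotf n (x i) (fitf x A1 (\<beta> m)) = dotf n (x i) y - m * \<sigma>1 i" if "l2 < m" "m < l1" "i \<in> A1" for m i
      using segment_correlation[OF I gp l(1,2) A(2) seg1 that] by (simp add: dotf_diff)
    have V: "dotf n (x i) (fitf x A1 v) = \<sigma>1 i" if "i \<in> A1" for i
    proof -
      have "fitf x A1 v = (\<lambda>k. (1 / (m1 - m2)) * (fitf x A1 (\<beta> m2) k - fitf x A1 (\<beta> m1) k))"
        by (simp add: fitf_def v_def fun_eq_iff sum_subtractf[symmetric] sum_divide_distrib diff_divide_distrib left_diff_distrib)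
      then have "dotf n (x i) (fitf x A1 v) = (1 / (m1 - m2)) * ((m1 - m2) * \<sigma>1 i)"
        using F[OF m(1,2) that] F[OF m(3,4) that] by (simp only: dotf_scale dotf_diff) (simp add: algebra_simps)
      then show ?thesis using m by simp
    qed
    have "dotf n (x i) (fitf x A1 (\<lambda>i. \<beta> m1 i - (- m1) * v i)) = dotf n (x i) y" if "i \<in> A1" for i
      unfolding fitf_affine dotf_diff dotf_scale F[OF m(1,2) that] V[OF that] by simp
    then show thesis using V that by blast
  qed
  have kb1: "kktf n x I y l1 (\<lambda>i. if i \<in> A1 then u1 i - l1 * v1 i else 0)"
    and sb1: "\<And>i. i \<in> A1 \<Longrightarrow> 0 \<le> \<sigma>1 i * (u1 i - l1 * v1 i)"
    by (rule segment_closed[OF I gp l(1,2) A(2) seg1 uv1]; use l in simp)+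
  have b1: "b i = (if i \<in> A1 then u1 i - l1 * v1 i else 0)" if "i \<in> I" for i
    by (rule kktf_unique[OF I l1 gp \<open>kktf n x I y l1 b\<close> kb1 that])
  \<comment> \<open>By uniqueness both affine formulas describe the solution at the knot, and there
    all coefficients in \<open>A0\<close> are nonzero.\<close>
  have sub: "A0 \<subseteq> A1"
  proof
    fix i assume "i \<in> A0"
    then show "i \<in> A1" using supp[of i] b1[of i] A by (auto split: if_splits)
  qed
  have s1: "\<sigma>1 i \<in> {-1, 1}" if "i \<in> A1" for i by (rule segment_sign[OF I gp l(1,2) A(2) seg1 that])
  have eqs: "\<sigma>1 i = \<sigma>0 i" if i: "i \<in> A0" for i
  proof -
    have "i \<in> I" "i \<in> A1" using i sub A by auto
    then have "u1 i - l1 * v1 i = u0 i - l1 * v0 i" using b1[of i] i by (simp add: b_def)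
    then have "0 \<le> \<sigma>1 i * (u0 i - l1 * v0 i)" using sb1[of i] i sub by auto
    moreover have "i \<in> A1" using i sub by auto
    ultimately show ?thesis using P[of l1 i] l1 i s0[OF i] s1[of i] by auto
  qed
  have hit: "g j (\<sigma>1 j) = l1" if j: "j \<in> A1 - A0" for j
  proof -
    have jI: "j \<in> I - A0" using j A by auto
    have "fitf x I b = fitf x A1 (\<lambda>i. u1 i - l1 * v1 i)"
    proof -
      have "fitf x I b = fitf x I (\<lambda>i. if i \<in> A1 then u1 i - l1 * v1 i else 0)" using b1 by (intro fitf_cong) auto
      also have "\<dots> = fitf x A1 (\<lambda>i. if i \<in> A1 then u1 i - l1 * v1 i else 0)" by (rule fitf_mono_neutral[OF I A(2)]) simp
      also have "\<dots> = fitf x A1 (\<lambda>i. u1 i - l1 * v1 i)" by (rule fitf_cong) simp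
      finally show ?thesis .
    qed
    then have "dotf n (x j) (\<lambda>k. y k - fitf x I b k) = l1 * \<sigma>1 j"
      using uv1[of j] j by (simp add: fitf_affine dotf_diff dotf_scale)
    then have "dotf n (residf x A0 w j) y = l1 * c j (\<sigma>1 j)"
      using cor[of j] jI by (simp add: c_def algebra_simps)
    moreover have "c j (\<sigma>1 j) \<noteq> 0" using cpos[OF jI s1[of j]] j by auto
    ultimately show ?thesis by (simp add: g_def c_def)
  qed
  obtain j where j: "j \<in> A1 - A0" using ne sub by auto
  have jI: "j \<in> I - A0" using j A by auto
  have A1: "A1 = insert j A0"
  proof -
    have "i = j" if "i \<in> A1 - A0" for i
    proof (rule ccontr)
      assume "i \<noteq> j"
      have "i \<in> I - A0" using that A by auto
      moreover have "\<sigma>1 i \<in> {-1, 1}" "\<sigma>1 j \<in> {-1, 1}" using s1 that j by blast+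
      ultimately have "g i (\<sigma>1 i) \<noteq> g j (\<sigma>1 j)" by (intro ties jI \<open>i \<noteq> j\<close>)
      then show False using hit[OF that] hit[OF j] by simp
    qed
    then show ?thesis using j sub by blast
  qed
  show thesis
  proof (rule that[OF jI A1 eqs])
    show "\<sigma>1 j \<in> {-1, 1}" using s1[of j] j by blast
    show "g j (\<sigma>1 j) = l1" by (rule hit[OF j])
    fix i s assume i: "i \<in> I - A0" and s: "s \<in> {-1, 1}" and ne: "(i, s) \<noteq> (j, \<sigma>1 j)"
    show "g i s < l1"
    proof (cases "i = j")
      case False
      have "g i s \<noteq> g j (\<sigma>1 j)" using ties[OF i jI False s, of "\<sigma>1 j"] s1[of j] j by blast
      then show ?thesis using gle[OF i s] hit[OF j] by simp
    next
      \<comment> \<open>The same variable with the opposite sign is not covered by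
        \<open>ties\<close>, but its joining value is negative: the numerator has the sign \<sigma>1
        j.\<close>
      case True
      have "s \<noteq> \<sigma>1 j" using ne True by simp
      moreover have "\<sigma>1 j = -1 \<or> \<sigma>1 j = 1" using s1[of j] j by blast
      moreover have "s = -1 \<or> s = 1" using s by blast
      ultimately have s': "s = - \<sigma>1 j" by auto
      have cp: "0 < \<sigma>1 j * c j (\<sigma>1 j)" using cpos[OF jI, of "\<sigma>1 j"] s1[of j] j by blast
      have "0 < s * c j s" by (rule cpos[OF jI s])
      have "c j (\<sigma>1 j) \<noteq> 0" using cp by auto
      moreover have "dotf n (residf x A0 w j) y / c j (\<sigma>1 j) = l1" using hit[OF j] by (simp only: g_def c_def)
      ultimately have "dotf n (residf x A0 w j) y = l1 * c j (\<sigma>1 j)" by (metis nonzero_divide_eq_eq)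
      then have "\<sigma>1 j * dotf n (residf x A0 w j) y = l1 * (\<sigma>1 j * c j (\<sigma>1 j))" by (simp only: mult.left_commute)
      then have "0 < \<sigma>1 j * dotf n (residf x A0 w j) y" using mult_pos_pos[OF l1 cp] by (simp only:)
      then have neg: "s * dotf n (residf x A0 w j) y < 0" unfolding s' by simp
      moreover have "g j s = (s * dotf n (residf x A0 w j) y) / (s * c j s)" using s by (auto simp: g_def c_def)
      moreover have "(s * dotf n (residf x A0 w j) y) / (s * c j s) < 0"
        by (rule divide_neg_pos[OF neg \<open>0 < s * c j s\<close>])
      ultimately have "g j s < 0" by (simp only:)
      then show ?thesis using True l1 by simp
    qed
  qed (use P in auto)
qed

section \<open>Knots and the event B\<close>

lemma knot_isolated:
  assumes "knot X y (Suc k) = ereal l1" "knot X y (Suc (Suc k)) = ereal l2" "0 \<le> l2" "l2 < l1"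
  shows "l1 \<in> knots X y"
proof -
  \<comment> \<open>\<open>knot\<close> is a supremum and could in principle be only a limit of
    knots. Some knot lies above the midpoint of l2 and l1; if it were below l1, it would be at most
    l2. So it is l1.\<close>
  define m where "m = (l2 + l1) / 2"
  have m: "l2 < m" "m < l1" "0 < m" using assms by (auto simp: m_def)
  have "ereal m < Sup (insert 0 {ereal l | l. l \<in> knots X y \<and> ereal l < knot X y k})"
    using assms(1) m by simp
  then obtain z where z: "z \<in> insert 0 {ereal l | l. l \<in> knots X y \<and> ereal l < knot X y k}" "ereal m < z"
    unfolding less_Sup_iff by blast
  then obtain l where l: "z = ereal l" "l \<in> knots X y" "ereal l < knot X y k" using m by (auto simp: zero_ereal_def)
  have "ereal l \<le> knot X y (Suc k)" unfolding knot.simps(2)[of X y k] using l by (intro Sup_upper) auto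
  then have "l \<le> l1" using assms(1) by simp
  moreover have "\<not> l < l1"
  proof
    assume "l < l1"
    then have "ereal l \<le> knot X y (Suc (Suc k))"
      unfolding knot.simps(2)[of X y "Suc k"] using l assms(1) by (intro Sup_upper) auto
    then show False using assms(2) z l m by simp
  qed
  ultimately show ?thesis using l by simp
qed

lemma knot_nonneg: "0 \<le> knot X y k"
  by (cases k) (auto intro: Sup_upper)

lemma knot_not_constant:
  assumes "l1 \<in> knots X y" "l2 < l1" "l1 < l0"
  shows "\<not> (\<forall>l. l2 < l \<and> l < l0 \<longrightarrow> supp (lasso X y l) = A)"
proof
  assume c: "\<forall>l. l2 < l \<and> l < l0 \<longrightarrow> supp (lasso X y l) = A"
  have "\<forall>\<^sub>F l' in at l1. l' \<in> {l2<..<l0}" using assms by (intro eventually_at_in_open') auto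
  then have "\<forall>\<^sub>F l' in at l1. supp (lasso X y l') = supp (lasso X y l1)"
    by eventually_elim (use c assms in auto)
  then show False using assms(1) unfolding knots_def by auto
qed

text \<open>The inverse of \<open>pick A\<close>; it turns a sign vector of dimension
  \<open>card A\<close> into a function on \<open>A\<close>.\<close>

definition card_below :: "nat set \<Rightarrow> nat \<Rightarrow> nat" where
  "card_below A i = card {b \<in> A. b < i}"

lemma pick_card_below: "i \<in> A \<Longrightarrow> pick A (card_below A i) = i"
  unfolding card_below_def by (rule pick_card_in_set)

lemma card_below_pick: "a < card A \<Longrightarrow> card_below A (pick A a) = a"
  unfolding card_below_def by (rule card_pick_le)

lemma card_below_less: "finite A \<Longrightarrow> i \<in> A \<Longrightarrow> card_below A i < card A"
  unfolding card_below_def by (intro psubset_card_mono) auto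

lemma at_step_segment:
  assumes X: "X \<in> carrier_mat n p" and y: "y \<in> carrier_vec n" and st: "at_step X y k A s"
    and l: "0 \<le> l1" "l1 < l0" "{l1<..<l0} \<subseteq> step_interval X y k"
  shows "A \<subseteq> {..<p}" "s \<in> carrier_vec (card A)"
    "lasso_segment n (colf X) {..<p} (($) y) (\<lambda>l i. lasso X y l $ i) A (\<lambda>i. s $ card_below A i) l1 l0"
proof -
  have S: "supp (lasso X y l) = A" "sign_vec (sub_vec (lasso X y l) A) = s" if "l1 < l" "l < l0" for l
    using st l that unfolding at_step_def by auto
  have d: "dim_vec (lasso X y l) = p" if "l1 < l" for l using lasso_kktf(1)[OF X y, of l] that l by auto
  define m where "m = (l1 + l0) / 2"
  have m: "l1 < m" "m < l0" using l by (auto simp: m_def)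
  show A: "A \<subseteq> {..<p}" using S(1)[OF m] d[OF m(1)] by (auto simp: supp_def)
  then have fin: "finite A" using finite_subset by auto
  show "s \<in> carrier_vec (card A)" using S(2)[OF m] by (auto simp: sign_vec_def sub_vec_def)
  show "lasso_segment n (colf X) {..<p} (($) y) (\<lambda>l i. lasso X y l $ i) A (\<lambda>i. s $ card_below A i) l1 l0"
    unfolding lasso_segment_def
  proof (intro allI impI conjI ballI)
    fix l assume ll: "l1 < l \<and> l < l0"
    then show "kktf n (colf X) {..<p} (($) y) l (($) (lasso X y l))" using lasso_kktf(2)[OF X y, of l] l by auto
    fix i
    show "(lasso X y l $ i \<noteq> 0) = (i \<in> A)" if "i \<in> {..<p}"
      using S(1)[of l] ll d[of l] that by (auto simp: supp_def)
    show "sgn (lasso X y l $ i) = s $ card_below A i" if "i \<in> A"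
      using S(2)[of l] ll card_below_less[OF fin that] pick_card_below[OF that] by (auto simp: sign_vec_def sub_vec_def)
  qed
qed

text \<open>\<open>at_step\<close> includes that the interval is nonempty, which makes the active
  set unique.\<close>

lemma at_step_active:
  assumes "at_step X y k A s"
  shows "step_active X y k = A"
  unfolding step_active_def
proof (rule the_equality)
  show "\<exists>s. at_step X y k A s" using assms by blast
  fix A' assume "\<exists>s. at_step X y k A' s"
  then show "A' = A" using assms unfolding at_step_def by blast
qed

text \<open>Translates B into two adjacent segments and a change of the active set at their common
  endpoint \<open>l1\<close>. Here \<open>l0\<close> is an arbitrary point of the interval at step
  k0.\<close>

lemma event_B_segments:
  assumes X: "X \<in> carrier_mat n p" and y: "y \<in> carrier_vec n" and B: "event_B X y k0 A0 s0"
  obtains A1 s1 l0 l1 l2 where "0 \<le> l2" "l2 < l1" "l1 < l0"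
    "A0 \<subseteq> {..<p}" "s0 \<in> carrier_vec (card A0)" "A1 \<subseteq> {..<p}" "s1 \<in> carrier_vec (card A1)"
    "lasso_segment n (colf X) {..<p} (($) y) (\<lambda>l i. lasso X y l $ i) A0 (\<lambda>i. s0 $ card_below A0 i) l1 l0"
    "lasso_segment n (colf X) {..<p} (($) y) (\<lambda>l i. lasso X y l $ i) A1 (\<lambda>i. s1 $ card_below A1 i) l2 l1"
    "\<not> (A1 = A0 \<and> (\<forall>i\<in>{..<p}. lasso X y l1 $ i \<noteq> 0 \<longleftrightarrow> i \<in> A0))"
    "l2 = knot_join X y A1 s1 (ereal l1)" "real_of_ereal (knot X y (k0 + 2)) = l2" "step_active X y k0 = A0"
    "sign_vec (pinv (sub_cols X A0) *\<^sub>v y) = s0"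
proof -
  obtain A1 s1 where st: "at_step X y k0 A0 s0" "at_step X y (k0 + 1) A1 s1"
    "knot X y (k0 + 2) = ereal (knot_join X y A1 s1 (knot X y (k0 + 1)))" "sign_vec (pinv (sub_cols X A0) *\<^sub>v y) = s0"
    using B unfolding event_B_def by blast
  define l2 where "l2 = knot_join X y A1 s1 (knot X y (k0 + 1))"
  have k2: "knot X y (k0 + 2) = ereal l2" using st(3) by (simp only: l2_def)
  have l2: "0 \<le> l2" using knot_nonneg[of X y "k0 + 2"] unfolding k2 by simp
  obtain l0 where l0: "knot X y (k0 + 1) < ereal l0" "ereal l0 < knot X y k0"
    using st(1) unfolding at_step_def step_interval_def by auto
  obtain m where m: "knot X y (k0 + 2) < ereal m" "ereal m < knot X y (k0 + 1)"
    using st(2) unfolding at_step_def step_interval_def by auto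
  \<comment> \<open>The knot between the two steps lies strictly between a value below
    \<open>l0\<close> and a value above \<open>m\<close>, hence is a real number.\<close>
  obtain l1 where k1: "knot X y (k0 + 1) = ereal l1"
  proof -
    have "\<exists>l. K = ereal l" if "K < ereal a" "ereal b < K" for K a b using that by (cases K) auto
    from this[OF l0(1) m(2)] show thesis using that by blast
  qed
  have l: "l2 < l1" "l1 < l0" using l0(1) m unfolding k1 k2 less_ereal.simps by linarith+
  have i0: "{l1<..<l0} \<subseteq> step_interval X y k0"
  proof
    fix l assume "l \<in> {l1<..<l0}"
    then have "ereal l < ereal l0" "ereal l1 < ereal l" by auto
    then show "l \<in> step_interval X y k0"
      unfolding step_interval_def k1 using less_trans[OF _ l0(2), of "ereal l"] by blast
  qed
  have i1: "{l2<..<l1} \<subseteq> step_interval X y (k0 + 1)"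
  proof
    fix l assume "l \<in> {l2<..<l1}"
    then have "ereal l < ereal l1" "ereal l2 < ereal l" by auto
    moreover have "knot X y (k0 + 1 + 1) = ereal l2" using k2 by (simp only: add.assoc one_add_one)
    ultimately show "l \<in> step_interval X y (k0 + 1)"
      unfolding step_interval_def k1 by simp
  qed
  note S0 = at_step_segment[OF X y st(1) _ l(2) i0] and S1 = at_step_segment[OF X y st(2) l2 l(1) i1]
  have l1: "0 \<le> l1" using l2 l by simp
  have "knot X y (Suc k0) = ereal l1" using k1 by (simp only: Suc_eq_plus1)
  moreover have "knot X y (Suc (Suc k0)) = ereal l2" using k2 by (simp only: Suc_eq_plus1 add.assoc one_add_one)
  ultimately have kn: "l1 \<in> knots X y" by (rule knot_isolated[OF _ _ l2 l(1)])
  have "\<not> (A1 = A0 \<and> (\<forall>i\<in>{..<p}. lasso X y l1 $ i \<noteq> 0 \<longleftrightarrow> i \<in> A0))"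
  proof
    assume *: "A1 = A0 \<and> (\<forall>i\<in>{..<p}. lasso X y l1 $ i \<noteq> 0 \<longleftrightarrow> i \<in> A0)"
    have "dim_vec (lasso X y l1) = p" using lasso_kktf(1)[OF X y, of l1] l2 l by auto
    then have "supp (lasso X y l1) = A0" using * S0(1)[OF l1] by (auto simp: supp_def)
    have "supp (lasso X y l) = A0" if "l2 < l" "l < l0" for l
    proof (cases l l1 rule: linorder_cases)
      case less
      then have "l \<in> step_interval X y (k0 + 1)" using i1 that by auto
      then have "supp (lasso X y l) = A1" using st(2) unfolding at_step_def by blast
      then show ?thesis using * by simp
    next
      case greater
      then have "l \<in> step_interval X y k0" using i0 that by auto
      then show ?thesis using st(1) unfolding at_step_def by blast
    qed (use \<open>supp (lasso X y l1) = A0\<close> in simp)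
    then have "\<forall>l. l2 < l \<and> l < l0 \<longrightarrow> supp (lasso X y l) = A0" by simp
    with knot_not_constant[OF kn l, of A0] show False by (rule notE)
  qed
  note nc = this
  have l2k: "l2 = knot_join X y A1 s1 (ereal l1)" unfolding l2_def k1 ..
  have rk: "real_of_ereal (knot X y (k0 + 2)) = l2" unfolding k2 by (rule real_of_ereal.simps(1))
  show thesis
    by (rule that[OF l2 l S0(1)[OF l1] S0(2)[OF l1] S1(1,2) S0(3)[OF l1] S1(3) nc l2k rk at_step_active[OF st(1)] st(4)])
qed

lemma event_B_indep:
  assumes X: "X \<in> carrier_mat n p" and gp: "general_position X" and y: "y \<in> carrier_vec n" and B: "event_B X y k0 A0 s0"
  shows "indepf n (colf X) A0"
proof -
  have gpf: "gpf n (colf X) {..<p}" using general_position_imp_gpf[OF X gp] by (simp add: colf_def[abs_def])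
  obtain A1 s1 l0 l1 l2 where l: "0 \<le> l2" "l2 < l1" "l1 < l0" "A0 \<subseteq> {..<p}"
    "lasso_segment n (colf X) {..<p} (($) y) (\<lambda>l i. lasso X y l $ i) A0 (\<lambda>i. s0 $ card_below A0 i) l1 l0"
    by (rule event_B_segments[OF X y B]) blast
  show ?thesis by (rule segment_indep[OF _ gpf _ l(3,4,5)]) (use l in auto)
qed

text \<open>The deterministic half of the argument. The two fits in the statistic differ by a
  multiple of r_j, which gives c^2 / R_jj times l1 (l1 - l2). Every \<open>h q q'\<close> with a
  positive signed denominator is at most l2, so replacing l2 by it can only enlarge this
  expression.\<close>

lemma event_B_cov_test:
  assumes X: "X \<in> carrier_mat n p" and gp: "general_position X" and y: "y \<in> carrier_vec n"
    and B: "event_B X y k0 A0 s0" and \<sigma>: "0 < \<sigma>"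
    and v0: "\<And>i. i \<in> A0 \<Longrightarrow> dotf n (colf X i) (fitf (colf X) A0 v0) = s0 $ card_below A0 i"
    and w: "\<And>i j. i \<in> A0 \<Longrightarrow> j < p \<Longrightarrow> dotf n (colf X i) (fitf (colf X) A0 (w j)) = dotf n (colf X i) (colf X j)"
    and a: "\<And>i. i \<in> {..<p} - A0 \<Longrightarrow> \<bar>dotf n (colf X i) (fitf (colf X) A0 v0)\<bar> < 1"
    and Rpos: "\<And>i. i \<in> {..<p} - A0 \<Longrightarrow> dotf n (r i) (r i) \<noteq> 0"
    and r: "r = residf (colf X) A0 w"
    and c: "c = (\<lambda>(i, s). s - dotf n (colf X i) (fitf (colf X) A0 v0))"
    and g: "g = (\<lambda>(i, s). dotf n (r i) (($) y) / c (i, s))"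
    and den: "den = (\<lambda>(j, s) (i, s'). c (i, s') - dotf n (r i) (r j) / dotf n (r j) (r j) * c (j, s))"
    and h: "h = (\<lambda>(j, s) (i, s'). (dotf n (r i) (($) y) - dotf n (r i) (r j) / dotf n (r j) (r j) * dotf n (r j) (($) y)) / den (j, s) (i, s'))"
    and Q: "Q = ({..<p} - A0) \<times> {-1, 1}"
    and ties: "\<And>i j s t. i \<in> {..<p} - A0 \<Longrightarrow> j \<in> {..<p} - A0 \<Longrightarrow> i \<noteq> j \<Longrightarrow> s \<in> {-1, 1} \<Longrightarrow> t \<in> {-1, 1} \<Longrightarrow> g (i, s) \<noteq> g (j, t)"
  shows "\<exists>q\<in>Q. (\<forall>q'\<in>Q - {q}. g q' < g q) \<and> (\<forall>q'\<in>Q - {q}. 0 < snd q' * den q q' \<longrightarrow>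
    cov_test X y \<sigma> (k0 + 1) * \<sigma>\<^sup>2 \<le> (c q)\<^sup>2 / dotf n (r (fst q)) (r (fst q)) * (g q * (g q - h q q')))"
proof -
  let ?x = "colf X" and ?I = "{..<p}"
  have gpf: "gpf n ?x ?I" using general_position_imp_gpf[OF X gp] by (simp add: colf_def[abs_def])
  obtain A1 s1 l0 l1 l2 where l: "0 \<le> l2" "l2 < l1" "l1 < l0" and A: "A0 \<subseteq> ?I" "A1 \<subseteq> ?I"
    and s: "s0 \<in> carrier_vec (card A0)" "s1 \<in> carrier_vec (card A1)"
    and seg0: "lasso_segment n ?x ?I (($) y) (\<lambda>l i. lasso X y l $ i) A0 (\<lambda>i. s0 $ card_below A0 i) l1 l0"
    and seg1: "lasso_segment n ?x ?I (($) y) (\<lambda>l i. lasso X y l $ i) A1 (\<lambda>i. s1 $ card_below A1 i) l2 l1"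
    and kn: "\<not> (A1 = A0 \<and> (\<forall>i\<in>?I. lasso X y l1 $ i \<noteq> 0 \<longleftrightarrow> i \<in> A0))"
    and kj: "l2 = knot_join X y A1 s1 (ereal l1)" "real_of_ereal (knot X y (k0 + 2)) = l2" "step_active X y k0 = A0"
    and sp: "sign_vec (pinv (sub_cols X A0) *\<^sub>v y) = s0"
    by (rule event_B_segments[OF X y B]) blast
  have fin: "finite ?I" "finite A0" "finite A1" using A finite_subset by auto
  have l1: "0 < l1" using l by simp
  have ind0: "indepf n ?x A0" by (rule event_B_indep[OF X gp y B])
  have ind1: "indepf n ?x A1" by (rule segment_indep[OF fin(1) gpf l(1,2) A(2) seg1])
  obtain u0 where u0: "\<And>i. i \<in> A0 \<Longrightarrow> dotf n (?x i) (fitf ?x A0 u0) = dotf n (?x i) (($) y)"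
    using normal_equations_solvable[OF X A(1) ind0, of "\<lambda>i. dotf n (?x i) (($) y)"] by blast
  obtain u1 where u1: "\<And>i. i \<in> A1 \<Longrightarrow> dotf n (?x i) (fitf ?x A1 u1) = dotf n (?x i) (($) y)"
    using normal_equations_solvable[OF X A(2) ind1, of "\<lambda>i. dotf n (?x i) (($) y)"] by blast
  obtain v1 where v1: "\<And>i. i \<in> A1 \<Longrightarrow> dotf n (?x i) (fitf ?x A1 v1) = s1 $ card_below A1 i"
    using normal_equations_solvable[OF X A(2) ind1, of "\<lambda>i. s1 $ card_below A1 i"] by blast
  have w': "dotf n (?x i) (fitf ?x A0 (w j)) = dotf n (?x i) (?x j)" if "i \<in> A0" "j \<in> ?I" for i j using w that by auto
  have pos: "sgn (u0 i) = s0 $ card_below A0 i" if i: "i \<in> A0" for i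
  proof -
    have "pinv (sub_cols X A0) *\<^sub>v y = vec (card A0) (\<lambda>a. u0 (pick A0 a))"
      by (rule pinv_mult_eq[OF X A(1) ind0 y]) (rule u0)
    then have "s0 = map_vec sgn (vec (card A0) (\<lambda>a. u0 (pick A0 a)))" using sp by (simp add: sign_vec_def)
    then show ?thesis using card_below_less[OF fin(2) i] pick_card_below[OF i] by simp
  qed
  have geq: "g (i, s) = dotf n (residf ?x A0 w i) (($) y) / (s - dotf n (?x i) (fitf ?x A0 v0))" for i s
    by (simp add: g c r)
  obtain j where j: "j \<in> ?I - A0" and A1: "A1 = insert j A0" and s10: "\<And>i. i \<in> A0 \<Longrightarrow> s1 $ card_below A1 i = s0 $ card_below A0 i"
    and sj: "s1 $ card_below A1 j \<in> {-1, 1}" and gj: "g (j, s1 $ card_below A1 j) = l1"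
    and gl: "\<And>i s. i \<in> ?I - A0 \<Longrightarrow> s \<in> {-1, 1} \<Longrightarrow> (i, s) \<noteq> (j, s1 $ card_below A1 j) \<Longrightarrow> g (i, s) < l1"
    and P: "\<And>m i. 0 \<le> m \<Longrightarrow> m \<le> l1 \<Longrightarrow> i \<in> A0 \<Longrightarrow> 0 < s0 $ card_below A0 i * (u0 i - m * v0 i)"
    by (rule lasso_knot_join[OF fin(1) gpf l A seg0 seg1 lasso_kktf(2)[OF X y l1] kn u0 v0 w' pos a ties[unfolded geq]])
      (simp_all add: geq)
  define sj where "sj = s1 $ card_below A1 j"
  define q where "q = (j, sj)"
  define Rj where "Rj = dotf n (r j) (r j)"
  have Rj: "Rj \<noteq> 0" using Rpos[OF j] by (simp add: Rj_def)
  have qQ: "q \<in> Q" using j sj by (simp add: q_def sj_def Q)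
  have gq: "g q = l1" using gj by (simp add: q_def sj_def)
  have cne: "c (i, s) \<noteq> 0" "0 < s * c (i, s)" if "i \<in> ?I - A0" "s \<in> {-1, 1}" for i s
    using a[OF that(1)] that(2) by (auto simp: c abs_less_iff)
  have rj: "dotf n (r j) (($) y) = c q * l1"
    using gq cne(1)[of j sj] j sj by (simp add: g q_def sj_def[symmetric] field_simps)
  have jI: "j \<in> ?I" "j \<notin> A0" using j by auto
  have b1: "\<And>i. i \<in> insert j A0 \<Longrightarrow> dotf n (?x i) (fitf ?x (insert j A0) u1) = dotf n (?x i) (($) y)"
    and b2: "\<And>i. i \<in> insert j A0 \<Longrightarrow> dotf n (?x i) (fitf ?x (insert j A0) v1) = s1 $ card_below A1 i"
    using u1 v1 unfolding A1 by auto
  have res: "dotf n (?x i) (\<lambda>k. y $ k - fitf ?x A0 u0 k) = dotf n (r i) (($) y)" if "i \<in> ?I" for i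
    unfolding r using residf_response[OF A(1) w' u0 that] by simp
  have fu: "fitf ?x A1 u1 k = fitf ?x A0 u0 k + c q * l1 / Rj * r j k" if "k < n" for k
  proof -
    have "fitf ?x (insert j A0) u1 k = fitf ?x A0 u0 k + (dotf n (?x j) (($) y) - dotf n (?x j) (fitf ?x A0 u0)) / dotf n (residf ?x A0 w j) (residf ?x A0 w j) * residf ?x A0 w j k"
      by (rule fitf_insert[OF A(1) w' fin(2) jI _ u0 b1 that]) (use Rj in \<open>simp_all add: Rj_def r\<close>)
    moreover have "dotf n (?x j) (($) y) - dotf n (?x j) (fitf ?x A0 u0) = c q * l1"
      using res[OF jI(1)] rj by (simp add: dotf_diff)
    ultimately show ?thesis by (simp add: A1 r Rj_def)
  qed
  have fv: "fitf ?x A1 v1 k = fitf ?x A0 v0 k + c q / Rj * r j k" if "k < n" for k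
  proof -
    have v0': "dotf n (?x i) (fitf ?x A0 v0) = s1 $ card_below A1 i" if "i \<in> A0" for i using v0 s10 that by simp
    have "fitf ?x (insert j A0) v1 k = fitf ?x A0 v0 k + (s1 $ card_below A1 j - dotf n (?x j) (fitf ?x A0 v0)) / dotf n (residf ?x A0 w j) (residf ?x A0 w j) * residf ?x A0 w j k"
      by (rule fitf_insert[OF A(1) w' fin(2) jI _ v0' b2 that]) (use Rj in \<open>simp_all add: Rj_def r\<close>)
    then show ?thesis by (simp add: A1 r Rj_def q_def sj_def c)
  qed
  have xr: "dotf n (?x i) (r j) = dotf n (r i) (r j)" if "i \<in> ?I" for i
    using residf_dotf[OF A(1) w' jI(1), of i] unfolding r by (simp add: dotf_commute)
  have hv: "hit_value X y A1 s1 i s = h q (i, s)" if i: "i \<in> ?I" "i \<notin> A1" for i s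
  proof -
    have v1': "dotf n (?x (pick A1 a)) (fitf ?x A1 v1) = s1 $ a" if "a < card A1" for a
      using v1[of "pick A1 a"] pick_in_set_le[OF that] card_below_pick[OF that] by simp
    have "hit_value X y A1 s1 i s = dotf n (?x i) (\<lambda>k. y $ k - fitf ?x A1 u1 k) / (s - dotf n (?x i) (fitf ?x A1 v1))"
      by (rule hit_value_eq[OF X A(2) ind1 y s(2) _ u1 v1']) (use i in auto)
    also have "dotf n (?x i) (\<lambda>k. y $ k - fitf ?x A1 u1 k) = dotf n (?x i) (\<lambda>k. (y $ k - fitf ?x A0 u0 k) - c q * l1 / Rj * r j k)"
      by (rule dotf_cong) (simp_all add: fu)
    also have "\<dots> = dotf n (r i) (($) y) - dotf n (r i) (r j) / Rj * dotf n (r j) (($) y)"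
      unfolding dotf_diff[of n _ "\<lambda>k. y $ k - fitf ?x A0 u0 k"] dotf_scale res[OF i(1)] xr[OF i(1)] rj by simp
    also have "dotf n (?x i) (fitf ?x A1 v1) = dotf n (?x i) (\<lambda>k. fitf ?x A0 v0 k + c q / Rj * r j k)"
      by (rule dotf_cong) (simp_all add: fv)
    also have "s - \<dots> = den q (i, s)"
      unfolding dotf_add dotf_scale xr[OF i(1)] by (simp add: den q_def c Rj_def)
    finally show ?thesis by (simp add: h q_def Rj_def)
  qed
  have cov: "cov_test X y \<sigma> (k0 + 1) * \<sigma>\<^sup>2 = (c q)\<^sup>2 / Rj * (l1 * (l1 - l2))"
  proof -
    \<comment> \<open>The segment formula at its left end \<open>l2\<close>, which may be 0.\<close>
    have "kktf n ?x ?I (($) y) l2 (\<lambda>i. if i \<in> A1 then u1 i - l2 * v1 i else 0)"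
      by (rule segment_closed(1)[OF fin(1) gpf l(1,2) A(2) seg1 u1 v1]) (use l in auto)
    from lasso_fit[OF X y l(1) this]
    have "X *\<^sub>v lasso X y l2 = vec n (fitf ?x A1 (\<lambda>i. u1 i - l2 * v1 i))"
      using fitf_mono_neutral[OF fin(1) A(2), of "\<lambda>i. if i \<in> A1 then u1 i - l2 * v1 i else 0" ?x]
        fitf_cong[of A1 "\<lambda>i. if i \<in> A1 then u1 i - l2 * v1 i else 0" "\<lambda>i. u1 i - l2 * v1 i" ?x] by simp
    \<comment> \<open>By \<open>P\<close> the coefficients on \<open>A0\<close> keep their signs
      down to \<open>l2\<close>, so the restricted lasso simply continues the old affine
      formula.\<close>
    moreover have "kktf n ?x A0 (($) y) l2 (\<lambda>i. u0 i - l2 * v0 i)"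
      unfolding kktf_def
    proof
      fix i assume i: "i \<in> A0"
      have cor: "dotf n (?x i) (\<lambda>k. y $ k - fitf ?x A0 (\<lambda>i. u0 i - l2 * v0 i) k) = l2 * s0 $ card_below A0 i"
        unfolding fitf_affine using u0[OF i] v0[OF i] by (simp add: dotf_diff dotf_scale)
      have s0i: "s0 $ card_below A0 i \<in> {-1, 1}" by (rule segment_sign[OF fin(1) gpf _ l(3) A(1) seg0 i]) (use l in simp)
      then have "sgn (u0 i - l2 * v0 i) = s0 $ card_below A0 i"
        using P[OF l(1) _ i] l by (auto simp: sgn_if)
      then show "\<bar>dotf n (?x i) (\<lambda>k. y $ k - fitf ?x A0 (\<lambda>i. u0 i - l2 * v0 i) k)\<bar> \<le> l2 \<and>
        (u0 i - l2 * v0 i \<noteq> 0 \<longrightarrow> dotf n (?x i) (\<lambda>k. y $ k - fitf ?x A0 (\<lambda>i. u0 i - l2 * v0 i) k) = l2 * sgn (u0 i - l2 * v0 i))"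
        unfolding cor using s0i l by (auto simp: abs_mult)
    qed
    from lasso_fit_sub_cols[OF X A(1) y l(1) this]
    have "sub_cols X A0 *\<^sub>v lasso (sub_cols X A0) y l2 = vec n (fitf ?x A0 (\<lambda>i. u0 i - l2 * v0 i))" .
    moreover have "y \<bullet> vec n f = dotf n (($) y) f" for f
      by (simp add: scalar_prod_def dotf_def atLeast0LessThan)
    moreover have "real_of_ereal (knot X y (k0 + 1 + 1)) = l2" using kj(2) by (simp only: add.assoc one_add_one)
    moreover have "step_active X y (k0 + 1 - 1) = A0" using kj(3) by (simp only: add_diff_cancel_right')
    ultimately have "cov_test X y \<sigma> (k0 + 1) = (dotf n (($) y) (fitf ?x A1 (\<lambda>i. u1 i - l2 * v1 i)) - dotf n (($) y) (fitf ?x A0 (\<lambda>i. u0 i - l2 * v0 i))) / \<sigma>\<^sup>2"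
      by (simp only: cov_test_def Let_def)
    also have "dotf n (($) y) (fitf ?x A1 (\<lambda>i. u1 i - l2 * v1 i)) - dotf n (($) y) (fitf ?x A0 (\<lambda>i. u0 i - l2 * v0 i))
      = dotf n (($) y) (\<lambda>k. fitf ?x A1 (\<lambda>i. u1 i - l2 * v1 i) k - fitf ?x A0 (\<lambda>i. u0 i - l2 * v0 i) k)"
      by (simp add: dotf_diff)
    also have "\<dots> = dotf n (($) y) (\<lambda>k. (c q * (l1 - l2) / Rj) * r j k)"
      by (rule dotf_cong) (simp_all add: fitf_affine fu fv algebra_simps diff_divide_distrib)
    also have "\<dots> = c q * (l1 - l2) / Rj * (c q * l1)"
      unfolding dotf_scale by (simp add: dotf_commute[of n "($) y"] rj)
    finally show ?thesis using \<sigma> by (simp add: power2_eq_square)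
  qed
  have fin2: "finite (({..<dim_col X} - A1) \<times> {-1, 1 :: real})" by simp
  have "\<forall>q'\<in>Q - {q}. g q' < g q"
  proof
    fix q' assume "q' \<in> Q - {q}"
    moreover obtain i s where "q' = (i, s)" by (cases q')
    ultimately have "g q' < l1" using gl[of i s] unfolding q_def sj_def Q by blast
    then show "g q' < g q" unfolding gq .
  qed
  moreover have "cov_test X y \<sigma> (k0 + 1) * \<sigma>\<^sup>2 \<le> (c q)\<^sup>2 / Rj * (g q * (g q - h q q'))"
    if q': "q' \<in> Q - {q}" and dp: "0 < snd q' * den q q'" for q'
  proof -
    obtain i s where qi: "q' = (i, s)" "i \<in> ?I - A0" "s \<in> {-1, 1}" using q' by (auto simp: Q)
    have "h q q' \<le> l2"
    proof (cases "i = j")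
      \<comment> \<open>For the variable that has just joined the numerator of \<open>h\<close>
        vanishes.\<close>
      case True
      then have "h q q' = 0" using Rj by (simp add: h q_def qi Rj_def)
      then show ?thesis using l by simp
    next
      case False
      have i1: "i \<in> ?I" "i \<notin> A1" using qi False by (auto simp: A1)
      have "g (i, s) < l1" using gl[OF qi(2,3)] False by auto
      moreover have ss: "s * s = 1" using qi by auto
      have "g (i, s) = (s * dotf n (r i) (($) y)) / (s * c (i, s))" using qi(3) by (auto simp: g)
      ultimately have "(s * dotf n (r i) (($) y)) / (s * c (i, s)) < l1" by (simp only:)
      then have lt: "s * dotf n (r i) (($) y) < l1 * (s * c (i, s))"
        by (rule iffD1[OF pos_divide_less_eq[OF cne(2)[OF qi(2,3)]]])
      \<comment> \<open>The inequality \<open>g (i, s) < l1\<close> in multiplied form, after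
        subtracting the same multiple of r_j y = c q * l1 on both sides. It says that the new
        joining value is below \<open>l1\<close>, so the indicator in \<open>knot_join\<close> is 1
        and the value takes part in the maximum.\<close>
      have lt': "s * (dotf n (r i) (($) y) - dotf n (r i) (r j) / Rj * dotf n (r j) (($) y)) < l1 * (s * den q (i, s))"
      proof -
        have "s * (a - \<rho> * (b * l1)) < l1 * (s * (d - \<rho> * b))" if "s * a < l1 * (s * d)" for a b d \<rho>
          using that by (simp add: algebra_simps)
        moreover have "den q (i, s) = c (i, s) - dotf n (r i) (r j) / Rj * c q" by (simp add: den q_def Rj_def)
        ultimately show ?thesis unfolding rj using lt by (simp only:)
      qed
      moreover have "h q (i, s) = (s * (dotf n (r i) (($) y) - dotf n (r i) (r j) / Rj * dotf n (r j) (($) y))) / (s * den q (i, s))"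
        using qi(3) by (auto simp: h q_def Rj_def)
      moreover have "0 < s * den q (i, s)" using dp by (simp add: qi)
      ultimately have hl: "h q (i, s) < l1" using iffD2[OF pos_divide_less_eq lt'] by (simp only:)
      have "hit_value X y A1 s1 i s * of_bool (ereal (hit_value X y A1 s1 i s) < ereal l1) \<le> knot_join X y A1 s1 (ereal l1)"
        unfolding knot_join_def using X i1 qi(3) by (intro Max_ge finite_imageI fin2) (force intro!: image_eqI[of _ _ "(i, s)"])
      then show ?thesis using hl kj(1) by (simp add: hv[OF i1] qi(1))
    qed
    then have "l1 * (l1 - l2) \<le> g q * (g q - h q q')" unfolding gq using l1 by (intro mult_left_mono) auto
    then show ?thesis unfolding cov Rj_def by (intro mult_left_mono divide_nonneg_nonneg dotf_nonneg) auto
  qed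
  ultimately have "(\<forall>q'\<in>Q - {q}. g q' < g q) \<and> (\<forall>q'\<in>Q - {q}. 0 < snd q' * den q q' \<longrightarrow>
    cov_test X y \<sigma> (k0 + 1) * \<sigma>\<^sup>2 \<le> (c q)\<^sup>2 / Rj * (g q * (g q - h q q')))" by blast
  moreover have "Rj = dotf n (r (fst q)) (r (fst q))" by (simp add: Rj_def q_def)
  ultimately show ?thesis using qQ by (intro bexI[of _ q]) (simp_all only:)
qed

section \<open>Tail bounds for the covariance test statistic\<close>

lemma residf_indep_insert:
  assumes A: "finite A" "A \<subseteq> I" "j \<in> I - A" and ind: "indepf n x A"
    and w: "\<And>i j. i \<in> A \<Longrightarrow> j \<in> I \<Longrightarrow> dotf n (x i) (fitf x A (w j)) = dotf n (x i) (x j)"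
    and R: "dotf n (residf x A w j) (residf x A w j) \<noteq> 0"
  shows "indepf n x (insert j A)"
  unfolding indepf_def
proof (intro allI impI)
  fix b assume b: "\<forall>k<n. fitf x (insert j A) b k = 0"
  have e: "fitf x (insert j A) b k = b j * x j k + fitf x A b k" for k using A by (simp add: fitf_def)
  have "dotf n (residf x A w j) (fitf x (insert j A) b) = 0" using b by (simp add: dotf_def)
  moreover have "fitf x (insert j A) b = (\<lambda>k. b j * x j k + fitf x A b k)" by (rule ext) (rule e)
  ultimately have "dotf n (residf x A w j) (\<lambda>k. b j * x j k + fitf x A b k) = 0" by (simp only:)
  then have "b j * dotf n (residf x A w j) (residf x A w j) = 0"
    using A residf_dotf[OF A(2) w, of j j] residf_orthogonal_fitf[OF A(2) w, of j b] by (simp add: dotf_add dotf_scale)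
  then have bj: "b j = 0" using R by simp
  then have "\<forall>k<n. fitf x A b k = 0" using b e by simp
  then have "\<forall>i\<in>A. b i = 0" using ind unfolding indepf_def by blast
  then show "\<forall>i\<in>insert j A. b i = 0" using bj by simp
qed

text \<open>If two joining values were the same linear functional of the noise, then r_i = \<kappa>
  r_j. This expresses s x_i through t x_j and the signed columns in \<open>A\<close>, and the
  coefficients sum to 1 exactly because \<kappa> is the quotient of the two denominators.\<close>

lemma gpf_no_ties:
  assumes gp: "gpf n x I" and I: "finite I" and A: "A \<subseteq> I" and ind: "indepf n x A"
    and w: "\<And>i j. i \<in> A \<Longrightarrow> j \<in> I \<Longrightarrow> dotf n (x i) (fitf x A (w j)) = dotf n (x i) (x j)"
    and v: "\<And>i. i \<in> A \<Longrightarrow> dotf n (x i) (fitf x A v) = \<sigma> i" "\<And>i. i \<in> A \<Longrightarrow> \<sigma> i \<in> {-1, 1}"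
    and ij: "i \<in> I - A" "j \<in> I - A" "i \<noteq> j" "s \<in> {-1, 1}" "t \<in> {-1, 1}"
    and R: "dotf n (residf x A w j) (residf x A w j) \<noteq> 0"
    and c: "s - dotf n (x i) (fitf x A v) \<noteq> 0" "t - dotf n (x j) (fitf x A v) \<noteq> 0"
  defines "d \<equiv> \<lambda>k. residf x A w i k / (s - dotf n (x i) (fitf x A v)) - residf x A w j k / (t - dotf n (x j) (fitf x A v))"
  shows "dotf n d d \<noteq> 0"
proof
  assume "dotf n d d = 0"
  then have d0: "d k = 0" if "k < n" for k using that by (simp add: dotf_eq_0_iff)
  have fin: "finite A" using A I finite_subset by auto
  define ci where "ci = s - dotf n (x i) (fitf x A v)"
  define cj where "cj = t - dotf n (x j) (fitf x A v)"
  define \<kappa> where "\<kappa> = ci / cj"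
  have c': "ci \<noteq> 0" "cj \<noteq> 0" using c by (simp_all add: ci_def cj_def)
  have r: "residf x A w i k = \<kappa> * residf x A w j k" if "k < n" for k
    using d0[OF that] c' unfolding d_def ci_def[symmetric] cj_def[symmetric] \<kappa>_def by (simp add: field_simps)
  have av: "dotf n (x l) (fitf x A v) = (\<Sum>m\<in>A. w l m * \<sigma> m)" if l: "l \<in> I" for l
  proof -
    have "dotf n (residf x A w l) (fitf x A v) = 0" by (rule residf_orthogonal_fitf[OF A w l])
    then have "dotf n (fitf x A v) (x l) = dotf n (fitf x A v) (fitf x A (w l))"
      unfolding residf_def[abs_def] by (simp add: dotf_commute[of n _ "fitf x A v"] dotf_diff)
    also have "\<dots> = (\<Sum>m\<in>A. w l m * \<sigma> m)" using v by (simp add: dotf_fitf dotf_commute[of n "fitf x A v"])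
    finally show ?thesis by (simp add: dotf_commute)
  qed
  define S where "S = (\<lambda>l. if l = i then s else if l = j then t else \<sigma> l)"
  \<comment> \<open>Read off from x_i = X_A w_i + \<kappa> (x_j - X_A w_j), multiplied by s, with
    the sign of each column factored out.\<close>
  define a where "a = (\<lambda>l. if l = j then s * \<kappa> * t else s * (w i l - \<kappa> * w j l) * \<sigma> l)"
  have ss: "s * s = 1" "t * t = 1" using ij by auto
  have F: "insert j A \<subseteq> I" "i \<in> I - insert j A" using ij A by auto
  have indF: "indepf n x (insert j A)" by (rule residf_indep_insert[OF fin A ij(2) ind w R])
  have S: "\<forall>l\<in>insert i (insert j A). S l \<in> {-1, 1}" using ij v(2) by (auto simp: S_def)
  have "(\<Sum>l\<in>insert j A. a l) = 1"
  proof -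
    have "(\<Sum>l\<in>insert j A. a l) = s * \<kappa> * t + (\<Sum>l\<in>A. s * (w i l - \<kappa> * w j l) * \<sigma> l)"
      using fin ij by (auto simp: a_def intro!: sum.cong)
    also have "(\<Sum>l\<in>A. s * (w i l - \<kappa> * w j l) * \<sigma> l) = s * ((\<Sum>l\<in>A. w i l * \<sigma> l) - \<kappa> * (\<Sum>l\<in>A. w j l * \<sigma> l))"
      by (simp add: sum_distrib_left sum_subtractf[symmetric] algebra_simps)
    also have "(\<Sum>l\<in>A. w i l * \<sigma> l) = s - ci" using av[of i] ij by (simp add: ci_def)
    also have "(\<Sum>l\<in>A. w j l * \<sigma> l) = t - cj" using av[of j] ij by (simp add: cj_def)
    also have "s * \<kappa> * t + s * (s - ci - \<kappa> * (t - cj)) = s * s + s * (\<kappa> * cj - ci)" by (simp add: algebra_simps)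
    also have "\<kappa> * cj = ci" using c' by (simp add: \<kappa>_def)
    finally show ?thesis using ss by simp
  qed
  moreover have "\<forall>k<n. S i * x i k = (\<Sum>l\<in>insert j A. a l * (S l * x l k))"
  proof (intro allI impI)
    fix k assume k: "k < n"
    have "(\<Sum>l\<in>insert j A. a l * (S l * x l k)) = a j * (S j * x j k) + (\<Sum>l\<in>A. a l * (S l * x l k))"
      using fin ij by simp
    also have "a j * (S j * x j k) = s * (\<kappa> * x j k)"
      using ij ss by (auto simp: a_def S_def)
    also have "(\<Sum>l\<in>A. a l * (S l * x l k)) = (\<Sum>l\<in>A. s * ((w i l - \<kappa> * w j l) * x l k))"
    proof (rule sum.cong[OF refl])
      fix l assume l: "l \<in> A"
      then have "l \<noteq> i" "l \<noteq> j" "\<sigma> l * \<sigma> l = 1" using ij v(2)[OF l] by auto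
      then have "a l * (S l * x l k) = s * (w i l - \<kappa> * w j l) * (\<sigma> l * \<sigma> l) * x l k" by (simp add: a_def S_def)
      then show "a l * (S l * x l k) = s * ((w i l - \<kappa> * w j l) * x l k)" using \<open>\<sigma> l * \<sigma> l = 1\<close> by simp
    qed
    also have "\<dots> = s * (fitf x A (w i) k - \<kappa> * fitf x A (w j) k)"
      by (simp add: fitf_affine[symmetric]) (simp add: fitf_def sum_distrib_left)
    also have "s * (\<kappa> * x j k) + \<dots> = s * (fitf x A (w i) k + \<kappa> * residf x A w j k)"
      by (simp add: residf_def algebra_simps)
    also have "\<dots> = s * x i k" unfolding r[OF k, symmetric] by (simp add: residf_def)
    finally show "S i * x i k = (\<Sum>l\<in>insert j A. a l * (S l * x l k))" by (simp add: S_def)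
  qed
  moreover have "insert j A \<subseteq> I \<and> i \<in> I - insert j A \<and> indepf n x (insert j A) \<and> (\<forall>l\<in>insert i (insert j A). S l \<in> {-1, 1})"
    using F indF S by blast
  ultimately show False using gp unfolding gpf_def by meson
qed

text \<open>The characterization of independence by the product law asks for a nonempty index set,
  whence \<open>0 < n\<close>.\<close>

lemma (in prob_space) distr_normal_vector:
  assumes "0 < n"
    and ind: "indep_vars (\<lambda>_. borel) \<epsilon> {..<n}"
    and nrm: "\<And>i. i < n \<Longrightarrow> distributed M lborel (\<epsilon> i) (normal_density 0 \<sigma>)"
  shows "distr M (Pi\<^sub>M {..<n} (\<lambda>_. borel)) (\<lambda>\<omega>. \<lambda>i\<in>{..<n}. \<epsilon> i \<omega>) = gauss n \<sigma>"
proof -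
  have rv: "\<And>i. i \<in> {..<n} \<Longrightarrow> random_variable borel (\<epsilon> i)" using ind unfolding indep_vars_def by auto
  have "distr M (Pi\<^sub>M {..<n} (\<lambda>_. borel)) (\<lambda>\<omega>. \<lambda>i\<in>{..<n}. \<epsilon> i \<omega>) = Pi\<^sub>M {..<n} (\<lambda>i. distr M borel (\<epsilon> i))"
    using indep_vars_iff_distr_eq_PiM'[of "{..<n}" \<epsilon> "\<lambda>_. borel"] rv ind assms(1) by auto
  also have "\<dots> = gauss n \<sigma>"
    unfolding gauss_def
  proof (rule PiM_cong[OF refl])
    fix i assume "i \<in> {..<n}"
    then have "distr M lborel (\<epsilon> i) = normal \<sigma>" using nrm[of i] by (simp add: distributed_def normal_def)
    then show "distr M borel (\<epsilon> i) = normal \<sigma>" by (metis distr_cong sets_lborel)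
  qed
  finally show ?thesis .
qed

lemma sum_abs_pinv_mult:
  assumes X: "X \<in> carrier_mat n p" and A: "A \<subseteq> {..<p}" and ind: "indepf n (colf X) A" and j: "j < p"
    and w: "\<And>i. i \<in> A \<Longrightarrow> dotf n (colf X i) (fitf (colf X) A w) = dotf n (colf X i) (colf X j)"
  shows "l1_norm (pinv (sub_cols X A) *\<^sub>v col X j) = (\<Sum>i\<in>A. \<bar>w i\<bar>)"
proof -
  have fin: "finite A" using A finite_subset by auto
  have cj: "col X j \<in> carrier_vec n" using X by (simp add: col_def)
  have "dotf n u (($) (col X j)) = dotf n u (colf X j)" for u
    using X j by (intro dotf_cong) (auto simp: colf_def)
  then have "pinv (sub_cols X A) *\<^sub>v col X j = vec (card A) (\<lambda>a. w (pick A a))"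
    by (intro pinv_mult_eq[OF X A ind cj]) (simp add: w)
  then show ?thesis using sum_pick[OF fin, of "\<lambda>i. \<bar>w i\<bar>"] by (simp add: l1_norm_def)
qed

text \<open>The bound in a fixed dimension. The set \<open>U\<close> stands in for an event whose
  measurability is not known. The outcome \<open>\<omega>0\<close> only witnesses that B is
  possible, from which the columns in \<open>A0\<close> are independent.\<close>

lemma cov_test_tail_bound:
  fixes M :: "'a measure" and X :: "real mat" and \<epsilon> :: "nat \<Rightarrow> 'a \<Rightarrow> real"
  assumes X: "X \<in> carrier_mat n p" and gp: "general_position X" and M: "prob_space M" and \<sigma>: "0 < \<sigma>"
    and ind: "prob_space.indep_vars M (\<lambda>_. borel) \<epsilon> {..<n}"
    and nrm: "\<And>i. i < n \<Longrightarrow> distributed M lborel (\<epsilon> i) (normal_density 0 \<sigma>)"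
    and \<beta>: "\<beta> \<in> carrier_vec p" and y: "\<And>\<omega>. y \<omega> = X *\<^sub>v \<beta> + vec n (\<lambda>i. \<epsilon> i \<omega>)"
    and A0: "A0 \<subseteq> {..<p}" and supp: "supp \<beta> \<subseteq> A0"
    and s0: "s0 \<in> carrier_vec (card A0)" "\<And>i. i < card A0 \<Longrightarrow> s0 $ i \<in> {-1, 1}"
    and B0: "event_B X (y \<omega>0) k0 A0 s0"
    and \<eta>: "0 < \<eta>" "\<eta> \<le> 1"
    and irrep: "\<And>j. j \<in> {..<p} - A0 \<Longrightarrow> l1_norm (pinv (sub_cols X A0) *\<^sub>v col X j) \<le> 1 - \<eta>"
    and R: "R = resid_gram X A0" and C: "0 < C"
    and R_nz: "\<And>j. j \<in> {..<p} - A0 \<Longrightarrow> R $$ (j, j) \<noteq> 0"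
    and R_diag: "\<And>i j. i \<in> {..<p} - A0 \<Longrightarrow> j \<in> {..<p} - A0 \<Longrightarrow> R $$ (i, i) / R $$ (j, j) \<le> C"
    and \<delta>: "0 < \<delta>"
    and S: "\<And>j. j \<in> {..<p} - A0 \<Longrightarrow> \<exists>S \<subseteq> {..<p} - (A0 \<union> {j}). D \<le> card S \<and> (\<forall>i\<in>S.
              invertible_mat (submatrix R (S - {i}) (S - {i})) \<and>
              schur_compl R (S - {i}) i / R $$ (i, i) \<ge> \<delta>\<^sup>2 \<and> \<bar>R $$ (i, j)\<bar> / R $$ (j, j) < \<eta> / (2 - \<eta>))"
    and D: "0 < D" and K: "1 \<le> K" and t: "0 \<le> t"
  shows "\<exists>U\<in>sets M. measure M U \<le> mills_factor K t + 4 * real p * (1 - upper_tail ((2 * K / \<eta> + 2) * sqrt C / \<delta>)) ^ D \<and>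
     (\<forall>\<omega>\<in>space M. event_B X (y \<omega>) k0 A0 s0 \<and> t < cov_test X (y \<omega>) \<sigma> (k0 + 1) \<longrightarrow> \<omega> \<in> U)"
proof -
  interpret prob_space M by (rule M)
  let ?x = "colf X" and ?I = "{..<p}"
  define J where "J = ?I - A0"
  define \<theta> where "\<theta> = 1 - upper_tail ((2 * K / \<eta> + 2) * sqrt C / \<delta>)"
  have \<theta>: "0 \<le> \<theta>" "\<theta> \<le> 1" using upper_tail_le_1 upper_tail_nonneg by (auto simp: \<theta>_def)
  have m0: "0 \<le> mills_factor K t" by (simp add: mills_factor_def)
  have fin: "finite A0" "finite J" using A0 finite_subset by (auto simp: J_def)
  have yc: "y \<omega> \<in> carrier_vec n" for \<omega> using X \<beta> by (simp add: y)
  have gpf: "gpf n ?x ?I" using general_position_imp_gpf[OF X gp] by (simp add: colf_def[abs_def])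
  have indep: "indepf n ?x A0" by (rule event_B_indep[OF X gp yc B0])
  obtain v0 where v0: "\<And>i. i \<in> A0 \<Longrightarrow> dotf n (?x i) (fitf ?x A0 v0) = s0 $ card_below A0 i"
    using normal_equations_solvable[OF X A0 indep, of "\<lambda>i. s0 $ card_below A0 i"] by blast
  have "\<forall>j. \<exists>u. \<forall>i\<in>A0. dotf n (?x i) (fitf ?x A0 u) = dotf n (?x i) (?x j)"
  proof
    fix j show "\<exists>u. \<forall>i\<in>A0. dotf n (?x i) (fitf ?x A0 u) = dotf n (?x i) (?x j)"
      by (rule normal_equations_solvable[OF X A0 indep])
  qed
  then obtain w where w: "\<And>i j. i \<in> A0 \<Longrightarrow> dotf n (?x i) (fitf ?x A0 (w j)) = dotf n (?x i) (?x j)" by metis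
  have w': "dotf n (?x i) (fitf ?x A0 (w j)) = dotf n (?x i) (?x j)" if "i \<in> A0" "j \<in> ?I" for i j by (rule w[OF that(1)])
  define r where "r = residf ?x A0 w"
  define Rf where "Rf = (\<lambda>i j. dotf n (r i) (r j))"
  have RR: "R $$ (i, j) = Rf i j" if "i < p" "j < p" for i j
  proof -
    have "R $$ (i, j) = dotf n (\<lambda>k. ?x i k - fitf ?x A0 (w i) k) (\<lambda>k. ?x j k - fitf ?x A0 (w j) k)"
      unfolding R by (rule resid_gram_index[OF X A0 indep _ that]) (rule w)
    also have "\<dots> = Rf i j" by (simp add: Rf_def r_def residf_def[abs_def])
    finally show ?thesis .
  qed
  have Rpos: "0 < Rf j j" if "j \<in> J" for j
    using R_nz[of j] RR[of j j] that dotf_nonneg[of n "r j"] by (auto simp: J_def Rf_def less_le)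
  have s0': "s0 $ card_below A0 i \<in> {-1, 1}" if "i \<in> A0" for i
    using s0(2) card_below_less[OF fin(1) that] by auto
  \<comment> \<open>The correlation with the sign direction is a sum of signs weighted by the
    regression coefficients of x_i, so the irrepresentability bound on their absolute sum applies.
    It keeps all signed denominators between \<eta> and 2 - \<eta>.\<close>
  have a: "\<bar>dotf n (?x i) (fitf ?x A0 v0)\<bar> \<le> 1 - \<eta>" if i: "i \<in> J" for i
  proof -
    have ii: "i \<in> ?I" using i by (simp add: J_def)
    have "dotf n (residf ?x A0 w i) (fitf ?x A0 v0) = 0" by (rule residf_orthogonal_fitf[OF A0 w' ii])
    then have "dotf n (fitf ?x A0 v0) (?x i) = dotf n (fitf ?x A0 v0) (fitf ?x A0 (w i))"
      unfolding residf_def[abs_def] by (simp add: dotf_commute[of n _ "fitf ?x A0 v0"] dotf_diff)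
    also have "\<dots> = (\<Sum>m\<in>A0. w i m * s0 $ card_below A0 m)" using v0 by (simp add: dotf_fitf dotf_commute[of n "fitf ?x A0 v0"])
    finally have "\<bar>dotf n (?x i) (fitf ?x A0 v0)\<bar> = \<bar>\<Sum>m\<in>A0. w i m * s0 $ card_below A0 m\<bar>" by (simp add: dotf_commute)
    also have "\<dots> \<le> (\<Sum>m\<in>A0. \<bar>w i m * s0 $ card_below A0 m\<bar>)" by (rule sum_abs)
    also have "\<dots> = (\<Sum>m\<in>A0. \<bar>w i m\<bar>)"
    proof (rule sum.cong[OF refl])
      fix m assume "m \<in> A0"
      then show "\<bar>w i m * s0 $ card_below A0 m\<bar> = \<bar>w i m\<bar>" using s0'[of m] by (auto simp: abs_mult)
    qed
    also have "\<dots> = l1_norm (pinv (sub_cols X A0) *\<^sub>v col X i)"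
      using sum_abs_pinv_mult[OF X A0 indep, of i "w i"] w ii by simp
    also have "\<dots> \<le> 1 - \<eta>" using irrep i by (simp add: J_def)
    finally show ?thesis .
  qed
  define c where "c = (\<lambda>(i, s). s - dotf n (?x i) (fitf ?x A0 v0))"
  have c: "\<eta> \<le> s * c (i, s) \<and> s * c (i, s) \<le> 2 - \<eta>" if "i \<in> J" "s \<in> {-1, 1}" for i s
    using a[OF that(1)] that(2) by (auto simp: c_def abs_le_iff)
  have cne: "c (i, s) \<noteq> 0" if "i \<in> J" "s \<in> {-1, 1}" for i s using c[OF that] \<eta> by auto
  define Q where "Q = J \<times> {-1, 1 :: real}"
  define g where "g = (\<lambda>(i, s) e. dotf n (r i) e / c (i, s))"
  define den where "den = (\<lambda>(j, s) (i, s'). c (i, s') - Rf i j / Rf j j * c (j, s))"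
  define h where "h = (\<lambda>(j, s) (i, s') e. (dotf n (r i) e - Rf i j / Rf j j * dotf n (r j) e) / den (j, s) (i, s'))"
  define G where "G = gauss n \<sigma>"
  define V where "V = {e \<in> space G. \<exists>q\<in>Q. (\<forall>q'\<in>Q - {q}. g q' e < g q e) \<and>
      (\<forall>q'\<in>Q - {q}. 0 < snd q' * den q q' \<longrightarrow> t * \<sigma>\<^sup>2 < (c q)\<^sup>2 / Rf (fst q) (fst q) * (g q e * (g q e - h q q' e)))}"
  define T where "T = {((i, s), (j, s')). i \<in> J \<and> j \<in> J \<and> i \<noteq> j \<and> s \<in> {-1, 1 :: real} \<and> s' \<in> {-1, 1 :: real}}"
  \<comment> \<open>Ties between different variables; a null set by
    \<open>gpf_no_ties\<close>.\<close>
  define N where "N = (\<Union>(q, q')\<in>T. {e \<in> space G. g q e = g q' e})"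
  have finT: "finite T" by (rule finite_subset[of _ "(J \<times> {-1,1}) \<times> (J \<times> {-1,1})"]) (use fin in \<open>auto simp: T_def\<close>)
  interpret G: prob_space G unfolding G_def by (rule prob_space_gauss[OF \<sigma>])
  have sG[measurable_cong]: "sets G = sets (Pi\<^sub>M {..<n} (\<lambda>_. borel))" by (simp add: G_def sets_gauss)
  have gm[measurable]: "g q \<in> borel_measurable G" for q unfolding g_def by (cases q) simp
  have hm[measurable]: "h q q' \<in> borel_measurable G" for q q' unfolding h_def by (cases q; cases q') simp
  have finQ: "finite Q" "finite (Q - {q})" for q using fin by (auto simp: Q_def)
  have Vm: "V \<in> sets G"
    unfolding V_def
    by (intro sets.sets_Collect_finite_Ex sets.sets_Collect_conj sets.sets_Collect_finite_All sets.sets_Collect_imp sets.sets_Collect_const finQ borel_measurable_less gm hm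
       borel_measurable_const borel_measurable_times borel_measurable_diff)
  have "emeasure G {e \<in> space G. g q e = g q' e} = 0" if "(q, q') \<in> T" for q q'
  proof -
    obtain i s j s' where q: "q = (i, s)" "q' = (j, s')" "i \<in> J" "j \<in> J" "i \<noteq> j" "s \<in> {-1, 1}" "s' \<in> {-1, 1}"
      using \<open>(q, q') \<in> T\<close> by (auto simp: T_def)
    define d where "d = (\<lambda>k. r i k / c q - r j k / c q')"
    have "dotf n d d \<noteq> 0"
      unfolding d_def q(1,2) c_def prod.case r_def
    proof (rule gpf_no_ties[OF gpf _ A0 indep w' v0 s0'])
      show "i \<in> ?I - A0" "j \<in> ?I - A0" "i \<noteq> j" "s \<in> {-1, 1}" "s' \<in> {-1, 1}" using q by (auto simp: J_def)
      show "dotf n (residf ?x A0 w j) (residf ?x A0 w j) \<noteq> 0" using Rpos[OF q(4)] by (simp add: Rf_def r_def)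
      show "s - dotf n (?x i) (fitf ?x A0 v0) \<noteq> 0" "s' - dotf n (?x j) (fitf ?x A0 v0) \<noteq> 0"
        using cne[OF q(3,6)] cne[OF q(4,7)] by (simp_all add: c_def)
    qed simp_all
    moreover have "{e \<in> space G. g q e = g q' e} = {e \<in> space G. dotf n d e = 0}"
    proof -
      have "dotf n d e = g q e - g q' e" for e
        by (simp add: d_def g_def q(1,2) dotf_def sum_subtractf[symmetric] sum_divide_distrib left_diff_distrib)
      then show ?thesis by auto
    qed
    ultimately show ?thesis using gauss_null_hyperplane[OF \<sigma>, of n d] by (simp add: G_def)
  qed
  then have "N \<in> null_sets G" unfolding N_def
    using finT by (intro null_sets_UN' countable_finite) (auto intro!: null_setsI)
  then have Nm: "N \<in> sets G" "measure G N = 0" by (auto simp: measure_def)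
  have bound: "measure G V \<le> mills_factor K t + 4 * real (card J) * \<theta> ^ D"
    unfolding V_def G_def \<theta>_def Q_def g_def h_def den_def
  proof (rule knot_gap_tail[OF \<sigma> fin(2) \<eta> C \<delta> K t])
    show "Rf i j = dotf n (r i) (r j)" for i j by (simp add: Rf_def)
    show "0 < Rf j j" if "j \<in> J" for j by (rule Rpos[OF that])
    show "Rf i i \<le> C * Rf j j" if "i \<in> J" "j \<in> J" for i j
      using R_diag[of i j] that RR[of i i] RR[of j j] Rpos[OF that(2)] by (simp add: J_def pos_divide_le_eq)
    show "\<eta> \<le> s * c (j, s) \<and> s * c (j, s) \<le> 2 - \<eta>" if "j \<in> J" "s \<in> {-1, 1}" for j s by (rule c[OF that])
    show "0 < D" by (rule D)
    fix j assume j: "j \<in> J"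
    note assms_S = S
    obtain S where S: "S \<subseteq> ?I - (A0 \<union> {j})" "D \<le> card S" "\<And>i. i \<in> S \<Longrightarrow> invertible_mat (submatrix R (S - {i}) (S - {i}))"
      "\<And>i. i \<in> S \<Longrightarrow> schur_compl R (S - {i}) i / R $$ (i, i) \<ge> \<delta>\<^sup>2" "\<And>i. i \<in> S \<Longrightarrow> \<bar>R $$ (i, j)\<bar> / R $$ (j, j) < \<eta> / (2 - \<eta>)"
    proof -
      from j have "j \<in> ?I - A0" by (simp add: J_def)
      from assms_S[OF this] obtain S where "S \<subseteq> {..<p} - (A0 \<union> {j})" "D \<le> card S" "\<forall>i\<in>S.
              invertible_mat (submatrix R (S - {i}) (S - {i})) \<and>
              schur_compl R (S - {i}) i / R $$ (i, i) \<ge> \<delta>\<^sup>2 \<and> \<bar>R $$ (i, j)\<bar> / R $$ (j, j) < \<eta> / (2 - \<eta>)" by blast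
      then show thesis by (intro that[of S]) blast+
    qed
    have SJ: "S \<subseteq> J - {j}" using S(1) by (auto simp: J_def)
    show "\<exists>S\<subseteq>J - {j}. D \<le> card S \<and> (\<forall>i\<in>S. \<bar>Rf i j\<bar> < \<eta> / (2 - \<eta>) * Rf j j \<and>
      (\<exists>w. (\<forall>l\<in>S - {i}. dotf n (r l) w = 0) \<and> dotf n (r i) w = dotf n w w \<and> \<delta>\<^sup>2 * Rf i i \<le> dotf n w w))"
    proof (rule exI[of _ S], intro conjI ballI SJ S(2))
      fix i assume i: "i \<in> S"
      then have iJ: "i \<in> J" "i < p" "j < p" using SJ j by (auto simp: J_def)
      show "\<bar>Rf i j\<bar> < \<eta> / (2 - \<eta>) * Rf j j"
        using S(5)[OF i] RR[OF iJ(2,3)] RR[OF iJ(3,3)] Rpos[OF j] by (simp only: pos_divide_less_eq)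
      have Rc: "R \<in> carrier_mat p p" unfolding R resid_gram_def using X resid_proj_carrier[OF X A0 indep] by auto
      have "\<exists>w. (\<forall>l\<in>S - {i}. dotf n (r l) w = 0) \<and> dotf n (r i) w = dotf n w w \<and> schur_compl R (S - {i}) i = dotf n w w"
      proof (rule schur_compl_residual[OF Rc])
        show "J \<subseteq> ?I" by (auto simp: J_def)
        show "R $$ (i, j) = dotf n (r i) (r j)" if "i \<in> J" "j \<in> J" for i j
          using RR[of i j] that by (simp add: J_def Rf_def)
        show "S - {i} \<subseteq> J" using SJ by auto
      qed (use S(3) i iJ in auto)
      then obtain w where w: "\<forall>l\<in>S - {i}. dotf n (r l) w = 0" "dotf n (r i) w = dotf n w w" "schur_compl R (S - {i}) i = dotf n w w" by blast
      have "\<delta>\<^sup>2 * Rf i i \<le> dotf n w w"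
        using S(4)[OF i] RR[OF iJ(2,2)] Rpos[OF iJ(1)] w(3) by (simp only: pos_le_divide_eq)
      then show "\<exists>w. (\<forall>l\<in>S - {i}. dotf n (r l) w = 0) \<and> dotf n (r i) w = dotf n w w \<and> \<delta>\<^sup>2 * Rf i i \<le> dotf n w w"
        using w by blast
    qed
  qed
  have key: "restrict (\<lambda>i. \<epsilon> i \<omega>) {..<n} \<in> V \<union> N"
    if B: "event_B X (y \<omega>) k0 A0 s0" and T: "t < cov_test X (y \<omega>) \<sigma> (k0 + 1)" for \<omega>
  proof (cases "restrict (\<lambda>i. \<epsilon> i \<omega>) {..<n} \<in> N")
    case False
    define e where "e = restrict (\<lambda>i. \<epsilon> i \<omega>) {..<n}"
    have eG: "e \<in> space G" by (simp add: e_def G_def space_gauss)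
    \<comment> \<open>The signal lies in the span of the columns in \<open>A0\<close>, so the
      residuals see only the noise.\<close>
    have ry: "dotf n (r i) (($) (y \<omega>)) = dotf n (r i) e" if "i \<in> J" for i
    proof -
      have ii: "i \<in> ?I" using that by (simp add: J_def)
      have f: "fitf ?x ?I (($) \<beta>) = fitf ?x A0 (($) \<beta>)"
        using supp \<beta> A0 by (intro fitf_mono_neutral) (auto simp: supp_def)
      have "dotf n (r i) (($) (y \<omega>)) = dotf n (r i) (\<lambda>k. fitf ?x A0 (($) \<beta>) k + e k)"
        unfolding y mult_mat_vec_fitf[OF X \<beta>] f by (rule dotf_cong) (simp_all add: e_def)
      also have "\<dots> = dotf n (r i) e"
      proof -
        have "dotf n (r i) (fitf ?x A0 (($) \<beta>)) = 0"
          unfolding r_def by (rule residf_orthogonal_fitf[OF A0 w' ii])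
        then show ?thesis by (simp add: dotf_add)
      qed
      finally show ?thesis .
    qed
    have gy: "g (i, s) (($) (y \<omega>)) = g (i, s) e" if "i \<in> J" for i s using ry[OF that] by (simp add: g_def)
    have hy: "h (j, s) (i, s') (($) (y \<omega>)) = h (j, s) (i, s') e" if "i \<in> J" "j \<in> J" for i j s s'
      using ry[OF that(1)] ry[OF that(2)] by (simp add: h_def)
    have "\<exists>q\<in>Q. (\<forall>q'\<in>Q - {q}. g q' (($) (y \<omega>)) < g q (($) (y \<omega>))) \<and> (\<forall>q'\<in>Q - {q}. 0 < snd q' * den q q' \<longrightarrow>
      cov_test X (y \<omega>) \<sigma> (k0 + 1) * \<sigma>\<^sup>2 \<le> (c q)\<^sup>2 / dotf n (r (fst q)) (r (fst q)) * (g q (($) (y \<omega>)) * (g q (($) (y \<omega>)) - h q q' (($) (y \<omega>)))))"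
    proof (rule event_B_cov_test[OF X gp yc B \<sigma> v0 w _ _ r_def c_def])
      show "\<bar>dotf n (?x i) (fitf ?x A0 v0)\<bar> < 1" if "i \<in> ?I - A0" for i
        using a[of i] that \<eta> by (simp add: J_def)
      show "dotf n (r i) (r i) \<noteq> 0" if "i \<in> ?I - A0" for i using Rpos[of i] that by (simp add: J_def Rf_def)
      show "(\<lambda>q. g q (($) (y \<omega>))) = (\<lambda>(i, s). dotf n (r i) (($) (y \<omega>)) / c (i, s))" by (auto simp: g_def)
      show "den = (\<lambda>(j, s) (i, s'). c (i, s') - dotf n (r i) (r j) / dotf n (r j) (r j) * c (j, s))"
        unfolding den_def Rf_def ..
      show "(\<lambda>q q'. h q q' (($) (y \<omega>))) = (\<lambda>(j, s) (i, s'). (dotf n (r i) (($) (y \<omega>)) - dotf n (r i) (r j) / dotf n (r j) (r j) * dotf n (r j) (($) (y \<omega>))) / den (j, s) (i, s'))"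
        by (auto simp: h_def Rf_def fun_eq_iff)
      show "Q = ({..<p} - A0) \<times> {-1, 1}" by (simp add: Q_def J_def)
      show "g (i, s) (($) (y \<omega>)) \<noteq> g (j, s') (($) (y \<omega>))" if ij: "i \<in> ?I - A0" "j \<in> ?I - A0" "i \<noteq> j" "s \<in> {-1, 1}" "s' \<in> {-1, 1}" for i j s s'
      proof -
        have iJ: "i \<in> J" "j \<in> J" using ij by (auto simp: J_def)
        have "((i, s), (j, s')) \<in> T" using ij iJ by (simp add: T_def)
        then have "g (i, s) e \<noteq> g (j, s') e" using False eG unfolding N_def e_def[symmetric] by blast
        then show ?thesis unfolding gy[OF iJ(1)] gy[OF iJ(2)] .
      qed
    qed
    then obtain q where q: "q \<in> Q" "\<And>q'. q' \<in> Q - {q} \<Longrightarrow> g q' (($) (y \<omega>)) < g q (($) (y \<omega>))"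
      "\<And>q'. q' \<in> Q - {q} \<Longrightarrow> 0 < snd q' * den q q' \<Longrightarrow>
        cov_test X (y \<omega>) \<sigma> (k0 + 1) * \<sigma>\<^sup>2 \<le> (c q)\<^sup>2 / Rf (fst q) (fst q) * (g q (($) (y \<omega>)) * (g q (($) (y \<omega>)) - h q q' (($) (y \<omega>))))"
      unfolding Rf_def by blast
    have gQ: "g q (($) (y \<omega>)) = g q e" if "q \<in> Q" for q using that gy by (auto simp: Q_def)
    have hQ: "h q q' (($) (y \<omega>)) = h q q' e" if "q \<in> Q" "q' \<in> Q" for q q' using that hy by (auto simp: Q_def)
    have tT: "t * \<sigma>\<^sup>2 < cov_test X (y \<omega>) \<sigma> (k0 + 1) * \<sigma>\<^sup>2" using T \<sigma> by simp
    have "e \<in> V" unfolding V_def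
    proof (intro CollectI conjI eG bexI[OF _ q(1)] ballI impI)
      fix q' assume q': "q' \<in> Q - {q}"
      then have q'Q: "q' \<in> Q" by simp
      show "g q' e < g q e" using q(2)[OF q'] unfolding gQ[OF q'Q] gQ[OF q(1)] .
      assume dq: "0 < snd q' * den q q'"
      from less_le_trans[OF tT q(3)[OF q' dq]]
      show "t * \<sigma>\<^sup>2 < (c q)\<^sup>2 / Rf (fst q) (fst q) * (g q e * (g q e - h q q' e))"
        unfolding gQ[OF q(1)] hQ[OF q(1) q'Q] .
    qed
    then show ?thesis by (simp add: e_def)
  qed simp
  \<comment> \<open>Without inactive variables the event is impossible. Otherwise some residual is
    nonzero, hence \<open>0 < n\<close>.\<close>
  show ?thesis
  proof (cases "J = {}")
    case True
    then have "V = {}" "N = {}" by (auto simp: V_def Q_def N_def T_def)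
    then show ?thesis using key m0 \<theta> by (intro bexI[of _ "{}"]) (auto simp: \<theta>_def[symmetric])
  next
    case False
    then obtain j where "j \<in> J" by auto
    have "0 < n"
    proof (rule ccontr)
      assume "\<not> 0 < n"
      then have "Rf j j = 0" by (simp add: Rf_def dotf_def)
      then show False using Rpos[OF \<open>j \<in> J\<close>] by simp
    qed
    define e where "e = (\<lambda>\<omega>. restrict (\<lambda>i. \<epsilon> i \<omega>) {..<n})"
    have law: "distr M (Pi\<^sub>M {..<n} (\<lambda>_. borel)) e = G"
      unfolding e_def G_def by (rule distr_normal_vector[OF \<open>0 < n\<close> ind nrm])
    have em: "e \<in> measurable M (Pi\<^sub>M {..<n} (\<lambda>_. borel))"
      unfolding e_def using ind by (intro measurable_restrict) (auto simp: indep_vars_def)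
    have VN: "V \<union> N \<in> sets (Pi\<^sub>M {..<n} (\<lambda>_. borel))" using Vm Nm sG by auto
    have "measure M (e -` (V \<union> N) \<inter> space M) = measure G (V \<union> N)"
      unfolding law[symmetric] by (rule measure_distr[OF em VN, symmetric])
    also have "\<dots> \<le> measure G V + measure G N" using Vm Nm by (intro measure_Un_le) auto
    also have "\<dots> \<le> mills_factor K t + 4 * real (card J) * \<theta> ^ D" using bound Nm by simp
    also have "\<dots> \<le> mills_factor K t + 4 * real p * \<theta> ^ D"
      using \<theta> card_mono[of ?I J] by (intro add_left_mono mult_right_mono mult_left_mono) (auto simp: J_def)
    finally have "measure M (e -` (V \<union> N) \<inter> space M) \<le> mills_factor K t + 4 * real p * \<theta> ^ D" .
    moreover have "e -` (V \<union> N) \<inter> space M \<in> sets M" by (rule measurable_sets[OF em VN])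
    ultimately show ?thesis using key unfolding e_def \<theta>_def[symmetric] by (intro bexI[of _ "e -` (V \<union> N) \<inter> space M"]) (auto simp: e_def)
  qed
qed

section \<open>Passage to the limit\<close>

lemma power_decay_bound:
  assumes \<theta>: "0 \<le> \<theta>" "\<theta> < 1" and d: "filterlim (\<lambda>p. d p / ln (real p)) at_top sequentially"
  shows "(\<lambda>p. real p * \<theta> ^ nat \<lceil>d p\<rceil>) \<longlonglongrightarrow> 0"
proof (rule tendsto_sandwich[where f="\<lambda>_. 0" and h="\<lambda>p. 1 / real p"])
  \<comment> \<open>\<theta>^d \<le> exp (- v d), and eventually d \<ge> (2 / v) ln p; so the power
    is at most 1 / p^2, which beats the factor p.\<close>
  define v where "v = 1 - \<theta>"
  have v: "0 < v" "v \<le> 1" using \<theta> by (auto simp: v_def)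
  have "\<forall>\<^sub>F p in sequentially. 2 / v \<le> d p / ln (real p)" using d by (simp add: filterlim_at_top)
  then show "\<forall>\<^sub>F p in sequentially. real p * \<theta> ^ nat \<lceil>d p\<rceil> \<le> 1 / real p"
    using eventually_gt_at_top[of 1]
  proof eventually_elim
    case (elim p)
    have l: "0 < ln (real p)" using elim by simp
    have "2 / v * ln (real p) \<le> d p" using elim(1) l by (simp add: pos_le_divide_eq)
    then have d2: "2 * ln (real p) \<le> v * d p" using v by (simp add: field_simps)
    have dn: "d p \<le> real (nat \<lceil>d p\<rceil>)" by linarith
    have "\<theta> \<le> exp (- v)" using exp_ge_add_one_self[of "- v"] by (simp add: v_def)
    then have "\<theta> ^ nat \<lceil>d p\<rceil> \<le> exp (- v) ^ nat \<lceil>d p\<rceil>" using \<theta> by (intro power_mono)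
    also have "\<dots> = exp (- (v * real (nat \<lceil>d p\<rceil>)))" by (simp add: exp_of_nat_mult[symmetric] mult.commute)
    also have "\<dots> \<le> exp (- (2 * ln (real p)))"
    proof -
      have "v * d p \<le> v * real (nat \<lceil>d p\<rceil>)" using dn v by (intro mult_left_mono) auto
      then have "2 * ln (real p) \<le> v * real (nat \<lceil>d p\<rceil>)" using d2 by linarith
      then show ?thesis by simp
    qed
    also have "\<dots> = 1 / (real p * real p)"
      using elim by (simp add: exp_minus exp_double[of "ln (real p)"] power2_eq_square field_simps)
    finally have "real p * \<theta> ^ nat \<lceil>d p\<rceil> \<le> real p * (1 / (real p * real p))" by (intro mult_left_mono) auto
    then show ?case using elim by simp
  qed
  show "(\<lambda>p. 1 / real p) \<longlonglongrightarrow> 0" by (rule lim_1_over_n)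
qed (use \<theta> in auto)

text \<open>First the dimension tends to infinity for fixed \<open>K\<close>, then \<open>K\<close>
  does.\<close>

lemma limsup_le_mills:
  fixes f :: "nat \<Rightarrow> real"
  assumes "\<And>K. 1 \<le> K \<Longrightarrow> \<exists>g. (\<forall>\<^sub>F p in sequentially. f p \<le> g p) \<and> g \<longlonglongrightarrow> mills_factor K t"
  shows "limsup (\<lambda>p. ereal (f p)) \<le> ereal (exp (- t))"
proof -
  have le: "limsup (\<lambda>p. ereal (f p)) \<le> ereal (mills_factor K t)" if K: "1 \<le> K" for K
  proof -
    obtain g where g: "\<forall>\<^sub>F p in sequentially. f p \<le> g p" "g \<longlonglongrightarrow> mills_factor K t" using assms[OF K] by blast
    have "limsup (\<lambda>p. ereal (f p)) \<le> limsup (\<lambda>p. ereal (g p))" by (rule Limsup_mono) (use g(1) in simp)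
    also have "\<dots> = ereal (mills_factor K t)" by (rule lim_imp_Limsup) (use g(2) in simp_all)
    finally show ?thesis .
  qed
  have lim: "((\<lambda>K. ereal (mills_factor K t)) \<longlongrightarrow> ereal (exp (- t))) at_top"
    using mills_factor_tendsto[of t] by simp
  have ev: "\<forall>\<^sub>F K in at_top. limsup (\<lambda>p. ereal (f p)) \<le> ereal (mills_factor K t)"
    using eventually_ge_at_top[of 1] by eventually_elim (rule le)
  show ?thesis by (rule tendsto_lowerbound[OF lim ev]) simp
qed

text \<open>\<open>measure\<close> is 0 on sets that are not measurable, so upper bounds by
  measurable supersets remain valid for every \<open>A\<close>.\<close>

lemma measure_mono_measurable_bound:
  assumes "finite_measure M" "A \<subseteq> B" "B \<in> sets M"
  shows "measure M A \<le> measure M B"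
proof (cases "A \<in> sets M")
  case True
  then show ?thesis using assms by (intro finite_measure.finite_measure_mono) auto
qed (simp add: measure_notin_sets)

theorem theorem3:
  fixes M :: "nat \<Rightarrow> 'a measure"
    and n :: "nat \<Rightarrow> nat"
    and X :: "nat \<Rightarrow> real mat"
    and \<beta> :: "nat \<Rightarrow> real vec"
    and \<epsilon> :: "nat \<Rightarrow> nat \<Rightarrow> 'a \<Rightarrow> real"
    and y :: "nat \<Rightarrow> 'a \<Rightarrow> real vec"
    and R :: "nat \<Rightarrow> real mat"
    and \<sigma> \<eta> C \<delta> :: real
    and k0 p0 :: nat
    and A0 :: "nat \<Rightarrow> nat set"
    and s0 :: "nat \<Rightarrow> real vec"
    and d :: "nat \<Rightarrow> real"
  assumes X: "\<And>p. p \<ge> p0 \<Longrightarrow> X p \<in> carrier_mat (n p) p"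
    and gp: "\<And>p. p \<ge> p0 \<Longrightarrow> general_position (X p)"
    and M: "\<And>p. p \<ge> p0 \<Longrightarrow> prob_space (M p)"
    and \<sigma>: "\<sigma> > 0"
    and noise_indep: "\<And>p. p \<ge> p0 \<Longrightarrow>
          prob_space.indep_vars (M p) (\<lambda>_. borel) (\<epsilon> p) {..<n p}"
    and noise_normal: "\<And>p i. p \<ge> p0 \<Longrightarrow> i < n p \<Longrightarrow>
          distributed (M p) lborel (\<epsilon> p i) (normal_density 0 \<sigma>)"
    and \<beta>: "\<And>p. p \<ge> p0 \<Longrightarrow> \<beta> p \<in> carrier_vec p"
    and y_def: "\<And>p \<omega>. y p \<omega> = X p *\<^sub>v \<beta> p + vec (n p) (\<lambda>i. \<epsilon> p i \<omega>)"
    and A0: "\<And>p. p \<ge> p0 \<Longrightarrow> A0 p \<subseteq> {..<p}"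
    and supp_\<beta>: "\<And>p. p \<ge> p0 \<Longrightarrow> supp (\<beta> p) \<subseteq> A0 p"
    and s0: "\<And>p. p \<ge> p0 \<Longrightarrow> s0 p \<in> carrier_vec (card (A0 p))"
            "\<And>p i. p \<ge> p0 \<Longrightarrow> i < card (A0 p) \<Longrightarrow> s0 p $ i \<in> {-1, 1}"
    and prob_B: "(\<lambda>p. \<P>(\<omega> in M p. event_B (X p) (y p \<omega>) k0 (A0 p) (s0 p))) \<longlonglongrightarrow> 1"
    and \<eta>: "0 < \<eta>" "\<eta> \<le> 1"
    and irrep: "\<And>p j. p \<ge> p0 \<Longrightarrow> j \<in> {..<p} - A0 p \<Longrightarrow>
          l1_norm (pinv (sub_cols (X p) (A0 p)) *\<^sub>v col (X p) j) \<le> 1 - \<eta>"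
    and R_def: "\<And>p. R p = resid_gram (X p) (A0 p)"
    and C: "C > 0"
    and R_nz: "\<And>p j. p \<ge> p0 \<Longrightarrow> j \<in> {..<p} - A0 p \<Longrightarrow> R p $$ (j, j) \<noteq> 0"
    and R_diag: "\<And>p i j. p \<ge> p0 \<Longrightarrow> i \<in> {..<p} - A0 p \<Longrightarrow> j \<in> {..<p} - A0 p \<Longrightarrow>
          R p $$ (i, i) / R p $$ (j, j) \<le> C"
    and \<delta>: "\<delta> > 0"
    and S: "\<And>p j. p \<ge> p0 \<Longrightarrow> j \<in> {..<p} - A0 p \<Longrightarrow>
          \<exists>S \<subseteq> {..<p} - (A0 p \<union> {j}).
            real (card S) \<ge> d p \<and>
            (\<forall>i\<in>S.
              invertible_mat (submatrix (R p) (S - {i}) (S - {i})) \<and>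
              schur_compl (R p) (S - {i}) i / R p $$ (i, i) \<ge> \<delta>\<^sup>2 \<and>
              \<bar>R p $$ (i, j)\<bar> / R p $$ (j, j) < \<eta> / (2 - \<eta>) \<and>
              l1_norm (pinv (sub_cols (X p) (A0 p \<union> {j})) *\<^sub>v col (X p) i) < 1)"
    and d: "filterlim (\<lambda>p. d p / ln (real p)) at_top sequentially"
  shows "(\<forall>t\<ge>0. limsup (\<lambda>p. ereal (\<P>(\<omega> in M p.
            cov_test (X p) (y p \<omega>) \<sigma> (k0 + 1) > t))) \<le> ereal (exp (- t))) \<and>
         (\<forall>t\<ge>0. limsup (\<lambda>p. ereal (\<P>(\<omega> in M p.
            cov_test (X p) (y p \<omega>) \<sigma> (k0 + 1) > t \<bar>
            event_B (X p) (y p \<omega>) k0 (A0 p) (s0 p)))) \<le> ereal (exp (- t)))"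
proof -
  have per_p: "\<exists>U\<in>sets (M p). measure (M p) U \<le> mills_factor K t + 4 * (real p * (1 - upper_tail ((2 * K / \<eta> + 2) * sqrt C / \<delta>)) ^ nat \<lceil>d p\<rceil>) \<and>
     (\<forall>\<omega>\<in>space (M p). event_B (X p) (y p \<omega>) k0 (A0 p) (s0 p) \<and> t < cov_test (X p) (y p \<omega>) \<sigma> (k0 + 1) \<longrightarrow> \<omega> \<in> U)"
    if p: "p \<ge> p0" and dp: "0 < d p" and pB: "0 < \<P>(\<omega> in M p. event_B (X p) (y p \<omega>) k0 (A0 p) (s0 p))"
      and K: "1 \<le> K" and t: "0 \<le> t" for p K t
  proof -
    \<comment> \<open>A set of positive measure is nonempty; this yields the outcome required by
      \<open>cov_test_tail_bound\<close>.\<close>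
    have "{\<omega> \<in> space (M p). event_B (X p) (y p \<omega>) k0 (A0 p) (s0 p)} \<noteq> {}" using pB by (metis measure_empty less_irrefl)
    then obtain \<omega>0 where B0: "event_B (X p) (y p \<omega>0) k0 (A0 p) (s0 p)" by blast
    have S': "\<exists>S \<subseteq> {..<p} - (A0 p \<union> {j}). nat \<lceil>d p\<rceil> \<le> card S \<and> (\<forall>i\<in>S.
              invertible_mat (submatrix (R p) (S - {i}) (S - {i})) \<and>
              schur_compl (R p) (S - {i}) i / R p $$ (i, i) \<ge> \<delta>\<^sup>2 \<and> \<bar>R p $$ (i, j)\<bar> / R p $$ (j, j) < \<eta> / (2 - \<eta>))"
      if j: "j \<in> {..<p} - A0 p" for j
    proof -
      from S[OF p j] obtain S where S': "S \<subseteq> {..<p} - (A0 p \<union> {j})" "d p \<le> real (card S)" "\<forall>i\<in>S.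
              invertible_mat (submatrix (R p) (S - {i}) (S - {i})) \<and>
              schur_compl (R p) (S - {i}) i / R p $$ (i, i) \<ge> \<delta>\<^sup>2 \<and>
              \<bar>R p $$ (i, j)\<bar> / R p $$ (j, j) < \<eta> / (2 - \<eta>) \<and>
              l1_norm (pinv (sub_cols (X p) (A0 p \<union> {j})) *\<^sub>v col (X p) i) < 1" by blast
      have "nat \<lceil>d p\<rceil> \<le> card S" using S'(2) by linarith
      then show ?thesis using S'(1,3) by (intro exI[of _ S]) blast
    qed
    have D: "0 < nat \<lceil>d p\<rceil>" using dp by simp
    show ?thesis
      using cov_test_tail_bound[where y="y p" and t=t and K=K, OF X[OF p] gp[OF p] M[OF p] \<sigma> noise_indep[OF p] noise_normal[OF p] \<beta>[OF p] y_def
        A0[OF p] supp_\<beta>[OF p] s0(1)[OF p] s0(2)[OF p] B0 \<eta> irrep[OF p] R_def C R_nz[OF p] R_diag[OF p] \<delta> S' D K t]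
      by (simp only: mult.assoc)
  qed
  define PB where "PB = (\<lambda>p. \<P>(\<omega> in M p. event_B (X p) (y p \<omega>) k0 (A0 p) (s0 p)))"
  have PB: "PB \<longlonglongrightarrow> 1" using prob_B by (simp add: PB_def)
  define b where "b = (\<lambda>K t p. mills_factor K t + 4 * (real p * (1 - upper_tail ((2 * K / \<eta> + 2) * sqrt C / \<delta>)) ^ nat \<lceil>d p\<rceil>))"
  have b: "b K t \<longlonglongrightarrow> mills_factor K t" for K t
  proof -
    have "(\<lambda>p. real p * (1 - upper_tail ((2 * K / \<eta> + 2) * sqrt C / \<delta>)) ^ nat \<lceil>d p\<rceil>) \<longlonglongrightarrow> 0"
      using upper_tail_pos upper_tail_le_1 d by (intro power_decay_bound) auto
    from tendsto_add[OF tendsto_const tendsto_mult[OF tendsto_const this, of 4], of "mills_factor K t"]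
    show ?thesis by (simp add: b_def)
  qed
  have "\<forall>\<^sub>F p in sequentially. 1 \<le> d p / ln (real p)" using d by (simp add: filterlim_at_top)
  then have dpos: "\<forall>\<^sub>F p in sequentially. 0 < d p"
    using eventually_gt_at_top[of 1]
  proof eventually_elim
    case (elim p)
    have "0 < ln (real p)" using elim(2) by simp
    moreover have "0 < d p / ln (real p)" using elim(1) by linarith
    ultimately show ?case by (simp add: zero_less_divide_iff)
  qed
  have "\<forall>\<^sub>F p in sequentially. 0 < PB p" using order_tendstoD(1)[OF PB, of 0] by simp
  with dpos eventually_ge_at_top[of p0]
  have good: "\<forall>\<^sub>F p in sequentially. p0 \<le> p \<and> 0 < d p \<and> 0 < PB p" by eventually_elim simp
  have bounds: "\<P>(\<omega> in M p. cov_test (X p) (y p \<omega>) \<sigma> (k0 + 1) > t) \<le> b K t p + (1 - PB p)"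
    "\<P>(\<omega> in M p. cov_test (X p) (y p \<omega>) \<sigma> (k0 + 1) > t \<bar> event_B (X p) (y p \<omega>) k0 (A0 p) (s0 p)) \<le> b K t p / PB p"
    if p: "p0 \<le> p \<and> 0 < d p \<and> 0 < PB p" and K: "1 \<le> K" and t: "0 \<le> t" for p K t
  proof -
    interpret prob_space "M p" using M p by simp
    define EB where "EB = {\<omega> \<in> space (M p). event_B (X p) (y p \<omega>) k0 (A0 p) (s0 p)}"
    have PBE: "PB p = measure (M p) EB" by (simp add: PB_def EB_def)
    \<comment> \<open>Positive measure also implies measurability, as nonmeasurable sets get the
      value 0.\<close>
    have EB: "EB \<in> sets (M p)" using p measure_notin_sets[of EB "M p"] unfolding PBE by force
    obtain U where U: "U \<in> sets (M p)" "measure (M p) U \<le> b K t p"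
      "\<And>\<omega>. \<omega> \<in> space (M p) \<Longrightarrow> event_B (X p) (y p \<omega>) k0 (A0 p) (s0 p) \<Longrightarrow> t < cov_test (X p) (y p \<omega>) \<sigma> (k0 + 1) \<Longrightarrow> \<omega> \<in> U"
      using per_p[of p K t] p K t unfolding b_def PB_def by blast
    \<comment> \<open>Outside B nothing is known about the statistic; the complement costs 1 -
      \<open>PB p\<close>, which tends to 0.\<close>
    have "\<P>(\<omega> in M p. cov_test (X p) (y p \<omega>) \<sigma> (k0 + 1) > t) \<le> measure (M p) (U \<union> (space (M p) - EB))"
      using U EB by (intro measure_mono_measurable_bound finite_measure_axioms) (auto simp: EB_def)
    also have "\<dots> \<le> measure (M p) U + measure (M p) (space (M p) - EB)" using U EB by (intro measure_Un_le) auto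
    also have "measure (M p) (space (M p) - EB) = 1 - PB p" unfolding PBE using EB by (rule prob_compl)
    finally show "\<P>(\<omega> in M p. cov_test (X p) (y p \<omega>) \<sigma> (k0 + 1) > t) \<le> b K t p + (1 - PB p)" using U(2) by simp
    have "\<P>(\<omega> in M p. cov_test (X p) (y p \<omega>) \<sigma> (k0 + 1) > t \<and> event_B (X p) (y p \<omega>) k0 (A0 p) (s0 p)) \<le> measure (M p) U"
      using U by (intro measure_mono_measurable_bound finite_measure_axioms) auto
    then have "\<P>(\<omega> in M p. cov_test (X p) (y p \<omega>) \<sigma> (k0 + 1) > t \<and> event_B (X p) (y p \<omega>) k0 (A0 p) (s0 p)) \<le> b K t p" using U(2) by simp
    then show "\<P>(\<omega> in M p. cov_test (X p) (y p \<omega>) \<sigma> (k0 + 1) > t \<bar> event_B (X p) (y p \<omega>) k0 (A0 p) (s0 p)) \<le> b K t p / PB p"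
      unfolding cond_prob_def PB_def using p by (intro divide_right_mono) (auto simp: PB_def)
  qed
  show ?thesis
  proof (intro conjI allI impI limsup_le_mills)
    fix t K :: real assume t: "0 \<le> t" and K: "1 \<le> K"
    have "\<forall>\<^sub>F p in sequentially. \<P>(\<omega> in M p. cov_test (X p) (y p \<omega>) \<sigma> (k0 + 1) > t) \<le> b K t p + (1 - PB p)"
      using good by eventually_elim (rule bounds(1)[OF _ K t])
    moreover have "(\<lambda>p. b K t p + (1 - PB p)) \<longlonglongrightarrow> mills_factor K t"
      using tendsto_add[OF b[of K t] tendsto_diff[OF tendsto_const PB, of 1]] by simp
    ultimately show "\<exists>g. (\<forall>\<^sub>F p in sequentially. \<P>(\<omega> in M p. cov_test (X p) (y p \<omega>) \<sigma> (k0 + 1) > t) \<le> g p) \<and> g \<longlonglongrightarrow> mills_factor K t"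
      by (intro exI[of _ "\<lambda>p. b K t p + (1 - PB p)"]) simp
  next
    fix t K :: real assume t: "0 \<le> t" and K: "1 \<le> K"
    have "\<forall>\<^sub>F p in sequentially. \<P>(\<omega> in M p. cov_test (X p) (y p \<omega>) \<sigma> (k0 + 1) > t \<bar> event_B (X p) (y p \<omega>) k0 (A0 p) (s0 p)) \<le> b K t p / PB p"
      using good by eventually_elim (rule bounds(2)[OF _ K t])
    moreover have "(\<lambda>p. b K t p / PB p) \<longlonglongrightarrow> mills_factor K t"
      using tendsto_divide[OF b[of K t] PB] by simp
    ultimately show "\<exists>g. (\<forall>\<^sub>F p in sequentially. \<P>(\<omega> in M p. cov_test (X p) (y p \<omega>) \<sigma> (k0 + 1) > t \<bar> event_B (X p) (y p \<omega>) k0 (A0 p) (s0 p)) \<le> g p) \<and> g \<longlonglongrightarrow> mills_factor K t"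
      by (intro exI[of _ "\<lambda>p. b K t p / PB p"]) simp
  qed
qed

end
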